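(* Let $\mathbf{X}=\{\mathbf{x}^1,\ldots,\mathbf{x}^s\}$ be a linearly independent set of vectors in $\mathbb{R}^s$, let $M=[\mathbf{x}^1\cdots\mathbf{x}^s]$, let $\boldsymbol{\alpha}=(\alpha_1,\ldots,\alpha_s)$ with all $\alpha_k>0$ real, and let $\{\tilde{\mathbf{x}}^1,\ldots,\tilde{\mathbf{x}}^s\}$ be the dual basis to $\mathbf{X}$. Then the fractional cone spline $C_{\boldsymbol{\alpha}}(\cdot\mid\mathbf{X})$ is given by $$C_{\boldsymbol{\alpha}}(\mathbf{x}\mid\mathbf{X})=\frac{1}{|\det(M)|}\prod_{k=1}^s\frac{\langle\mathbf{x},\tilde{\mathbf{x}}^k\rangle_+^{\alpha_k-1}}{\Gamma(\alpha_k)}.$$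
   Context: Fourier transform convention: $\hat f(\boldsymbol{\omega})=\int f(\mathbf{x})e^{-i\langle\boldsymbol{\omega},\mathbf{x}\rangle}d\mathbf{x}$, extended to tempered distributions. Fractional cone spline: for linearly independent $\mathbf{x}^1,\ldots,\mathbf{x}^s\in\mathbb{R}^s$ and $\alpha_1,\ldots,\alpha_s>0$, $C_{\boldsymbol{\alpha}}(\cdot\mid\mathbf{X})$ is the tempered distribution on $\mathbb{R}^s$ with Fourier transform $$\widehat{C_{\boldsymbol{\alpha}}}(\boldsymbol{\omega}\mid\mathbf{X})=\prod_{k=1}^s\left(\frac{1}{i\langle\boldsymbol{\omega},\mathbf{x}^k\rangle}+\sigma_k\pi\,\delta(\langle\boldsymbol{\omega},\mathbf{x}^k\rangle)\right)^{\alpha_k},\qquad\sigma_k=\begin{cases}1,&\alpha_k\in\{1,2,3,\ldots\}\\0,&\text{otherwise.}\end{cases}$$ The product is the direct (tensor) product of one-variable distributions in the variables $\langle\boldsymbol{\omega},\mathbf{x}^k\rangle$. For integer $\alpha_k$ the factor is the Fourier transform of the $\alpha_k$-fold convolution of the Heaviside function with itself; for non-integer $\alpha_k$ it is the usual regularization (by analytic continuation in the exponent) of $(i\omega)^{-\alpha_k}$, principal branch. Equivalently, $\widehat{C_{\boldsymbol{\alpha}}}$ is the limit in the space of tempered distributions, as $\varepsilon\to0^+$, of $\prod_{k}(\varepsilon+i\langle\boldsymbol{\omega},\mathbf{x}^k\rangle)^{-\alpha_k}$ (principal branch). The dual basis is determined by $\langle\mathbf{x}^j,\tilde{\mathbf{x}}^k\rangle=\delta_{jk}$.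 For real $\beta>-1$, $x_+^{\beta}=x^\beta$ for $x>0$ and $x_+^\beta=0$ for $x<0$. The asserted equality means that the distribution is represented by the stated locally integrable function (equality almost everywhere). *)

theory Defs
  imports "HOL-Analysis.Analysis"
begin

primrec iter_deriv :: "'a list \<Rightarrow> ('a::euclidean_space \<Rightarrow> complex) \<Rightarrow> 'a \<Rightarrow> complex" where
  "iter_deriv [] f = f"
| "iter_deriv (b # bs) f = (\<lambda>x. frechet_derivative (iter_deriv bs f) (at x) b)"

text \<open>Total differentiability of all iterated partial derivatives is smoothness, and it ensures that
  \<^const>\<open>frechet_derivative\<close> above never takes an unspecified value.\<close>

definition schwartz :: "('a::euclidean_space \<Rightarrow> complex) set" where
  "schwartz = {f. \<forall>bs\<in>lists Basis.
      (\<forall>x. iter_deriv bs f differentiable at x) \<and>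
      (\<forall>m::nat. bounded (range (\<lambda>x. norm x ^ m *\<^sub>R iter_deriv bs f x)))}"

definition schwartz_norm :: "nat \<Rightarrow> ('a::euclidean_space \<Rightarrow> complex) \<Rightarrow> real" where
  "schwartz_norm N f = (\<Sum>bs | bs \<in> lists Basis \<and> length bs \<le> N.
      SUP x. (1 + norm x) ^ N * norm (iter_deriv bs f x))"

text \<open>A tempered distribution is a functional of which only the values on \<^const>\<open>schwartz\<close> matter;
  so two of them are equal if they agree there.  Continuity is with respect to the increasing
  family of norms \<^const>\<open>schwartz_norm\<close>.\<close>

definition tempered :: "(('a::euclidean_space \<Rightarrow> complex) \<Rightarrow> complex) \<Rightarrow> bool" where
  "tempered T \<longleftrightarrow>
     (\<forall>f\<in>schwartz. \<forall>g\<in>schwartz. T (\<lambda>x. f x + g x) = T f + T g) \<and>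
     (\<forall>c. \<forall>f\<in>schwartz. T (\<lambda>x. c * f x) = c * T f) \<and>
     (\<exists>N C. \<forall>f\<in>schwartz. norm (T f) \<le> C * schwartz_norm N f)"

definition fourier :: "('a::euclidean_space \<Rightarrow> complex) \<Rightarrow> 'a \<Rightarrow> complex" where
  "fourier f \<omega> = (LINT x|lborel. f x * exp (- \<i> * of_real (\<omega> \<bullet> x)))"

definition dist_fourier ::
  "(('a::euclidean_space \<Rightarrow> complex) \<Rightarrow> complex) \<Rightarrow> ('a \<Rightarrow> complex) \<Rightarrow> complex" where
  "dist_fourier T \<phi> = T (fourier \<phi>)"

definition dist_of_fun ::
  "('a::euclidean_space \<Rightarrow> real) \<Rightarrow> ('a \<Rightarrow> complex) \<Rightarrow> complex" where
  "dist_of_fun f \<phi> = (LINT x|lborel. of_real (f x) * \<phi> x)"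

definition represented_by ::
  "(('a::euclidean_space \<Rightarrow> complex) \<Rightarrow> complex) \<Rightarrow> ('a \<Rightarrow> real) \<Rightarrow> bool" where
  "represented_by T f \<longleftrightarrow>
     (\<forall>K. compact K \<longrightarrow> set_integrable lborel K f) \<and>
     (\<forall>\<phi>\<in>schwartz. integrable lborel (\<lambda>x. of_real (f x) * \<phi> x) \<and> T \<phi> = dist_of_fun f \<phi>)"

text \<open>Direct product of one-variable distributions: the tempered distribution determined by its
  values on products of one-variable test functions.\<close>

definition is_tensor_product ::
  "('n::finite \<Rightarrow> (real \<Rightarrow> complex) \<Rightarrow> complex) \<Rightarrow> ((real^'n \<Rightarrow> complex) \<Rightarrow> complex) \<Rightarrow> bool" where
  "is_tensor_product h T \<longleftrightarrow> tempered T \<and>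
     (\<forall>\<phi>. (\<forall>k. \<phi> k \<in> schwartz) \<longrightarrow>
        T (\<lambda>y. \<Prod>k\<in>UNIV. \<phi> k (y $ k)) = (\<Prod>k\<in>UNIV. h k (\<phi> k)))"

text \<open>The distribution \<open>T(A \<omega>)\<close> for a linear bijection \<open>A\<close>: if \<open>T\<close> is a function then substituting
  \<open>y = A \<omega>\<close> in the integral of \<open>T(A \<omega>) \<phi>(\<omega>)\<close> gives the formula.\<close>

definition dist_pullback ::
  "(real^'n \<Rightarrow> real^'n) \<Rightarrow> ((real^'n \<Rightarrow> complex) \<Rightarrow> complex) \<Rightarrow> (real^'n \<Rightarrow> complex) \<Rightarrow> complex" where
  "dist_pullback A T \<phi> = T (\<lambda>y. \<phi> (inv A y)) / of_real \<bar>det (matrix A)\<bar>"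

definition heaviside :: "real \<Rightarrow> real" where
  "heaviside x = (if x \<ge> 0 then 1 else 0)"

definition convolution :: "(real \<Rightarrow> real) \<Rightarrow> (real \<Rightarrow> real) \<Rightarrow> real \<Rightarrow> real" where
  "convolution f g x = (LINT y|lborel. f (x - y) * g y)"

text \<open>The \<open>m\<close>-fold convolution \<open>H * \<dots> * H\<close>, for \<open>m \<ge> 1\<close>.\<close>

definition heaviside_conv_power :: "nat \<Rightarrow> real \<Rightarrow> real" where
  "heaviside_conv_power m = (convolution heaviside ^^ (m - 1)) heaviside"

text \<open>The distribution \<open>(\<i>\<omega>)\<^sup>z\<close>: a locally integrable function if \<open>Re z > -1\<close>, continued
  analytically in \<open>z\<close> to the complement of \<open>{-1, -2, -3, \<dots>}\<close>.  This domain is connected, so the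
  continuation is unique.\<close>

definition i_omega_power :: "complex \<Rightarrow> (real \<Rightarrow> complex) \<Rightarrow> complex" where
  "i_omega_power z \<phi> = (THE v. \<exists>F. F holomorphic_on {w. w + 1 \<notin> \<int>\<^sub>\<le>\<^sub>0} \<and>
      (\<forall>w. Re w > -1 \<longrightarrow> F w = (LINT \<omega>|lborel. (\<i> * of_real \<omega>) powr w * \<phi> \<omega>)) \<and>
      v = F z)"

text \<open>The factor \<open>(1 / (\<i>\<omega>) + \<sigma> \<pi> \<delta>(\<omega>))\<^sup>a\<close> for \<open>a > 0\<close>.\<close>

definition cone_factor :: "real \<Rightarrow> (real \<Rightarrow> complex) \<Rightarrow> complex" where
  "cone_factor a = (if a \<in> \<nat>
     then dist_fourier (dist_of_fun (heaviside_conv_power (nat \<lfloor>a\<rfloor>)))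
     else i_omega_power (of_real (- a)))"

definition is_cone_spline ::
  "('n::finite \<Rightarrow> real) \<Rightarrow> ('n \<Rightarrow> real^'n) \<Rightarrow> ((real^'n \<Rightarrow> complex) \<Rightarrow> complex) \<Rightarrow> bool" where
  "is_cone_spline \<alpha> X C \<longleftrightarrow> tempered C \<and>
     (\<exists>T. is_tensor_product (\<lambda>k. cone_factor (\<alpha> k)) T \<and>
       (\<forall>\<phi>\<in>schwartz. dist_fourier C \<phi> = dist_pullback (\<lambda>\<omega>. \<chi> k. \<omega> \<bullet> X k) T \<phi>))"

definition trunc_power :: "real \<Rightarrow> real \<Rightarrow> real" where
  "trunc_power x \<beta> = (if x > 0 then x powr \<beta> else 0)"

end

theory Submission
  imports Defs "HOL-Probability.Probability" "HOL-Complex_Analysis.Complex_Analysis"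
begin

text \<open>
  Put \<open>A \<omega> = (\<omega> \<bullet> X k)\<^sub>k\<close> and \<open>B x = (x \<bullet> Xd k)\<^sub>k\<close>; since the two bases are dual, \<open>B\<close> is the inverse
  transpose of \<open>A\<close>.  Three facts make the formula true.

  \<^item> In one variable, the factor with exponent \<open>a\<close> is the Fourier transform of
    \<open>t\<^sub>+ powr (a - 1) / Gamma a\<close> (\<open>cone_factor_eq\<close>).  For natural \<open>a\<close> this is the formula for the
    iterated convolution of the Heaviside function.  For other \<open>a\<close> it is Euler's integral
    \<open>\<integral> x powr (z - 1) * exp (- s * x) = Gamma z * s powr (- z)\<close>, integrated against a test function
    \<open>\<phi>\<close> with \<open>s\<close> tending to the imaginary axis.  That proves the claim for exponents \<open>z\<close> in the strip
    \<open>0 < Re z < 1\<close>.  The pairing of \<open>t\<^sub>+ powr (z - 1) / Gamma z\<close> with \<open>fourier \<phi>\<close> is holomorphic for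
    \<open>Re z > 0\<close>, so it is the analytic continuation of the pairing of \<open>(\<i> * \<omega>) powr (- z)\<close> with \<open>\<phi>\<close>.

  \<^item> Hence the tensor product of the factors acts on \<open>\<psi>\<close> by integrating \<open>fourier \<psi>\<close> against the product
    density on the positive orthant (\<open>orthant_tensor_product\<close>), and a linear change of variables turns
    the pullback along \<open>A\<close> into the density transported along \<open>B\<close>.  Thus the claimed density is a cone
    spline (\<open>cone_spline_exists\<close>).

  \<^item> No other distribution is one.  The definition fixes a cone spline on the Fourier transforms of
    those Schwartz functions that are products in the coordinates \<open>A \<omega>\<close>.  Modulated Gaussians are such
    products, and their Fourier transforms are, up to constants, all translates and dilates of the Gaussian
    \<open>exp (- (norm (B x))\<^sup>2 / 2)\<close>.  A tempered distribution that vanishes on those vanishes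
    (\<open>tempered_vanishing_on_dilates\<close>): every Schwartz function is a limit of its convolutions with
    narrow Gaussians, and these are limits of Riemann sums of translates, both in the Schwartz norms.
\<close>

section \<open>Schwartz functions\<close>

lemma iter_deriv_append: "iter_deriv (bs @ cs) f = iter_deriv bs (iter_deriv cs f)"
  by (induction bs) auto

lemma schwartz_differentiable:
  assumes "f \<in> schwartz" "bs \<in> lists Basis"
  shows "iter_deriv bs f differentiable at x"
  using assms by (auto simp: schwartz_def)

text \<open>Passing between the weights \<open>norm x ^ m\<close> in the definition of Schwartz functions and
  \<open>(1 + norm x) ^ m\<close> in the norms costs only a constant.\<close>

lemma one_plus_power_le:
  fixes t :: real
  assumes "0 \<le> t"
  shows "(1 + t) ^ m \<le> 2 ^ m * (1 + t ^ m)"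
proof -
  have "1 + t \<le> 2 * max 1 t" by auto
  then have "(1 + t) ^ m \<le> (2 * max 1 t) ^ m"
    using assms by (intro power_mono) auto
  also have "\<dots> = 2 ^ m * (max 1 t) ^ m"
    by (simp add: power_mult_distrib)
  also have "(max 1 t) ^ m \<le> 1 + t ^ m"
    using assms by (auto simp: max_def)
  finally show ?thesis by simp
qed

lemma schwartz_bound:
  assumes "f \<in> schwartz" "bs \<in> lists Basis"
  obtains K where "0 \<le> K" "\<And>x. (1 + norm x) ^ m * norm (iter_deriv bs f x) \<le> K"
proof -
  have "bounded (range (\<lambda>x. norm x ^ k *\<^sub>R iter_deriv bs f x))" for k
    using assms by (auto simp: schwartz_def)
  then have *: "\<exists>K. \<forall>x. norm x ^ k * norm (iter_deriv bs f x) \<le> K" for k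
    by (auto simp: bounded_iff)
  obtain K0 where K0: "norm x ^ 0 * norm (iter_deriv bs f x) \<le> K0" for x using *[of 0] by auto
  obtain K1 where K1: "norm x ^ m * norm (iter_deriv bs f x) \<le> K1" for x using *[of m] by auto
  have "(1 + norm x) ^ m * norm (iter_deriv bs f x) \<le> 2 ^ m * (K0 + K1)" for x
  proof -
    have "(1 + norm x) ^ m * norm (iter_deriv bs f x)
        \<le> 2 ^ m * (1 + norm x ^ m) * norm (iter_deriv bs f x)"
      by (intro mult_right_mono one_plus_power_le) auto
    also have "\<dots> = 2 ^ m * (norm x ^ 0 * norm (iter_deriv bs f x) + norm x ^ m * norm (iter_deriv bs f x))"
      by (simp add: algebra_simps)
    also have "\<dots> \<le> 2 ^ m * (K0 + K1)"
      using K0[of x] K1[of x] by (intro mult_left_mono add_mono) auto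
    finally show ?thesis .
  qed
  moreover have "0 \<le> K0" "0 \<le> K1"
    using order.trans[OF _ K0[of 0]] order.trans[OF _ K1[of 0]] by auto
  ultimately show ?thesis using that[of "2 ^ m * (K0 + K1)"] by auto
qed

lemma schwartzI:
  assumes "\<And>bs x. bs \<in> lists Basis \<Longrightarrow> iter_deriv bs f differentiable at x"
    and "\<And>bs m. bs \<in> lists Basis \<Longrightarrow> \<exists>K. \<forall>x. (1 + norm x) ^ m * norm (iter_deriv bs f x) \<le> K"
  shows "f \<in> schwartz"
  unfolding schwartz_def
proof (intro CollectI ballI conjI allI assms(1))
  fix bs :: "'a list" and m :: nat
  assume bs: "bs \<in> lists Basis"
  from assms(2)[OF bs, of m] obtain K where
    K: "\<And>x. (1 + norm x) ^ m * norm (iter_deriv bs f x) \<le> K" by auto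
  have "norm (norm x ^ m *\<^sub>R iter_deriv bs f x) \<le> K" for x
  proof -
    have "norm x ^ m \<le> (1 + norm x) ^ m" by (intro power_mono) auto
    from mult_right_mono[OF this, of "norm (iter_deriv bs f x)"] K[of x] show ?thesis by simp
  qed
  then show "bounded (range (\<lambda>x. norm x ^ m *\<^sub>R iter_deriv bs f x))"
    unfolding bounded_iff by blast
qed

lemma iter_deriv_schwartz:
  assumes "f \<in> schwartz" "cs \<in> lists Basis"
  shows "iter_deriv cs f \<in> schwartz"
proof (rule schwartzI)
  fix bs :: "'a list" assume bs: "bs \<in> lists Basis"
  then have "bs @ cs \<in> lists Basis" using assms by auto
  note * = schwartz_differentiable[OF assms(1) this] schwartz_bound[OF assms(1) this]
  show "iter_deriv bs (iter_deriv cs f) differentiable at x" for x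
    using *(1) by (simp add: iter_deriv_append)
  show "\<exists>K. \<forall>x. (1 + norm x) ^ m * norm (iter_deriv bs (iter_deriv cs f) x) \<le> K" for m
    using *(2) by (metis iter_deriv_append)
qed

lemma iter_deriv_add_scale:
  assumes "f \<in> schwartz" "g \<in> schwartz" "bs \<in> lists Basis"
  shows "iter_deriv bs (\<lambda>x. f x + c * g x) = (\<lambda>x. iter_deriv bs f x + c * iter_deriv bs g x)"
  using assms(3)
proof (induction bs)
  case (Cons b bs)
  then have bs: "bs \<in> lists Basis" by auto
  have "frechet_derivative (\<lambda>x. iter_deriv bs f x + c * iter_deriv bs g x) (at x)
     = (\<lambda>h. frechet_derivative (iter_deriv bs f) (at x) h
          + c * frechet_derivative (iter_deriv bs g) (at x) h)" for x
  proof (rule frechet_derivative_at[symmetric])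
    show "((\<lambda>x. iter_deriv bs f x + c * iter_deriv bs g x) has_derivative
      (\<lambda>h. frechet_derivative (iter_deriv bs f) (at x) h
          + c * frechet_derivative (iter_deriv bs g) (at x) h)) (at x)"
      using schwartz_differentiable[OF assms(1) bs, of x]
            schwartz_differentiable[OF assms(2) bs, of x]
      unfolding frechet_derivative_works
      by (auto intro!: derivative_eq_intros)
  qed
  then show ?case using Cons.IH by simp
qed simp

lemma schwartz_add_scale:
  assumes "f \<in> schwartz" "g \<in> schwartz"
  shows "(\<lambda>x. f x + c * g x) \<in> schwartz"
proof (rule schwartzI)
  fix bs :: "'a list" assume bs: "bs \<in> lists Basis"
  note eq = iter_deriv_add_scale[OF assms bs, of c]
  show "iter_deriv bs (\<lambda>x. f x + c * g x) differentiable at x" for x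
    unfolding eq using schwartz_differentiable[OF assms(1) bs, of x]
            schwartz_differentiable[OF assms(2) bs, of x]
    by (intro differentiable_add differentiable_mult differentiable_const) auto
  fix m
  obtain K1 K2 where K: "0 \<le> K1" "\<And>x. (1 + norm x) ^ m * norm (iter_deriv bs f x) \<le> K1"
     "0 \<le> K2" "\<And>x. (1 + norm x) ^ m * norm (iter_deriv bs g x) \<le> K2"
    using schwartz_bound[OF assms(1) bs, of m] schwartz_bound[OF assms(2) bs, of m] by (metis (no_types, lifting))
  have "(1 + norm x) ^ m * norm (iter_deriv bs (\<lambda>x. f x + c * g x) x) \<le> K1 + norm c * K2" for x
  proof -
    have "(1 + norm x) ^ m * norm (iter_deriv bs f x + c * iter_deriv bs g x)
       \<le> (1 + norm x) ^ m * (norm (iter_deriv bs f x) + norm c * norm (iter_deriv bs g x))"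
      by (intro mult_left_mono norm_triangle_le) (auto simp: norm_mult)
    also have "\<dots> = (1 + norm x) ^ m * norm (iter_deriv bs f x) +
        norm c * ((1 + norm x) ^ m * norm (iter_deriv bs g x))"
      by (simp add: algebra_simps)
    also have "\<dots> \<le> K1 + norm c * K2"
      using K by (intro add_mono mult_left_mono) auto
    finally show ?thesis by (simp add: eq)
  qed
  then show "\<exists>K. \<forall>x. (1 + norm x) ^ m * norm (iter_deriv bs (\<lambda>x. f x + c * g x) x) \<le> K" by blast
qed

lemma iter_deriv_zero: "iter_deriv bs (\<lambda>x. 0) = (\<lambda>x. 0)"
  by (induction bs) auto

lemma schwartz_zero: "(\<lambda>x. 0) \<in> schwartz"
  by (rule schwartzI) (auto simp: iter_deriv_zero)

text \<open>Sums are the form in which Riemann sums of convolution integrals appear below.\<close>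

lemma schwartz_lincomb:
  assumes "finite V" "f \<in> schwartz" "\<And>v. v \<in> V \<Longrightarrow> g v \<in> schwartz"
  shows "(\<lambda>x. f x + (\<Sum>v\<in>V. c v * g v x)) \<in> schwartz \<and>
    (\<forall>bs\<in>lists Basis. iter_deriv bs (\<lambda>x. f x + (\<Sum>v\<in>V. c v * g v x)) =
       (\<lambda>x. iter_deriv bs f x + (\<Sum>v\<in>V. c v * iter_deriv bs (g v) x)))"
  using assms
proof (induction V)
  case (insert v V)
  let ?h = "\<lambda>x. f x + (\<Sum>v\<in>V. c v * g v x)"
  have h: "?h \<in> schwartz" "\<And>bs. bs\<in>lists Basis \<Longrightarrow>
      iter_deriv bs ?h = (\<lambda>x. iter_deriv bs f x + (\<Sum>v\<in>V. c v * iter_deriv bs (g v) x))"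
    using insert by auto
  have eq: "(\<lambda>x. f x + (\<Sum>v\<in>insert v V. c v * g v x)) = (\<lambda>x. ?h x + c v * g v x)"
    using insert.hyps by (auto simp: algebra_simps)
  have gv: "g v \<in> schwartz" using insert by auto
  show ?case
    unfolding eq using schwartz_add_scale[OF h(1) gv] iter_deriv_add_scale[OF h(1) gv] h(2) insert.hyps
    by (auto simp: algebra_simps fun_eq_iff)
qed auto

lemma schwartz_has_derivative:
  assumes "f \<in> schwartz" 
  shows "(f has_derivative frechet_derivative f (at x)) (at x)"
  using schwartz_differentiable[OF assms, of "[]" x] frechet_derivative_works by auto

lemma schwartz_continuous:
  assumes "f \<in> schwartz"
  shows "continuous_on S f"
  using schwartz_has_derivative[OF assms]
  by (meson continuous_at_imp_continuous_on has_derivative_continuous)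

lemma schwartz_measurable [measurable_dest]:
  assumes "f \<in> schwartz"
  shows "f \<in> borel_measurable borel"
  by (intro borel_measurable_continuous_onI schwartz_continuous assms)

lemma finite_multi_indices: "finite {bs. bs \<in> lists (Basis::'a::euclidean_space set) \<and> length bs \<le> N}"
proof -
  have "{bs. bs \<in> lists (Basis::'a set) \<and> length bs \<le> N}
      = {xs. set xs \<subseteq> (Basis::'a set) \<and> length xs \<le> N}" by (auto simp: lists_eq_set)
  then show ?thesis using finite_lists_length_le[of "Basis::'a set" N] by simp
qed

lemma schwartz_bdd_above:
  assumes "f \<in> schwartz" "bs \<in> lists Basis"
  shows "bdd_above (range (\<lambda>x. (1 + norm x) ^ N * norm (iter_deriv bs f x)))"
proof -
  obtain K where "\<And>x. (1 + norm x) ^ N * norm (iter_deriv bs f x) \<le> K"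
    using schwartz_bound[OF assms, of N] by blast
  then show ?thesis by (intro bdd_aboveI2)
qed

lemma schwartz_norm_upper:
  fixes f :: "'a::euclidean_space \<Rightarrow> complex"
  assumes "f \<in> schwartz" "bs \<in> lists Basis" "length bs \<le> N"
  shows "(1 + norm x) ^ N * norm (iter_deriv bs f x) \<le> schwartz_norm N f"
proof -
  note bdd = schwartz_bdd_above[OF assms(1)]
  have "(1 + norm x) ^ N * norm (iter_deriv bs f x)
      \<le> (SUP x. (1 + norm x) ^ N * norm (iter_deriv bs f x))"
    using bdd[OF assms(2)] by (intro cSUP_upper) auto
  also have "\<dots> \<le> schwartz_norm N f"
    unfolding schwartz_norm_def
  proof (rule member_le_sum)
    fix cs assume cs: "cs \<in> {bs \<in> lists (Basis::'a set). length bs \<le> N} - {bs}"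
    have "0 \<le> (1 + norm (0::'a)) ^ N * norm (iter_deriv cs f 0)" by simp
    also have "\<dots> \<le> (SUP x. (1 + norm x) ^ N * norm (iter_deriv cs f x))"
      using bdd[of cs] cs by (intro cSUP_upper) auto
    finally show "0 \<le> (SUP x. (1 + norm x) ^ N * norm (iter_deriv cs f x))" .
  qed (use assms finite_multi_indices in auto)
  finally show ?thesis .
qed

lemma schwartz_norm_least:
  fixes f :: "'a::euclidean_space \<Rightarrow> complex"
  assumes "\<And>bs x. bs \<in> lists Basis \<Longrightarrow> length bs \<le> N \<Longrightarrow> (1 + norm x) ^ N * norm (iter_deriv bs f x) \<le> \<eta>"
  shows "schwartz_norm N f \<le> real (card {bs. bs \<in> lists (Basis::'a set) \<and> length bs \<le> N}) * \<eta>"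
  unfolding schwartz_norm_def
  by (rule sum_bounded_above, rule cSUP_least) (use assms in auto)

lemma schwartz_norm_nonneg: "f \<in> schwartz \<Longrightarrow> 0 \<le> schwartz_norm N f"
  using order.trans[OF _ schwartz_norm_upper[of f "[]" N 0]] by auto

lemma schwartz_norm_mono:
  fixes f :: "'a::euclidean_space \<Rightarrow> complex"
  assumes f: "f \<in> schwartz" and nm: "n \<le> m"
  shows "schwartz_norm n f \<le> schwartz_norm m f"
proof -
  let ?t = "\<lambda>N bs. SUP x. (1 + norm x) ^ N * norm (iter_deriv bs f x)"
  note bdd = schwartz_bdd_above[OF f]
  have "schwartz_norm n f \<le> (\<Sum>bs | bs \<in> lists (Basis::'a set) \<and> length bs \<le> n. ?t m bs)"
    unfolding schwartz_norm_def
  proof (intro sum_mono cSUP_mono)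
    fix bs x assume "bs \<in> {bs. bs \<in> lists (Basis::'a set) \<and> length bs \<le> n}"
    then show "bdd_above (range (\<lambda>x. (1 + norm x) ^ m * norm (iter_deriv bs f x)))" by (intro bdd) auto
    show "\<exists>y\<in>UNIV. (1 + norm x) ^ n * norm (iter_deriv bs f x) \<le> (1 + norm y) ^ m * norm (iter_deriv bs f y)"
      using nm by (intro bexI[of _ x] mult_right_mono power_increasing) auto
  qed auto
  also have "\<dots> \<le> schwartz_norm m f"
    unfolding schwartz_norm_def
  proof (rule sum_mono2[OF finite_multi_indices])
    fix bs assume "bs \<in> {bs \<in> lists (Basis::'a set). length bs \<le> m} - {bs \<in> lists Basis. length bs \<le> n}"
    then have bs: "bs \<in> lists Basis" by auto
    have "0 \<le> (1 + norm (0::'a)) ^ m * norm (iter_deriv bs f 0)" by simp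
    also have "\<dots> \<le> ?t m bs" using bdd[OF bs] by (intro cSUP_upper) auto
    finally show "0 \<le> ?t m bs" .
  qed (use nm in auto)
  finally show ?thesis .
qed

lemma iter_deriv_dilation:
  fixes g :: "'a::euclidean_space \<Rightarrow> complex"
  assumes g: "g \<in> schwartz" and bs: "bs \<in> lists Basis"
  shows "iter_deriv bs (\<lambda>x. g (s *\<^sub>R (x - w))) = (\<lambda>x. of_real s ^ length bs * iter_deriv bs g (s *\<^sub>R (x - w)))"
  using bs
proof (induction bs)
  case (Cons b bs)
  then have bs: "bs \<in> lists Basis" by auto
  let ?G = "iter_deriv bs g"
  have "((\<lambda>x. of_real s ^ length bs * ?G (s *\<^sub>R (x - w))) has_derivative
      (\<lambda>h. of_real s ^ length bs * frechet_derivative ?G (at (s *\<^sub>R (x - w))) (s *\<^sub>R h))) (at x)" for x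
  proof (rule has_derivative_mult_right, rule has_derivative_compose[of "\<lambda>x. s *\<^sub>R (x - w)"])
    show "((\<lambda>x. s *\<^sub>R (x - w)) has_derivative (\<lambda>h. s *\<^sub>R h)) (at x)"
      by (auto intro!: derivative_eq_intros)
  qed (use schwartz_has_derivative[OF iter_deriv_schwartz[OF g bs]] in auto)
  from frechet_derivative_at[OF this, symmetric]
  have "frechet_derivative (\<lambda>x. of_real s ^ length bs * ?G (s *\<^sub>R (x - w))) (at x) b
     = of_real s ^ length bs * frechet_derivative ?G (at (s *\<^sub>R (x - w))) (s *\<^sub>R b)" for x
    by simp
  moreover have "frechet_derivative ?G (at y) (s *\<^sub>R b) = s *\<^sub>R frechet_derivative ?G (at y) b" for y
    using schwartz_has_derivative[OF iter_deriv_schwartz[OF g bs], of y]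
    by (simp add: linear_cmul has_derivative_linear)
  ultimately show ?case
    using Cons.IH by (simp add: scaleR_conv_of_real mult_ac)
qed simp

text \<open>With \<open>y = s *\<^sub>R (x - w)\<close> one has \<open>1 + norm x \<le> (1 + norm w + 1 / s) * (1 + norm y)\<close>, so that decay in
  \<open>y\<close> is decay in \<open>x\<close>.\<close>

lemma schwartz_dilation:
  fixes g :: "'a::euclidean_space \<Rightarrow> complex"
  assumes g: "g \<in> schwartz" and s: "0 < s"
  shows "(\<lambda>x. g (s *\<^sub>R (x - w))) \<in> schwartz"
proof (rule schwartzI)
  fix bs :: "'a list" assume bs: "bs \<in> lists Basis"
  note eq = iter_deriv_dilation[OF g bs, of s w]
  show "iter_deriv bs (\<lambda>x. g (s *\<^sub>R (x - w))) differentiable at x" for x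
    unfolding eq
  proof (intro differentiable_mult differentiable_const)
    show "(\<lambda>x. iter_deriv bs g (s *\<^sub>R (x - w))) differentiable at x"
      unfolding differentiable_def
    proof (rule exI, rule has_derivative_compose[of "\<lambda>x. s *\<^sub>R (x - w)"])
      show "((\<lambda>x. s *\<^sub>R (x - w)) has_derivative (\<lambda>h. s *\<^sub>R h)) (at x)"
        by (auto intro!: derivative_eq_intros)
    qed (rule schwartz_has_derivative[OF iter_deriv_schwartz[OF g bs]])
  qed
  fix m
  obtain K where K: "0 \<le> K" "\<And>x. (1 + norm x) ^ m * norm (iter_deriv bs g x) \<le> K"
    using schwartz_bound[OF g bs, of m] by metis
  define c where "c = 1 + norm w + 1 / s"
  have "(1 + norm x) ^ m * norm (iter_deriv bs (\<lambda>x. g (s *\<^sub>R (x - w))) x) \<le> c ^ m * (\<bar>s\<bar> ^ length bs * K)" for x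
  proof -
    define y where "y = s *\<^sub>R (x - w)"
    have "norm x \<le> norm (x - w) + norm w" by norm
    also have "norm (x - w) = norm y / s" using s by (simp add: y_def)
    finally have "norm x \<le> norm y / s + norm w" .
    moreover have "0 < 1 / s" using s by simp
    ultimately have "1 + norm x \<le> c + norm y / s" unfolding c_def by linarith
    also have "\<dots> \<le> c * (1 + norm y)"
    proof -
      have "1 / s \<le> c" by (simp add: c_def)
      from mult_right_mono[OF this, of "norm y"] show ?thesis by (simp add: algebra_simps)
    qed
    finally have "(1 + norm x) ^ m \<le> (c * (1 + norm y)) ^ m"
      by (intro power_mono) auto
    then have "(1 + norm x) ^ m * norm (iter_deriv bs g y) \<le> (c * (1 + norm y)) ^ m * norm (iter_deriv bs g y)"
      by (intro mult_right_mono) auto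
    also have "\<dots> = c ^ m * ((1 + norm y) ^ m * norm (iter_deriv bs g y))"
      by (simp add: power_mult_distrib)
    also have "\<dots> \<le> c ^ m * K" using s K(2)[of y] by (intro mult_left_mono) (auto simp: c_def)
    finally have "\<bar>s\<bar> ^ length bs * ((1 + norm x) ^ m * norm (iter_deriv bs g y)) \<le> \<bar>s\<bar> ^ length bs * (c ^ m * K)"
      by (intro mult_left_mono) auto
    then show ?thesis unfolding eq by (simp add: norm_mult norm_power y_def mult_ac)
  qed
  then show "\<exists>K. \<forall>x. (1 + norm x) ^ m * norm (iter_deriv bs (\<lambda>x. g (s *\<^sub>R (x - w))) x) \<le> K" by blast
qed

lemma tempered_diff:
  assumes S: "tempered S" and T: "tempered T"
  shows "tempered (\<lambda>f. S f - T f)"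
  unfolding tempered_def
proof (intro conjI ballI allI)
  show "S (\<lambda>x. f x + g x) - T (\<lambda>x. f x + g x) = (S f - T f) + (S g - T g)"
    if "f \<in> schwartz" "g \<in> schwartz" for f g
    using S T that by (simp add: tempered_def)
  show "S (\<lambda>x. c * f x) - T (\<lambda>x. c * f x) = c * (S f - T f)" if "f \<in> schwartz" for c f
    using S T that by (simp add: tempered_def right_diff_distrib)
  obtain N C where C: "\<And>f. f \<in> schwartz \<Longrightarrow> norm (S f) \<le> C * schwartz_norm N f"
    using S unfolding tempered_def by blast
  obtain M D where D: "\<And>f. f \<in> schwartz \<Longrightarrow> norm (T f) \<le> D * schwartz_norm M f"
    using T unfolding tempered_def by blast
  have "norm (S f - T f) \<le> (\<bar>C\<bar> + \<bar>D\<bar>) * schwartz_norm (max N M) f" if f: "f \<in> schwartz" for f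
  proof -
    have mono: "schwartz_norm n f \<le> schwartz_norm m f" if "n \<le> m" for n m
      by (rule schwartz_norm_mono[OF f that])
    have "norm (S f - T f) \<le> C * schwartz_norm N f + D * schwartz_norm M f"
      using C[OF f] D[OF f] by (intro order.trans[OF norm_triangle_ineq4] add_mono)
    also have "\<dots> \<le> \<bar>C\<bar> * schwartz_norm (max N M) f + \<bar>D\<bar> * schwartz_norm (max N M) f"
      by (intro add_mono mult_mono mono schwartz_norm_nonneg f) auto
    finally show ?thesis by (simp add: distrib_right)
  qed
  then show "\<exists>N C. \<forall>f\<in>schwartz. norm (S f - T f) \<le> C * schwartz_norm N f" by blast
qed

section \<open>Integration of Schwartz functions and decay of the Fourier transform\<close>

text \<open>Lebesgue measure is the image of the product measure under the coordinates of the basis, so this is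
  Fubini's theorem for products of one-variable functions.\<close>

lemma lborel_prod_coordinates:
  fixes f :: "'a::euclidean_space \<Rightarrow> real \<Rightarrow> 'c::{real_normed_field,banach,second_countable_topology}"
  assumes f: "\<And>b. b \<in> Basis \<Longrightarrow> integrable lborel (f b)"
  shows "integrable lborel (\<lambda>x. \<Prod>b\<in>Basis. f b (x \<bullet> b))"
    and "(LINT x|lborel. (\<Prod>b\<in>Basis. f b (x \<bullet> b))) = (\<Prod>b\<in>Basis. integral\<^sup>L lborel (f b))"
proof -
  interpret product_sigma_finite "\<lambda>_::'a. lborel :: real measure" by standard
  have m[measurable]: "b \<in> Basis \<Longrightarrow> f b \<in> borel_measurable borel" for b
    using f[of b] by (auto dest: borel_measurable_integrable)
  have T[measurable]: "(\<lambda>g. \<Sum>b\<in>Basis. g b *\<^sub>R b)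
      \<in> measurable (\<Pi>\<^sub>M b\<in>(Basis::'a set). (lborel::real measure)) (borel :: 'a measure)"
    by simp
  have g[measurable]: "(\<lambda>x::'a. \<Prod>b\<in>Basis. f b (x \<bullet> b)) \<in> borel_measurable borel"
    by measurable
  show "integrable lborel (\<lambda>x. \<Prod>b\<in>Basis. f b (x \<bullet> b))"
    apply (subst lborel_eq)
    apply (subst integrable_distr_eq[OF T g])
    using product_integrable_prod[OF finite_Basis f] by simp
  show "(LINT x|lborel. (\<Prod>b\<in>Basis. f b (x \<bullet> b))) = (\<Prod>b\<in>Basis. integral\<^sup>L lborel (f b))"
    apply (subst lborel_eq)
    apply (subst integral_distr[OF T g])
    using product_integral_prod[OF finite_Basis f] by simp
qed

lemma lborel_prod_components:
  fixes f :: "'n::finite \<Rightarrow> real \<Rightarrow> 'c::{real_normed_field,banach,second_countable_topology}"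
  assumes f: "\<And>k. integrable lborel (f k)"
  shows "integrable lborel (\<lambda>x::real^'n. \<Prod>k\<in>UNIV. f k (x $ k))"
    and "(LINT x|lborel. (\<Prod>k\<in>UNIV. f k ((x::real^'n) $ k))) = (\<Prod>k\<in>UNIV. integral\<^sup>L lborel (f k))"
proof -
  define e where "e = (\<lambda>k::'n. axis k (1::real))"
  have inj: "inj e" by (auto simp: e_def inj_def axis_eq_axis)
  have basis: "Basis = range e" by (auto simp: e_def Basis_vec_def)
  have inv: "inv e (e k) = k" for k by (simp add: inj)
  have eq: "(\<Prod>b\<in>Basis. h (inv e b) b) = (\<Prod>k\<in>UNIV. h k (e k))" for h :: "'n \<Rightarrow> real^'n \<Rightarrow> 'c"
    unfolding basis by (subst prod.reindex[OF inj]) (simp add: inv)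
  have "(\<Prod>b\<in>Basis. f (inv e b) (x \<bullet> b)) = (\<Prod>k\<in>UNIV. f k (x $ k))" for x
    using eq[of "\<lambda>k b. f k (x \<bullet> b)"] by (simp add: e_def inner_axis)
  then show "integrable lborel (\<lambda>x::real^'n. \<Prod>k\<in>UNIV. f k (x $ k))"
    "(LINT x|lborel. (\<Prod>k\<in>UNIV. f k ((x::real^'n) $ k))) = (\<Prod>k\<in>UNIV. integral\<^sup>L lborel (f k))"
    using lborel_prod_coordinates[of "\<lambda>b. f (inv e b)", OF f] eq[of "\<lambda>k b. integral\<^sup>L lborel (f k)"]
    by auto
qed

lemma lborel_integral_affine:
  fixes f :: "'a::euclidean_space \<Rightarrow> 'b::{banach,second_countable_topology}"
  assumes c: "c \<noteq> 0" and [measurable]: "f \<in> borel_measurable borel"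
  shows "integrable lborel (\<lambda>x. f (t + c *\<^sub>R x)) \<longleftrightarrow> integrable lborel f"
    and "(LINT x|lborel. f x) = \<bar>c\<bar> ^ DIM('a) *\<^sub>R (LINT x|lborel. f (t + c *\<^sub>R x))"
proof -
  have eq: "(lborel :: 'a measure) = density (distr lborel borel (\<lambda>x. t + c *\<^sub>R x)) (\<lambda>_. ennreal (\<bar>c\<bar> ^ DIM('a)))"
    using lborel_affine[OF c, of t] by (simp add: ennreal_power)
  have scale: "integrable lborel (\<lambda>x. k *\<^sub>R g x) \<longleftrightarrow> integrable lborel g"
    if "k \<noteq> 0" for k and g :: "'a \<Rightarrow> 'b"
    using that integrable_scaleR_right[of k lborel g]
      integrable_scaleR_right[of "inverse k" lborel "\<lambda>x. k *\<^sub>R g x"] by auto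
  show "integrable lborel (\<lambda>x. f (t + c *\<^sub>R x)) \<longleftrightarrow> integrable lborel f"
    using c by (subst (2) eq) (simp add: integrable_density integrable_distr_eq scale)
  show "(LINT x|lborel. f x) = \<bar>c\<bar> ^ DIM('a) *\<^sub>R (LINT x|lborel. f (t + c *\<^sub>R x))"
    using c by (subst eq) (simp add: integral_density integral_distr)
qed

text \<open>The exponent is chosen such that \<open>1 / weight x\<close> is dominated by the product of the one-variable
  functions \<open>1 / (1 + (x \<bullet> b)\<^sup>2)\<close> and is therefore integrable.\<close>

abbreviation weight :: "'a::euclidean_space \<Rightarrow> real" where
  "weight x \<equiv> (1 + norm x) ^ (2 * DIM('a))"

lemma integrable_weight: "integrable lborel (\<lambda>x::'a::euclidean_space. 1 / weight x)"
proof (rule Bochner_Integration.integrable_bound)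
  have "integrable lborel (\<lambda>t::real. inverse (1 + t\<^sup>2))"
    using integrable_inverse_1_plus_square by (simp add: set_integrable_def einterval_eq_UNIV)
  then show "integrable lborel (\<lambda>x::'a. \<Prod>b\<in>Basis. inverse (1 + (x \<bullet> b)\<^sup>2))"
    by (intro lborel_prod_coordinates)
  have "1 / weight x \<le> (\<Prod>b\<in>Basis. inverse (1 + (x \<bullet> b)\<^sup>2))" for x :: 'a
  proof -
    have "(\<Prod>b\<in>Basis. 1 + (x \<bullet> b)\<^sup>2) \<le> (\<Prod>b\<in>(Basis::'a set). (1 + norm x)\<^sup>2)"
    proof (intro prod_mono conjI)
      fix b :: 'a assume b: "b \<in> Basis"
      have "(x \<bullet> b)\<^sup>2 \<le> (norm x)\<^sup>2"
        using Basis_le_norm[OF b, of x] by (simp add: abs_le_square_iff[symmetric])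
      then show "1 + (x \<bullet> b)\<^sup>2 \<le> (1 + norm x)\<^sup>2"
        by (simp add: power2_sum add_increasing2)
    qed (simp add: add_nonneg_nonneg)
    also have "\<dots> = weight x" by (simp add: power_mult)
    finally have "(\<Prod>b\<in>Basis. 1 + (x \<bullet> b)\<^sup>2) \<le> weight x" .
    moreover have "0 < (\<Prod>b\<in>(Basis::'a set). 1 + (x \<bullet> b)\<^sup>2)"
      by (intro prod_pos) (simp add: add_pos_nonneg)
    ultimately have "inverse (weight x) \<le> inverse (\<Prod>b\<in>Basis. 1 + (x \<bullet> b)\<^sup>2)"
      by (intro le_imp_inverse_le)
    also have "\<dots> = (\<Prod>b\<in>Basis. inverse (1 + (x \<bullet> b)\<^sup>2))"
      by (induction rule: infinite_finite_induct) auto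
    finally show ?thesis by (simp add: inverse_eq_divide)
  qed
  then show "AE x::'a in lborel. norm (1 / weight x) \<le> norm (\<Prod>b\<in>Basis. inverse (1 + (x \<bullet> b)\<^sup>2))"
    by (intro AE_I2) (simp add: abs_prod prod_nonneg)
qed simp

lemma integrable_weight_bound:
  fixes f :: "'a::euclidean_space \<Rightarrow> 'b::{banach,second_countable_topology}"
  assumes [measurable]: "f \<in> borel_measurable borel" and K: "\<And>x. weight x * norm (f x) \<le> K"
  shows "integrable lborel f" "norm (integral\<^sup>L lborel f) \<le> K * (LINT x|lborel. 1 / weight (x::'a))"
proof -
  have le: "norm (f x) \<le> K * (1 / weight x)" for x
  proof -
    have "0 < weight x" by (simp add: add_pos_nonneg)
    then show ?thesis using K[of x] by (simp add: field_simps)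
  qed
  have i: "integrable lborel (\<lambda>x::'a. K * (1 / weight x))"
    using integrable_weight by (intro integrable_mult_right) auto
  have "norm (f x) \<le> norm (K * (1 / weight x))" for x
    using order.trans[OF le abs_ge_self] by simp
  then show f: "integrable lborel f"
    by (intro Bochner_Integration.integrable_bound[OF i]) auto
  have "norm (integral\<^sup>L lborel f) \<le> (LINT x|lborel. norm (f x))" by simp
  also have "\<dots> \<le> (LINT x|lborel. K * (1 / weight (x::'a)))"
    using f i le by (intro integral_mono) auto
  also have "\<dots> = K * (LINT x|lborel. 1 / weight (x::'a))"
    by (rule integral_mult_right_zero)
  finally show "norm (integral\<^sup>L lborel f) \<le> K * (LINT x|lborel. 1 / weight (x::'a))" .
qed

lemma difference_quotient_limit:
  fixes F :: "'a::real_normed_vector \<Rightarrow> 'b::real_normed_vector"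
  assumes der: "(F has_derivative F') (at x)"
  shows "((\<lambda>t. (F (x + t *\<^sub>R b) - F x) /\<^sub>R t) \<longlongrightarrow> F' b) (at 0)"
proof -
  have "((\<lambda>t. F (x + t *\<^sub>R b)) has_derivative (\<lambda>t. F' (t *\<^sub>R b))) (at 0)"
    by (rule has_derivative_compose[of "\<lambda>t. x + t *\<^sub>R b", where g = F])
       (auto intro!: derivative_eq_intros der)
  moreover have "F' (t *\<^sub>R b) = t *\<^sub>R F' b" for t
    using der by (auto simp: linear_cmul has_derivative_linear)
  ultimately have "((\<lambda>t. (F (x + t *\<^sub>R b) - F x - t *\<^sub>R F' b) /\<^sub>R norm t) \<longlongrightarrow> 0) (at 0)"
    by (simp add: has_derivative_def)
  then have "((\<lambda>t. norm ((F (x + t *\<^sub>R b) - F x - t *\<^sub>R F' b) /\<^sub>R norm t)) \<longlongrightarrow> 0) (at 0)"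
    by (rule tendsto_norm_zero)
  then have "((\<lambda>t. norm ((F (x + t *\<^sub>R b) - F x) /\<^sub>R t - F' b)) \<longlongrightarrow> 0) (at 0)"
  proof (rule Lim_transform_eventually)
    have "norm ((F (x + t *\<^sub>R b) - F x - t *\<^sub>R F' b) /\<^sub>R norm t)
        = norm ((F (x + t *\<^sub>R b) - F x) /\<^sub>R t - F' b)" if "t \<noteq> 0" for t
    proof -
      have "(F (x + t *\<^sub>R b) - F x) /\<^sub>R t - F' b = (F (x + t *\<^sub>R b) - F x - t *\<^sub>R F' b) /\<^sub>R t"
        using that by (simp add: scaleR_diff_right)
      then show ?thesis by simp
    qed
    then show "\<forall>\<^sub>F t in at 0. norm ((F (x + t *\<^sub>R b) - F x - t *\<^sub>R F' b) /\<^sub>R norm t)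
        = norm ((F (x + t *\<^sub>R b) - F x) /\<^sub>R t - F' b)"
      by (auto simp: eventually_at_filter)
  qed
  from LIM_zero_cancel[OF tendsto_norm_zero_cancel[OF this]] show ?thesis .
qed

lemma difference_quotient_bound:
  fixes F :: "'a::real_normed_vector \<Rightarrow> 'b::real_normed_vector"
  assumes der: "\<And>x. (F has_derivative F' x) (at x)" and h: "0 < h"
    and B: "\<And>t. 0 < t \<Longrightarrow> t < h \<Longrightarrow> norm (F' (x + t *\<^sub>R b) b) \<le> B"
  shows "norm ((F (x + h *\<^sub>R b) - F x) /\<^sub>R h) \<le> B"
proof -
  have vd: "((\<lambda>t. F (x + t *\<^sub>R b)) has_vector_derivative F' (x + t *\<^sub>R b) b) (at t)" for t
    unfolding has_vector_derivative_def
  proof (rule has_derivative_eq_rhs)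
    show "((\<lambda>t. F (x + t *\<^sub>R b)) has_derivative (\<lambda>s. F' (x + t *\<^sub>R b) (s *\<^sub>R b))) (at t)"
      by (rule has_derivative_compose[of "\<lambda>t. x + t *\<^sub>R b", where g = F])
         (auto intro!: derivative_eq_intros der)
    show "(\<lambda>s. F' (x + t *\<^sub>R b) (s *\<^sub>R b)) = (\<lambda>s. s *\<^sub>R F' (x + t *\<^sub>R b) b)"
      using der[of "x + t *\<^sub>R b"] by (auto simp: linear_cmul has_derivative_linear)
  qed
  have "norm (F (x + h *\<^sub>R b) - F (x + 0 *\<^sub>R b)) \<le> B * h - B * 0"
  proof (rule differentiable_bound_general[where f = "\<lambda>t. F (x + t *\<^sub>R b)" and \<phi> = "\<lambda>t. B * t" and a = 0 and b = h])
    show "continuous_on {0..h} (\<lambda>t. F (x + t *\<^sub>R b))"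
      using vd by (intro continuous_at_imp_continuous_on ballI has_vector_derivative_continuous)
    show "((\<lambda>t. B * t) has_vector_derivative B) (at t)" for t
      unfolding has_real_derivative_iff_has_vector_derivative[symmetric]
      by (auto intro!: derivative_eq_intros)
    show "continuous_on {0..h} (\<lambda>t. B * t)" by (intro continuous_intros)
  qed (use h vd B in auto)
  then have "norm (F (x + h *\<^sub>R b) - F x) / h \<le> B"
    using h by (subst pos_divide_le_eq) simp_all
  moreover have "norm ((F (x + h *\<^sub>R b) - F x) /\<^sub>R h) = norm (F (x + h *\<^sub>R b) - F x) / h"
    using h by (simp add: divide_inverse mult.commute)
  ultimately show ?thesis by simp
qed

text \<open>By translation invariance the integral of every difference quotient of \<open>F\<close> is zero, and dominated
  convergence carries this over to the derivative.\<close>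

lemma integral_derivative_eq_0:
  fixes F :: "'a::euclidean_space \<Rightarrow> complex"
  assumes der: "\<And>x. (F has_derivative F' x) (at x)" and F: "integrable lborel F"
    and b: "norm b \<le> 1" and K: "\<And>x. weight x * norm (F' x b) \<le> K"
  shows "(LINT x|lborel. F' x b) = 0"
proof -
  define h where "h = (\<lambda>n. 1 / (real (Suc n)))"
  have h: "0 < h n" "h n \<le> 1" for n by (auto simp: h_def)
  have h0: "h \<longlonglongrightarrow> 0" unfolding h_def by real_asymp
  define D where "D = (\<lambda>n x. (F (x + h n *\<^sub>R b) - F x) /\<^sub>R h n)"
  have "continuous_on UNIV F"
    using der by (meson continuous_at_imp_continuous_on has_derivative_continuous)
  then have Fm[measurable]: "F \<in> borel_measurable borel" by (rule borel_measurable_continuous_onI)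
  have Dm[measurable]: "D n \<in> borel_measurable borel" for n
    unfolding D_def by measurable
  have lim: "(\<lambda>n. D n x) \<longlonglongrightarrow> F' x b" for x
    unfolding D_def by (rule filterlim_compose[OF difference_quotient_limit[OF der]])
      (use h h0 in \<open>auto simp: filterlim_at less_imp_neq[symmetric]\<close>)
  have Dle: "norm (D n x) \<le> 4 ^ DIM('a) * K * (1 / weight x)" for n x
    unfolding D_def
  proof (rule difference_quotient_bound[OF der h(1)])
    fix t assume t: "0 < t" "t < h n"
    have "norm (t *\<^sub>R b) \<le> 1"
      using t h(2)[of n] b mult_mono[of t 1 "norm b" 1] by auto
    then have "norm x \<le> norm (x + t *\<^sub>R b) + 1"
      using norm_triangle_ineq4[of "x + t *\<^sub>R b" "t *\<^sub>R b"] by auto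
    then have "1 + norm x \<le> 2 * (1 + norm (x + t *\<^sub>R b))" 
      using norm_ge_zero[of "x + t *\<^sub>R b"] by (simp only: distrib_left mult_1_right)
    then have "weight x \<le> (2 * (1 + norm (x + t *\<^sub>R b))) ^ (2 * DIM('a))"
      by (intro power_mono) auto
    also have "\<dots> = 4 ^ DIM('a) * weight (x + t *\<^sub>R b)"
      by (simp only: power_mult_distrib) (simp add: power_mult)
    finally have "weight x * norm (F' (x + t *\<^sub>R b) b)
       \<le> 4 ^ DIM('a) * (weight (x + t *\<^sub>R b) * norm (F' (x + t *\<^sub>R b) b))"
      by (metis mult.assoc mult_right_mono norm_ge_zero)
    also have "\<dots> \<le> 4 ^ DIM('a) * K" by (intro mult_left_mono K) auto
    finally have *: "weight x * norm (F' (x + t *\<^sub>R b) b) \<le> 4 ^ DIM('a) * K" .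
    have "0 < weight x" by (simp add: add_pos_nonneg)
    with * show "norm (F' (x + t *\<^sub>R b) b) \<le> 4 ^ DIM('a) * K * (1 / weight x)"
      by (simp add: field_simps)
  qed
  have "(\<lambda>n. integral\<^sup>L lborel (D n)) \<longlonglongrightarrow> (LINT x|lborel. F' x b)"
  proof (rule integral_dominated_convergence[where w = "\<lambda>x. 4 ^ DIM('a) * K * (1 / weight x)"])
    show "integrable lborel (\<lambda>x::'a. 4 ^ DIM('a) * K * (1 / weight x))"
      using integrable_weight by (intro integrable_mult_right) auto
    show "(\<lambda>x. F' x b) \<in> borel_measurable lborel"
      by (rule borel_measurable_LIMSEQ_metric[where f = D]) (use lim in auto)
  qed (use lim Dle in auto)
  moreover have "integral\<^sup>L lborel (D n) = 0" for n
  proof -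
    have "integrable lborel (\<lambda>x. F (h n *\<^sub>R b + 1 *\<^sub>R x))"
      by (subst lborel_integral_affine) (auto simp: F)
    moreover have "integral\<^sup>L lborel F = (LINT x|lborel. F (h n *\<^sub>R b + 1 *\<^sub>R x))"
      by (subst lborel_integral_affine(2)[of 1 F "h n *\<^sub>R b"]) auto
    ultimately show ?thesis
      unfolding D_def using F by (simp add: add.commute)
  qed
  ultimately show ?thesis by (simp add: LIMSEQ_const_iff)
qed

lemma schwartz_integrable:
  assumes "f \<in> schwartz"
  shows "integrable lborel f"
proof -
  obtain K where "\<And>x. weight x * norm (iter_deriv [] f x) \<le> K"
    using schwartz_bound[OF assms, of "[]" "2 * DIM('a)"] by auto
  then show ?thesis using assms by (intro integrable_weight_bound(1)[of f K]) auto
qed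

lemma schwartz_directional_derivative:
  assumes "f \<in> schwartz" "b \<in> Basis"
  shows "(\<lambda>x. frechet_derivative f (at x) b) \<in> schwartz"
  using iter_deriv_schwartz[OF assms(1), of "[b]"] assms(2) by simp

lemma schwartz_fourier_integrable:
  fixes h :: "'a::euclidean_space \<Rightarrow> complex"
  assumes h: "h \<in> schwartz"
  shows "integrable lborel (\<lambda>x. h x * exp (- \<i> * of_real (y \<bullet> x)))"
proof -
  have [measurable]: "h \<in> borel_measurable borel" using h by auto
  show ?thesis
    by (rule Bochner_Integration.integrable_bound[OF schwartz_integrable[OF h]])
       (auto simp: norm_mult norm_exp_eq_Re)
qed

text \<open>The integral of the derivative of \<open>\<lambda>x. f x * exp (- \<i> * (y \<bullet> x))\<close> is zero; the product rule splits it
  into the two sides of the claim.\<close>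

lemma fourier_directional_derivative:
  fixes f :: "'a::euclidean_space \<Rightarrow> complex"
  assumes f: "f \<in> schwartz" and b: "b \<in> Basis"
  shows "fourier (\<lambda>x. frechet_derivative f (at x) b) y = \<i> * of_real (y \<bullet> b) * fourier f y"
proof -
  note g = schwartz_directional_derivative[OF f b]
  define e where "e = (\<lambda>x. exp (- \<i> * of_real (y \<bullet> x)))"
  have ne: "norm (e x) = 1" for x by (simp add: e_def norm_exp_eq_Re)
  have int: "integrable lborel (\<lambda>x. h x * e x)" if "h \<in> schwartz" for h
    unfolding e_def by (rule schwartz_fourier_integrable[OF that])
  define F' where "F' = (\<lambda>x h. f x * (e x * (- \<i> * of_real (y \<bullet> h))) + frechet_derivative f (at x) h * e x)"
  obtain K1 K2 where K: "\<And>x. weight x * norm (iter_deriv [] f x) \<le> K1"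
     "\<And>x. weight x * norm (iter_deriv [b] f x) \<le> K2"
    using schwartz_bound[OF f, of "[]" "2 * DIM('a)"] schwartz_bound[OF f, of "[b]" "2 * DIM('a)"] b
    by (metis Cons_in_lists_iff lists.Nil)
  have "(LINT x|lborel. F' x b) = 0"
  proof (rule integral_derivative_eq_0[where F = "\<lambda>x. f x * e x" and K = "K1 * norm y + K2"])
    fix x
    have "((\<lambda>x. - \<i> * complex_of_real (y \<bullet> x)) has_derivative (\<lambda>h. - \<i> * complex_of_real (y \<bullet> h))) (at x)"
      by (auto intro!: derivative_eq_intros)
    from has_derivative_compose[OF this DERIV_exp[unfolded has_field_derivative_def]]
    have "(e has_derivative (\<lambda>h. e x * (- \<i> * of_real (y \<bullet> h)))) (at x)"
      by (simp add: e_def)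
    from has_derivative_mult[OF schwartz_has_derivative[OF f] this]
    show "((\<lambda>x. f x * e x) has_derivative F' x) (at x)"
      unfolding F'_def .
  next
    show "integrable lborel (\<lambda>x. f x * e x)" by (rule int[OF f])
    show "norm b \<le> 1" using b by simp
    fix x
    have yb: "\<bar>y \<bullet> b\<bar> \<le> norm y" using Basis_le_norm[OF b, of y] by simp
    have "norm (F' x b) \<le> norm (f x) * norm y + norm (frechet_derivative f (at x) b)"
      unfolding F'_def by (rule norm_triangle_le) (auto simp: norm_mult ne intro!: add_mono mult_left_mono yb)
    then have "weight x * norm (F' x b) \<le> weight x * (norm (f x) * norm y + norm (frechet_derivative f (at x) b))"
      by (intro mult_left_mono) auto
    also have "\<dots> = (weight x * norm (f x)) * norm y + weight x * norm (frechet_derivative f (at x) b)"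
      by (simp add: algebra_simps)
    also have "\<dots> \<le> K1 * norm y + K2"
      using K(1)[of x] K(2)[of x] by (intro add_mono mult_right_mono) auto
    finally show "weight x * norm (F' x b) \<le> K1 * norm y + K2" .
  qed
  also have "(LINT x|lborel. F' x b)
      = (LINT x|lborel. (- \<i> * of_real (y \<bullet> b)) * (f x * e x) + frechet_derivative f (at x) b * e x)"
    unfolding F'_def by (simp add: algebra_simps)
  also have "\<dots> = (- \<i> * of_real (y \<bullet> b)) * (LINT x|lborel. f x * e x)
      + (LINT x|lborel. frechet_derivative f (at x) b * e x)"
    using int[OF f] int[OF g] by (subst Bochner_Integration.integral_add) auto
  finally show ?thesis
    unfolding fourier_def e_def by (simp add: algebra_simps eq_neg_iff_add_eq_0)
qed

lemma fourier_iter_deriv: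
  fixes f :: "'a::euclidean_space \<Rightarrow> complex"
  assumes f: "f \<in> schwartz" and b: "b \<in> Basis"
  shows "fourier (iter_deriv (replicate m b) f) y = (\<i> * of_real (y \<bullet> b)) ^ m * fourier f y"
proof (induction m)
  case (Suc m)
  have "iter_deriv (replicate m b) f \<in> schwartz"
    using b by (intro iter_deriv_schwartz f) (auto simp: in_lists_conv_set)
  from fourier_directional_derivative[OF this b, of y] Suc show ?case by simp
qed simp

lemma norm_fourier_le:
  fixes f :: "'a::euclidean_space \<Rightarrow> complex"
  assumes [measurable]: "f \<in> borel_measurable borel" and "\<And>x. weight x * norm (f x) \<le> K"
  shows "norm (fourier f y) \<le> K * (LINT x|lborel. 1 / weight (x::'a))"
  unfolding fourier_def
proof (rule integrable_weight_bound)
  show "(\<lambda>x. f x * exp (- \<i> * of_real (y \<bullet> x))) \<in> borel_measurable borel"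
    by measurable
  show "weight x * norm (f x * exp (- \<i> * of_real (y \<bullet> x))) \<le> K" for x
    using assms(2)[of x] by (simp add: norm_mult norm_exp_eq_Re)
qed

text \<open>The factor \<open>(y \<bullet> b) ^ m\<close> times \<open>fourier f y\<close> is the transform of an iterated derivative of \<open>f\<close>, which
  is bounded by a Schwartz norm.  Taking for \<open>b\<close> the direction of the largest coordinate of \<open>y\<close>
  controls \<open>norm y ^ m\<close>.  The constants do not depend on \<open>f\<close>, which gives continuity of the
  distributions below.\<close>

lemma fourier_decay:
  obtains N C where "0 \<le> C" "\<And>(f::'a::euclidean_space \<Rightarrow> complex) y. f \<in> schwartz \<Longrightarrow>
     (1 + norm y) ^ m * norm (fourier f y) \<le> C * schwartz_norm N f"
proof -
  define W where "W = (LINT x|lborel. 1 / weight (x::'a))"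
  have W: "0 \<le> W" unfolding W_def by (intro integral_nonneg_AE) simp
  \<comment> \<open>derivatives of order up to \<open>m\<close>, and \<open>2 * DIM('a)\<close> powers to make them integrable\<close>
  define N where "N = m + 2 * DIM('a)"
  define D where "D = real DIM('a)"
  have "(1 + norm y) ^ m * norm (fourier f y) \<le> (2 ^ m * (1 + D ^ m) * W) * schwartz_norm N f"
    if f: "f \<in> schwartz" for f :: "'a \<Rightarrow> complex" and y
  proof -
    have *: "\<bar>y \<bullet> b\<bar> ^ k * norm (fourier f y) \<le> W * schwartz_norm N f" 
      if b: "b \<in> Basis" and k: "k \<le> m" for b k
    proof -
      have bs: "replicate k b \<in> lists Basis" using b by (auto simp: in_lists_conv_set)
      have "norm (fourier (iter_deriv (replicate k b) f) y) \<le> schwartz_norm N f * W"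
        unfolding W_def
      proof (rule norm_fourier_le)
        show "iter_deriv (replicate k b) f \<in> borel_measurable borel"
          using iter_deriv_schwartz[OF f bs] by auto
        fix x :: 'a
        have "weight x \<le> (1 + norm x) ^ N"
          by (intro power_increasing) (auto simp: N_def)
        then have "weight x * norm (iter_deriv (replicate k b) f x)
            \<le> (1 + norm x) ^ N * norm (iter_deriv (replicate k b) f x)"
          by (intro mult_right_mono) auto
        also have "\<dots> \<le> schwartz_norm N f"
          using k by (intro schwartz_norm_upper f bs) (auto simp: N_def)
        finally show "weight x * norm (iter_deriv (replicate k b) f x) \<le> schwartz_norm N f" .
      qed
      then show ?thesis
        by (simp add: fourier_iter_deriv[OF f b] norm_mult norm_power mult.commute)
    qed
    obtain b0 where b0: "b0 \<in> Basis" "\<And>b. b \<in> Basis \<Longrightarrow> \<bar>y \<bullet> b\<bar> \<le> \<bar>y \<bullet> b0\<bar>"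
    proof -
      have "Max ((\<lambda>b. \<bar>y \<bullet> b\<bar>) ` Basis) \<in> (\<lambda>b. \<bar>y \<bullet> b\<bar>) ` Basis" by (intro Max_in) auto
      then obtain b0 where "b0 \<in> Basis" "Max ((\<lambda>b. \<bar>y \<bullet> b\<bar>) ` Basis) = \<bar>y \<bullet> b0\<bar>" by (elim imageE) simp
      then show ?thesis using Max_ge[of "(\<lambda>b. \<bar>y \<bullet> b\<bar>) ` Basis"] by (intro that[of b0]) auto
    qed
    have "norm y \<le> (\<Sum>b\<in>Basis. \<bar>y \<bullet> b\<bar>)" by (rule norm_le_l1)
    also have "\<dots> \<le> D * \<bar>y \<bullet> b0\<bar>"
      unfolding D_def by (rule sum_bounded_above) (rule b0)
    finally have y: "norm y \<le> D * \<bar>y \<bullet> b0\<bar>" .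
    have "(1 + norm y) ^ m * norm (fourier f y) \<le> 2 ^ m * (1 + norm y ^ m) * norm (fourier f y)"
      by (intro mult_right_mono one_plus_power_le) auto
    also have "\<dots> \<le> 2 ^ m * (1 + (D * \<bar>y \<bullet> b0\<bar>) ^ m) * norm (fourier f y)"
      by (intro mult_right_mono mult_left_mono add_left_mono power_mono y) auto
    also have "\<dots> = 2 ^ m * (\<bar>y \<bullet> b0\<bar> ^ 0 * norm (fourier f y) + D ^ m * (\<bar>y \<bullet> b0\<bar> ^ m * norm (fourier f y)))"
      by (simp add: power_mult_distrib algebra_simps)
    also have "\<dots> \<le> 2 ^ m * (W * schwartz_norm N f + D ^ m * (W * schwartz_norm N f))"
      by (intro mult_left_mono add_mono * b0) (auto simp: D_def)
    finally show ?thesis by (simp add: algebra_simps)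
  qed
  moreover have "0 \<le> 2 ^ m * (1 + D ^ m) * W" using W by (simp add: D_def)
  ultimately show ?thesis by (rule that[rotated])
qed

lemma fourier_measurable [measurable]:
  fixes f :: "'a::euclidean_space \<Rightarrow> complex"
  assumes [measurable]: "f \<in> borel_measurable borel"
  shows "fourier f \<in> borel_measurable borel"
proof -
  have "(\<lambda>y. LINT x|lborel. f x * exp (- \<i> * of_real (y \<bullet> x))) \<in> borel_measurable borel"
    by (rule lborel.borel_measurable_lebesgue_integral) measurable
  then show ?thesis unfolding fourier_def[abs_def] .
qed

lemma fourier_add:
  assumes "f \<in> schwartz" "g \<in> schwartz"
  shows "fourier (\<lambda>x. f x + g x) y = fourier f y + fourier g y"
  using schwartz_fourier_integrable[OF assms(1), of y] schwartz_fourier_integrable[OF assms(2), of y]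
  by (simp add: fourier_def distrib_right)

lemma fourier_product:
  fixes \<phi> :: "'n::finite \<Rightarrow> real \<Rightarrow> complex"
  assumes "\<And>k. \<phi> k \<in> schwartz"
  shows "fourier (\<lambda>x::real^'n. \<Prod>k\<in>UNIV. \<phi> k (x $ k)) y = (\<Prod>k\<in>UNIV. fourier (\<phi> k) (y $ k))"
proof -
  have i: "integrable lborel (\<lambda>t. \<phi> k t * exp (- \<i> * of_real (y $ k * t)))" for k
    using schwartz_fourier_integrable[OF assms, of k "y $ k"] by simp
  have "(\<Prod>k\<in>UNIV. \<phi> k (x $ k)) * exp (- \<i> * of_real (y \<bullet> x))
      = (\<Prod>k\<in>UNIV. \<phi> k (x $ k) * exp (- \<i> * of_real (y $ k * x $ k)))" for x
    by (simp add: inner_vec_def prod.distrib exp_sum[symmetric] sum_distrib_left sum_negf)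
  then show ?thesis
    unfolding fourier_def using lborel_prod_components(2)[OF i] by simp
qed

section \<open>Holomorphic dependence of integrals on a parameter\<close>

text \<open>Locally uniform domination suffices: Cauchy's inequality turns a bound for \<open>f\<close> on a disc into a
  Lipschitz bound on half of that disc, and so into a dominating function for the difference
  quotients.\<close>

lemma holomorphic_on_lebesgue_integral:
  fixes f :: "complex \<Rightarrow> 'a \<Rightarrow> complex"
  assumes S: "open S" and hol: "\<And>x. (\<lambda>z. f z x) holomorphic_on S"
    and meas: "\<And>z. z \<in> S \<Longrightarrow> f z \<in> borel_measurable M"
    and dom: "\<And>z. z \<in> S \<Longrightarrow> \<exists>r>0. \<exists>g. integrable M g \<and> (\<forall>w\<in>cball z r. \<forall>x. norm (f w x) \<le> g x)"
  shows "(\<lambda>z. LINT x|M. f z x) holomorphic_on S"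
proof (rule holomorphic_onI)
  fix z0 assume z0: "z0 \<in> S"
  obtain r1 g where r1: "0 < r1" and g: "integrable M g"
    and gb1: "\<And>w x. w \<in> cball z0 r1 \<Longrightarrow> norm (f w x) \<le> g x"
    using dom[OF z0] by blast
  obtain r2 where r2: "0 < r2" "cball z0 r2 \<subseteq> S"
    using S z0 open_contains_cball by blast
  define r where "r = min r1 r2"
  have r: "0 < r" "cball z0 r \<subseteq> S" and gb: "\<And>w x. w \<in> cball z0 r \<Longrightarrow> norm (f w x) \<le> g x"
    using r1 r2 gb1 by (auto simp: r_def)
  have int: "integrable M (f w)" if "w \<in> cball z0 r" for w
    by (rule Bochner_Integration.integrable_bound[OF g meas])
       (use that r gb[OF that] in \<open>auto intro: order.trans[OF _ abs_ge_self]\<close>)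
  define B where "B = ball z0 (r/2)"
  have Bc: "B \<subseteq> cball z0 r" unfolding B_def using r by (auto simp: subset_iff)
  have g0: "0 \<le> g x" for x using gb[of z0 x] r by (auto intro: order.trans[OF norm_ge_zero])
  have lip: "norm (f w x - f z0 x) \<le> 2 * g x / r * norm (w - z0)" if w: "w \<in> B" for w x
  proof (rule field_differentiable_bound[where S = B and f' = "deriv (\<lambda>z. f z x)"])
    show "convex B" "w \<in> B" "z0 \<in> B" using w r by (auto simp: B_def)
    fix v assume v: "v \<in> B"
    have sub: "cball v (r/2) \<subseteq> cball z0 r"
    proof
      fix u assume "u \<in> cball v (r/2)"
      then show "u \<in> cball z0 r"
        using v dist_triangle[of z0 u v] by (auto simp: B_def dist_commute)
    qed
    show "((\<lambda>z. f z x) has_field_derivative deriv (\<lambda>z. f z x) v) (at v within B)"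
      by (rule has_field_derivative_at_within[OF holomorphic_derivI[OF hol S]]) (use v Bc r(2) in blast)
    have "norm ((deriv ^^ 1) (\<lambda>z. f z x) v) \<le> fact 1 * g x / (r/2) ^ 1"
    proof (rule Cauchy_inequality)
      show "(\<lambda>z. f z x) holomorphic_on ball v (r/2)"
        using sub r hol[of x] by (meson ball_subset_cball holomorphic_on_subset subset_trans)
      show "continuous_on (cball v (r/2)) (\<lambda>z. f z x)"
        using sub r hol[of x] by (meson holomorphic_on_imp_continuous_on holomorphic_on_subset subset_trans)
      show "norm (f u x) \<le> g x" if "norm (v - u) = r/2" for u
        using that sub by (intro gb) (auto simp: subset_iff dist_norm)
    qed (use r in auto)
    then show "norm (deriv (\<lambda>z. f z x) v) \<le> 2 * g x / r" by (simp add: mult.commute)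
  qed
  let ?q = "\<lambda>w. ((LINT x|M. f w x) - (LINT x|M. f z0 x)) / (w - z0)"
  let ?D = "LINT x|M. deriv (\<lambda>z. f z x) z0"
  have "(?q \<longlongrightarrow> ?D) (at z0 within B)"
    unfolding tendsto_at_iff_sequentially
  proof (intro allI impI)
    fix X assume X: "\<forall>i. X i \<in> B - {z0}" "X \<longlonglongrightarrow> z0"
    define d where "d = (\<lambda>i x. (f (X i) x - f z0 x) / (X i - z0))"
    have Xc: "X i \<in> cball z0 r" for i using X Bc by auto
    have dm: "d i \<in> borel_measurable M" for i
      unfolding d_def using int[OF Xc[of i]] int[of z0] r by (intro borel_measurable_divide borel_measurable_diff) auto
    have lim: "(\<lambda>i. d i x) \<longlonglongrightarrow> deriv (\<lambda>z. f z x) z0" for x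
    proof -
      have "((\<lambda>z. f z x) has_field_derivative deriv (\<lambda>z. f z x) z0) (at z0)"
        using z0 S hol[of x] by (intro holomorphic_derivI) auto
      then have "((\<lambda>w. (f w x - f z0 x) / (w - z0)) \<longlongrightarrow> deriv (\<lambda>z. f z x) z0) (at z0)"
        by (simp add: has_field_derivative_iff)
      then show ?thesis
        unfolding d_def by (rule filterlim_compose) (use X in \<open>auto simp: filterlim_at\<close>)
    qed
    have "(\<lambda>i. integral\<^sup>L M (d i)) \<longlonglongrightarrow> ?D"
    proof (rule integral_dominated_convergence[where w = "\<lambda>x. 2 * g x / r"])
      show "(\<lambda>x. deriv (\<lambda>z. f z x) z0) \<in> borel_measurable M"
        by (rule borel_measurable_LIMSEQ_metric[where f = d]) (use lim dm in auto)
      show "integrable M (\<lambda>x. 2 * g x / r)" using g by auto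
      show "AE x in M. norm (d i x) \<le> 2 * g x / r" for i
      proof (rule AE_I2)
        fix x
        have "0 < norm (X i - z0)" using X by auto
        moreover have "norm (f (X i) x - f z0 x) \<le> 2 * g x / r * norm (X i - z0)"
          using X by (intro lip) auto
        ultimately show "norm (d i x) \<le> 2 * g x / r"
          by (simp add: d_def norm_divide divide_le_eq)
      qed
    qed (use lim dm in auto)
    moreover have "integral\<^sup>L M (d i) = ?q (X i)" for i
      unfolding d_def using int[OF Xc[of i]] int[of z0] r by simp
    ultimately show "(?q \<circ> X) \<longlonglongrightarrow> ?D" by (simp add: comp_def)
  qed
  moreover have "at z0 within B = at z0"
    by (rule at_within_open) (use r in \<open>auto simp: B_def\<close>)
  ultimately have "((\<lambda>z. LINT x|M. f z x) has_field_derivative ?D) (at z0)"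
    by (simp add: has_field_derivative_iff)
  then show "(\<lambda>z. LINT x|M. f z x) field_differentiable at z0 within S"
    using field_differentiable_at_within field_differentiable_def by blast
qed

section \<open>The one-variable factor of a cone spline\<close>

text \<open>The integrand of Euler's integral as a function on the whole line.  It vanishes for \<open>x \<le> 0\<close> since
  \<open>0 powr w = 0\<close>.\<close>

definition gamma_kernel :: "complex \<Rightarrow> complex \<Rightarrow> real \<Rightarrow> complex" where
  "gamma_kernel z s x = of_real (max x 0) powr (z - 1) * exp (- s * of_real x)"

lemma gamma_kernel_measurable [measurable]: "gamma_kernel z s \<in> borel_measurable borel"
  unfolding gamma_kernel_def[abs_def] powr_def by measurable

text \<open>Euler's integral for \<open>a = 1\<close>, rescaled.\<close>

lemma gamma_kernel_real:
  assumes z: "0 < Re z" and a: "0 < a"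
  shows "integrable lborel (gamma_kernel z (of_real a))"
    and "integral\<^sup>L lborel (gamma_kernel z (of_real a)) = Gamma z * of_real a powr (-z)"
proof -
  have int: "integrable lborel (gamma_kernel z (of_real a))" if a: "0 < a" for a
  proof -
    have "set_integrable lebesgue {0<..} (\<lambda>t. complex_of_real t powr (z - 1) / of_real (exp (a * t)))"
      by (rule absolutely_integrable_Gamma_integral[OF z a])
    moreover have "(\<lambda>t. indicator {0<..} t *\<^sub>R (complex_of_real t powr (z - 1) / of_real (exp (a * t)))) 
        = gamma_kernel z (of_real a)"
      by (auto simp: gamma_kernel_def fun_eq_iff max_def exp_minus divide_inverse) (metis exp_of_real of_real_mult)
    ultimately show ?thesis unfolding set_integrable_def by (simp add: integrable_completion)
  qed
  have one: "integral\<^sup>L lborel (gamma_kernel z 1) = Gamma z"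
  proof -
    have "((\<lambda>t. if t \<in> {0<..} then of_real t powr (z - 1) / of_real (exp t) else 0) has_integral Gamma z) UNIV"
      by (subst has_integral_restrict_UNIV) (rule Gamma_integral_complex'[OF z])
    also have "(\<lambda>t. if t \<in> {0<..} then complex_of_real t powr (z - 1) / of_real (exp t) else 0) = gamma_kernel z 1"
      by (auto simp: gamma_kernel_def fun_eq_iff max_def exp_minus exp_of_real divide_inverse)
    finally have "(gamma_kernel z 1 has_integral Gamma z) UNIV" .
    moreover have "(gamma_kernel z 1 has_integral integral\<^sup>L lborel (gamma_kernel z 1)) UNIV"
      using int[of 1] by (intro has_integral_integral_lborel) auto
    ultimately show ?thesis by (rule has_integral_unique[rotated])
  qed
  have "gamma_kernel z 1 (0 + a * x) = of_real a powr (z - 1) * gamma_kernel z (of_real a) x" for x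
    using a by (cases "0 < x") (auto simp: gamma_kernel_def max_def powr_times_real not_le zero_less_mult_iff mult_le_0_iff)
  then have "Gamma z = a *\<^sub>R (of_real a powr (z - 1) * integral\<^sup>L lborel (gamma_kernel z (of_real a)))"
    using a unfolding one[symmetric]
    by (subst lborel_integral_real_affine[of a _ 0]) auto
  also have "\<dots> = of_real a powr z * integral\<^sup>L lborel (gamma_kernel z (of_real a))"
    using a by (simp add: scaleR_conv_of_real powr_diff)
  finally show "integral\<^sup>L lborel (gamma_kernel z (of_real a)) = Gamma z * of_real a powr (-z)"
    using a by (simp add: powr_minus field_simps)
  show "integrable lborel (gamma_kernel z (of_real a))" by (rule int[OF a])
qed

lemma gamma_kernel_norm_mono:
  assumes "a \<le> Re s"
  shows "norm (gamma_kernel z s x) \<le> norm (gamma_kernel z (of_real a) x)"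
proof (cases "0 < x")
  case True
  then have "a * x \<le> Re s * x" using assms by (intro mult_right_mono) auto
  then show ?thesis by (auto simp: gamma_kernel_def norm_mult intro!: mult_left_mono)
qed (simp add: gamma_kernel_def)

text \<open>Both sides of the formula are holomorphic in the half-plane \<open>Re s > 0\<close> and agree on the positive real
  axis.\<close>

lemma gamma_kernel_integral:
  assumes z: "0 < Re z" and s: "0 < Re s"
  shows "integrable lborel (gamma_kernel z s)"
    and "integral\<^sup>L lborel (gamma_kernel z s) = Gamma z * s powr (-z)"
proof -
  show "integrable lborel (gamma_kernel z s)"
    by (rule Bochner_Integration.integrable_bound[OF gamma_kernel_real(1)[OF z s]])
       (auto intro: gamma_kernel_norm_mono)
  let ?S = "{s. 0 < Re s}"
  have hol: "(\<lambda>s. integral\<^sup>L lborel (gamma_kernel z s)) holomorphic_on ?S"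
  proof (rule holomorphic_on_lebesgue_integral)
    show "open ?S" by (rule open_halfspace_Re_gt)
    show "(\<lambda>s. gamma_kernel z s x) holomorphic_on ?S" for x
      unfolding gamma_kernel_def by (intro holomorphic_intros)
    fix s assume s: "s \<in> ?S"
    show "\<exists>r>0. \<exists>g. integrable lborel g \<and> (\<forall>w\<in>cball s r. \<forall>x. norm (gamma_kernel z w x) \<le> g x)"
    proof (intro exI conjI ballI allI)
      show "0 < Re s / 2" using s by simp
      then show "integrable lborel (\<lambda>x. norm (gamma_kernel z (of_real (Re s / 2)) x))"
        by (intro integrable_norm gamma_kernel_real z)
      fix w x assume w: "w \<in> cball s (Re s / 2)"
      then have "Re s - Re w \<le> Re s / 2"
        using abs_Re_le_cmod[of "s - w"] by (auto simp: dist_norm)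
      then show "norm (gamma_kernel z w x) \<le> norm (gamma_kernel z (of_real (Re s / 2)) x)"
        by (intro gamma_kernel_norm_mono) auto
    qed
  qed auto
  have "integral\<^sup>L lborel (gamma_kernel z s) - Gamma z * s powr (-z) = 0"
  proof (rule analytic_continuation[where S = ?S and U = "of_real ` {0<..}" and \<xi> = 1
      and f = "\<lambda>s. integral\<^sup>L lborel (gamma_kernel z s) - Gamma z * s powr (-z)"])
    show "(\<lambda>s. integral\<^sup>L lborel (gamma_kernel z s) - Gamma z * s powr (-z)) holomorphic_on ?S"
      by (intro holomorphic_intros hol) (auto simp: complex_nonpos_Reals_iff)
    show "open ?S" by (rule open_halfspace_Re_gt)
    show "connected ?S" by (intro convex_connected convex_halfspace_Re_gt)
    show "(1::complex) islimpt of_real ` {0<..}"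
      unfolding islimpt_sequential
    proof (intro exI conjI allI)
      have "(\<lambda>n. 1 + 1 / real (Suc n)) \<longlonglongrightarrow> 1" by real_asymp
      from tendsto_of_real[OF this, where 'a = complex]
      show "(\<lambda>n. of_real (1 + 1 / real (Suc n))) \<longlonglongrightarrow> (1::complex)"
        by (simp only: of_real_1)
      fix n
      have "0 < 1 / real (Suc n)" by simp
      then have "0 < 1 + 1 / real (Suc n)" "1 + 1 / real (Suc n) \<noteq> 1" by linarith+
      then show "of_real (1 + 1 / real (Suc n)) \<in> of_real ` {0<..} - {1::complex}"
        by (metis DiffI greaterThan_iff imageI of_real_eq_1_iff singletonD)
    qed
    show "of_real ` {0<..} \<subseteq> ?S" "1 \<in> ?S" "s \<in> ?S" using s by auto
    show "integral\<^sup>L lborel (gamma_kernel z w) - Gamma z * w powr (-z) = 0" if "w \<in> of_real ` {0<..}" for w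
      using that gamma_kernel_real(2)[OF z] by auto
  qed
  then show "integral\<^sup>L lborel (gamma_kernel z s) = Gamma z * s powr (-z)" by simp
qed

lemma integrable_powr_decay:
  assumes \<sigma>: "-1 < \<sigma>" "\<sigma> + 2 \<le> real m" "2 \<le> m"
  shows "integrable lborel (\<lambda>x::real. \<bar>x\<bar> powr \<sigma> / (1 + \<bar>x\<bar>) ^ m)"
proof -
  define k where "k = (\<lambda>x::real. indicator {0..1} x *\<^sub>R x powr \<sigma>)"
  have k: "integrable lborel k"
  proof -
    have "(\<lambda>x. x powr \<sigma>) absolutely_integrable_on {0..1}"
      by (rule nonnegative_absolutely_integrable_1) (use \<sigma> in \<open>auto intro: integrable_on_powr_from_0\<close>)
    then show ?thesis
      unfolding k_def set_integrable_def by (simp add: integrable_completion)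
  qed
  have k': "integrable lborel (\<lambda>x. k (0 + (-1) * x))"
    by (rule lborel_integrable_real_affine[OF k]) simp
  have w: "integrable lborel (\<lambda>x::real. 1 / (1 + \<bar>x\<bar>) ^ 2)"
    using integrable_weight[where 'a = real] by simp
  show ?thesis
  proof (rule Bochner_Integration.integrable_bound[OF Bochner_Integration.integrable_add[OF Bochner_Integration.integrable_add[OF k k'] w]])
    have "\<bar>x\<bar> powr \<sigma> / (1 + \<bar>x\<bar>) ^ m \<le> k x + k (0 + (-1) * x) + 1 / (1 + \<bar>x\<bar>) ^ 2" for x
    proof (cases "\<bar>x\<bar> \<le> 1")
      case True
      have "\<bar>x\<bar> powr \<sigma> / (1 + \<bar>x\<bar>) ^ m \<le> \<bar>x\<bar> powr \<sigma> / 1"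
        by (intro divide_left_mono) (auto intro: one_le_power)
      also have "\<dots> \<le> k x + k (0 + (-1) * x)"
        using True by (cases "0 \<le> x") (auto simp: k_def indicator_def)
      also have "\<dots> \<le> k x + k (0 + (-1) * x) + 1 / (1 + \<bar>x\<bar>) ^ 2" by simp
      finally show ?thesis .
    next
      case False
      have "\<bar>x\<bar> powr \<sigma> \<le> \<bar>x\<bar> powr real (m - 2)"
        using False \<sigma> by (intro powr_mono) auto
      also have "\<dots> = \<bar>x\<bar> ^ (m - 2)" using False by (intro powr_realpow) auto
      also have "\<dots> \<le> (1 + \<bar>x\<bar>) ^ (m - 2)" by (intro power_mono) auto
      finally have "\<bar>x\<bar> powr \<sigma> * (1 + \<bar>x\<bar>) ^ 2 \<le> (1 + \<bar>x\<bar>) ^ (m - 2) * (1 + \<bar>x\<bar>) ^ 2"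
        by (intro mult_right_mono) auto
      also have "\<dots> = (1 + \<bar>x\<bar>) ^ m"
        by (simp only: power_add[symmetric] le_add_diff_inverse2[OF \<sigma>(3)])
      finally have *: "\<bar>x\<bar> powr \<sigma> * (1 + \<bar>x\<bar>) ^ 2 \<le> (1 + \<bar>x\<bar>) ^ m" .
      have "0 < (1 + \<bar>x\<bar>) ^ m" "0 < (1 + \<bar>x\<bar>) ^ 2" by (auto intro!: zero_less_power)
      with * have "\<bar>x\<bar> powr \<sigma> / (1 + \<bar>x\<bar>) ^ m \<le> 1 / (1 + \<bar>x\<bar>) ^ 2"
        by (simp add: divide_simps del: zero_less_power_eq)
      then show ?thesis
        by (rule order.trans) (auto simp: k_def)
    qed
    then show "AE x in lborel. norm (\<bar>x\<bar> powr \<sigma> / (1 + \<bar>x\<bar>) ^ m) \<le> norm (k x + k (0 + (-1) * x) + 1 / (1 + \<bar>x\<bar>) ^ 2)"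
      by (intro AE_I2) (auto intro: order.trans[OF _ abs_ge_self])
  qed simp
qed

text \<open>The properties through which a test function and its Fourier transform enter the one-variable
  integrals below; both have them, the latter by \<open>fourier_decay\<close>.\<close>

definition rapid :: "(real \<Rightarrow> complex) \<Rightarrow> bool" where
  "rapid h \<longleftrightarrow> h \<in> borel_measurable borel \<and> (\<forall>m. \<exists>K. \<forall>x. (1 + \<bar>x\<bar>) ^ m * norm (h x) \<le> K)"

lemma rapid_schwartz:
  assumes "\<phi> \<in> schwartz" shows "rapid \<phi>"
  unfolding rapid_def
proof (intro conjI allI)
  show "\<phi> \<in> borel_measurable borel" using assms by auto
  fix m
  obtain K where "0 \<le> K" and K: "\<And>x. (1 + norm x) ^ m * norm (iter_deriv [] \<phi> x) \<le> K"
    using schwartz_bound[OF assms lists.Nil, of m] by metis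
  from K show "\<exists>K. \<forall>x. (1 + \<bar>x\<bar>) ^ m * norm (\<phi> x) \<le> K" by auto
qed

lemma rapid_fourier:
  assumes "\<phi> \<in> schwartz" shows "rapid (fourier \<phi>)"
  unfolding rapid_def
proof (intro conjI allI)
  show "fourier \<phi> \<in> borel_measurable borel" using assms by (intro fourier_measurable) auto
  fix m
  obtain N C where "\<And>(f::real \<Rightarrow> complex) y. f \<in> schwartz \<Longrightarrow>
     (1 + norm y) ^ m * norm (fourier f y) \<le> C * schwartz_norm N f"
    using fourier_decay[of m, where 'a = real] by metis
  from this[OF assms] show "\<exists>K. \<forall>x. (1 + \<bar>x\<bar>) ^ m * norm (fourier \<phi> x) \<le> K" by auto
qed

lemma rapid_integrable:
  assumes h: "rapid h" and \<sigma>: "-1 < \<sigma>"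
  shows "integrable lborel (\<lambda>x. \<bar>x\<bar> powr \<sigma> * norm (h x))"
proof -
  \<comment> \<open>two powers beyond \<open>\<sigma>\<close> leave \<open>1 / (1 + \<bar>x\<bar>)\<^sup>2\<close> at infinity\<close>
  define m where "m = nat \<lceil>\<sigma>\<rceil> + 2"
  have m: "\<sigma> + 2 \<le> real m" "2 \<le> m" unfolding m_def by linarith+
  have [measurable]: "h \<in> borel_measurable borel" using h by (simp add: rapid_def)
  obtain K where K: "\<And>x. (1 + \<bar>x\<bar>) ^ m * norm (h x) \<le> K"
    using h by (auto simp: rapid_def)
  have le: "\<bar>x\<bar> powr \<sigma> * norm (h x) \<le> K * (\<bar>x\<bar> powr \<sigma> / (1 + \<bar>x\<bar>) ^ m)" for x
  proof -
    have p: "0 < (1 + \<bar>x\<bar>) ^ m" by (intro zero_less_power) auto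
    then have "norm (h x) \<le> K / (1 + \<bar>x\<bar>) ^ m"
      using K[of x] by (subst pos_le_divide_eq) (auto simp: mult.commute)
    from mult_left_mono[OF this, of "\<bar>x\<bar> powr \<sigma>"] show ?thesis by (simp add: mult.commute)
  qed
  show ?thesis
    by (rule Bochner_Integration.integrable_bound[OF integrable_mult_right[OF integrable_powr_decay[OF \<sigma> m], of K]])
       (use le order.trans[OF le abs_ge_self] in \<open>auto simp: abs_mult\<close>)
qed

text \<open>The argument of \<open>z\<close> is at most \<open>pi\<close> in absolute value.\<close>

lemma norm_powr_le:
  fixes z w :: complex
  shows "norm (z powr w) \<le> norm z powr Re w * exp (pi * \<bar>Im w\<bar>)"
proof -
  have "- Im w * Arg z \<le> \<bar>Im w\<bar> * \<bar>Arg z\<bar>" by (metis abs_ge_minus_self abs_mult minus_mult_left)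
  also have "\<dots> \<le> \<bar>Im w\<bar> * pi"
    using Arg_bounded[of z] by (intro mult_left_mono) auto
  finally show ?thesis
    by (simp add: norm_powr_complex mult.commute mult_left_mono)
qed

text \<open>Used both with \<open>b x = \<i> * x\<close> and with \<open>b x = max x 0\<close>.  Near \<open>w\<^sub>0\<close> the modulus \<open>\<bar>x\<bar> powr Re w\<close> is at most the sum
  of its values at the two ends of a small interval around \<open>Re w\<^sub>0\<close>.\<close>

lemma holomorphic_powr_integral:
  assumes h: "rapid h" and [measurable]: "b \<in> borel_measurable borel"
    and b: "\<And>x. b x = 0 \<or> norm (b x) = \<bar>x\<bar>"
  shows "(\<lambda>w. LINT x|lborel. b x powr w * h x) holomorphic_on {w. -1 < Re w}"
proof (rule holomorphic_on_lebesgue_integral)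
  have [measurable]: "h \<in> borel_measurable borel" using h by (simp add: rapid_def)
  show "open {w. -1 < Re w}" by (rule open_halfspace_Re_gt)
  show "(\<lambda>w. b x powr w * h x) holomorphic_on {w. -1 < Re w}" for x
    by (intro holomorphic_intros)
  show "(\<lambda>x. b x powr w * h x) \<in> borel_measurable lborel" for w
    unfolding powr_def by measurable
  fix w0 assume w0: "w0 \<in> {w. -1 < Re w}"
  define r where "r = (Re w0 + 1) / 2"
  define g where "g = (\<lambda>x. exp (pi * (\<bar>Im w0\<bar> + r)) * (\<bar>x\<bar> powr (Re w0 - r) * norm (h x) + \<bar>x\<bar> powr (Re w0 + r) * norm (h x)))"
  show "\<exists>r>0. \<exists>g. integrable lborel g \<and> (\<forall>w\<in>cball w0 r. \<forall>x. norm (b x powr w * h x) \<le> g x)"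
  proof (intro exI conjI ballI allI)
    show "0 < r" using w0 by (simp add: r_def)
    show "integrable lborel g"
      unfolding g_def using w0
      by (intro integrable_mult_right Bochner_Integration.integrable_add rapid_integrable h) (auto simp: r_def field_simps)
    fix w x assume w: "w \<in> cball w0 r"
    have w': "\<bar>Re w0 - Re w\<bar> \<le> r" "\<bar>Im w0 - Im w\<bar> \<le> r"
      using w abs_Re_le_cmod[of "w0 - w"] abs_Im_le_cmod[of "w0 - w"] by (auto simp: dist_norm)
    show "norm (b x powr w * h x) \<le> g x"
    proof (cases "b x = 0")
      case False
      then have bx: "norm (b x) = \<bar>x\<bar>" and x: "x \<noteq> 0" using b[of x] by auto
      have "\<bar>x\<bar> powr Re w \<le> \<bar>x\<bar> powr (Re w0 - r) + \<bar>x\<bar> powr (Re w0 + r)"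
      proof (cases "\<bar>x\<bar> \<le> 1")
        case True
        then have "\<bar>x\<bar> powr Re w \<le> \<bar>x\<bar> powr (Re w0 - r)"
          using x w' by (intro powr_mono') auto
        then show ?thesis by (simp add: add_increasing2)
      next
        case False
        then have "\<bar>x\<bar> powr Re w \<le> \<bar>x\<bar> powr (Re w0 + r)"
          using x w' by (intro powr_mono) auto
        then show ?thesis by (simp add: add_increasing)
      qed
      moreover have "exp (pi * \<bar>Im w\<bar>) \<le> exp (pi * (\<bar>Im w0\<bar> + r))"
        using w' by (auto intro!: mult_left_mono)
      ultimately have "\<bar>x\<bar> powr Re w * exp (pi * \<bar>Im w\<bar>)
          \<le> (\<bar>x\<bar> powr (Re w0 - r) + \<bar>x\<bar> powr (Re w0 + r)) * exp (pi * (\<bar>Im w0\<bar> + r))"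
        by (intro mult_mono) auto
      with norm_powr_le[of "b x" w] bx
      have "norm (b x powr w) \<le> (\<bar>x\<bar> powr (Re w0 - r) + \<bar>x\<bar> powr (Re w0 + r)) * exp (pi * (\<bar>Im w0\<bar> + r))"
        by simp
      from mult_right_mono[OF this, of "norm (h x)"] show ?thesis
        by (simp add: g_def norm_mult algebra_simps)
    qed (simp add: g_def)
  qed
qed

text \<open>With the damping factor \<open>exp (- \<epsilon> * x)\<close> both integrals converge absolutely, Fubini's theorem applies,
  and the inner integral is Euler's with \<open>s = \<epsilon> + \<i> * \<omega>\<close>.  As \<open>\<epsilon>\<close> tends to zero both sides converge
  by domination; on the right this uses \<open>Re z < 1\<close>, which makes \<open>\<bar>\<omega>\<bar> powr (- Re z)\<close> locally integrable.\<close>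

lemma mellin_fourier:
  assumes \<phi>: "\<phi> \<in> schwartz" and z: "0 < Re z" "Re z < 1"
  shows "(LINT x|lborel. of_real (max x 0) powr (z - 1) * fourier \<phi> x)
      = Gamma z * (LINT \<omega>|lborel. (\<i> * of_real \<omega>) powr (- z) * \<phi> \<omega>)"
proof -
  define \<epsilon> where "\<epsilon> = (\<lambda>n. 1 / real (Suc n))"
  have \<epsilon>: "0 < \<epsilon> n" for n by (simp add: \<epsilon>_def)
  have \<epsilon>0: "\<epsilon> \<longlonglongrightarrow> 0" unfolding \<epsilon>_def by real_asymp
  note r\<phi> = rapid_schwartz[OF \<phi>] and rF = rapid_fourier[OF \<phi>]
  have m[measurable]: "\<phi> \<in> borel_measurable borel" "fourier \<phi> \<in> borel_measurable borel"
    using r\<phi> rF by (auto simp: rapid_def)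
  let ?k = "\<lambda>n. gamma_kernel z (of_real (\<epsilon> n))"
  have k: "integrable lborel (?k n)" for n
    using gamma_kernel_real(1)[OF z(1) \<epsilon>] .
  have eq: "(LINT x|lborel. ?k n x * fourier \<phi> x)
      = Gamma z * (LINT \<omega>|lborel. (of_real (\<epsilon> n) + \<i> * of_real \<omega>) powr (- z) * \<phi> \<omega>)" for n
  proof -
    let ?f = "\<lambda>x \<omega>. ?k n x * (\<phi> \<omega> * exp (- \<i> * of_real (x * \<omega>)))"
    have "integrable (lborel \<Otimes>\<^sub>M lborel) (case_prod ?f)"
    proof (rule lborel_pair.Fubini_integrable)
      show "case_prod ?f \<in> borel_measurable (lborel \<Otimes>\<^sub>M lborel)" by measurable
      have "integrable lborel (\<lambda>x. norm (?k n x) * (LINT y|lborel. norm (\<phi> y)))"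
        by (intro integrable_mult_left integrable_norm k)
      then show "integrable lborel (\<lambda>x. LINT y|lborel. norm (case_prod ?f (x, y)))"
        by (simp add: norm_mult norm_exp_eq_Re)
      show "AE x in lborel. integrable lborel (\<lambda>y. case_prod ?f (x, y))"
      proof (rule AE_I2)
        fix x
        show "integrable lborel (\<lambda>y. case_prod ?f (x, y))"
          by (rule Bochner_Integration.integrable_bound[OF
                integrable_mult_right[OF integrable_norm[OF schwartz_integrable[OF \<phi>]], of "norm (?k n x)"]])
             (auto simp: norm_mult norm_exp_eq_Re)
      qed
    qed
    from lborel_pair.Fubini_integral[OF this]
    have "(LINT x|lborel. LINT \<omega>|lborel. ?f x \<omega>) = (LINT \<omega>|lborel. LINT x|lborel. ?f x \<omega>)"
      by simp
    moreover have "(LINT \<omega>|lborel. ?f x \<omega>) = ?k n x * fourier \<phi> x" for x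
      unfolding fourier_def by (simp add: inner_real_def)
    moreover have "(LINT x|lborel. ?f x \<omega>) = Gamma z * ((of_real (\<epsilon> n) + \<i> * of_real \<omega>) powr (- z) * \<phi> \<omega>)" for \<omega>
    proof -
      have "?f x \<omega> = gamma_kernel z (of_real (\<epsilon> n) + \<i> * of_real \<omega>) x * \<phi> \<omega>" for x
        by (simp add: gamma_kernel_def exp_add[symmetric] algebra_simps)
      then have "(LINT x|lborel. ?f x \<omega>)
          = (LINT x|lborel. gamma_kernel z (of_real (\<epsilon> n) + \<i> * of_real \<omega>) x * \<phi> \<omega>)"
        by (simp only:)
      also have "\<dots> = Gamma z * ((of_real (\<epsilon> n) + \<i> * of_real \<omega>) powr (- z) * \<phi> \<omega>)"
        using gamma_kernel_integral[OF z(1), of "of_real (\<epsilon> n) + \<i> * of_real \<omega>"] \<epsilon>[of n]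
        by simp
      finally show ?thesis .
    qed
    ultimately show ?thesis by (simp only: integral_mult_right_zero)
  qed
  have L: "(\<lambda>n. LINT x|lborel. ?k n x * fourier \<phi> x)
      \<longlonglongrightarrow> (LINT x|lborel. of_real (max x 0) powr (z - 1) * fourier \<phi> x)"
  proof (rule integral_dominated_convergence[where w = "\<lambda>x. \<bar>x\<bar> powr (Re z - 1) * norm (fourier \<phi> x)"])
    show "(\<lambda>x. of_real (max x 0) powr (z - 1) * fourier \<phi> x) \<in> borel_measurable lborel"
      unfolding powr_def by measurable
    show "integrable lborel (\<lambda>x. \<bar>x\<bar> powr (Re z - 1) * norm (fourier \<phi> x))"
      by (rule rapid_integrable[OF rF]) (use z in auto)
    show "AE x in lborel. (\<lambda>n. ?k n x * fourier \<phi> x) \<longlonglongrightarrow> of_real (max x 0) powr (z - 1) * fourier \<phi> x"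
    proof (rule AE_I2)
      fix x
      have "(\<lambda>n. exp (- of_real (\<epsilon> n) * of_real x)) \<longlonglongrightarrow> exp (- of_real 0 * of_real x :: complex)"
        by (intro tendsto_intros \<epsilon>0)
      then have "(\<lambda>n. of_real (max x 0) powr (z - 1) * exp (- of_real (\<epsilon> n) * of_real x) * fourier \<phi> x)
         \<longlonglongrightarrow> of_real (max x 0) powr (z - 1) * 1 * fourier \<phi> x"
        by (intro tendsto_mult tendsto_const) auto
      then show "(\<lambda>n. ?k n x * fourier \<phi> x) \<longlonglongrightarrow> of_real (max x 0) powr (z - 1) * fourier \<phi> x"
        by (simp add: gamma_kernel_def)
    qed
    show "AE x in lborel. norm (?k n x * fourier \<phi> x) \<le> \<bar>x\<bar> powr (Re z - 1) * norm (fourier \<phi> x)" for n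
    proof (rule AE_I2)
      fix x
      have "norm (?k n x) \<le> norm (gamma_kernel z (of_real 0) x)"
        using \<epsilon>[of n] by (intro gamma_kernel_norm_mono) auto
      also have "\<dots> \<le> \<bar>x\<bar> powr (Re z - 1)"
        by (cases "0 < x") (auto simp: gamma_kernel_def norm_powr_real_powr)
      finally show "norm (?k n x * fourier \<phi> x) \<le> \<bar>x\<bar> powr (Re z - 1) * norm (fourier \<phi> x)"
        by (simp add: norm_mult mult_right_mono)
    qed
  qed (use m in auto)
  have R: "(\<lambda>n. LINT \<omega>|lborel. (of_real (\<epsilon> n) + \<i> * of_real \<omega>) powr (- z) * \<phi> \<omega>)
      \<longlonglongrightarrow> (LINT \<omega>|lborel. (\<i> * of_real \<omega>) powr (- z) * \<phi> \<omega>)"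
  proof (rule integral_dominated_convergence[where
        w = "\<lambda>x. exp (pi * \<bar>Im z\<bar>) * (\<bar>x\<bar> powr (- Re z) * norm (\<phi> x))"])
    show "(\<lambda>\<omega>. (\<i> * of_real \<omega>) powr (- z) * \<phi> \<omega>) \<in> borel_measurable lborel"
      "(\<lambda>\<omega>. (of_real (\<epsilon> n) + \<i> * of_real \<omega>) powr (- z) * \<phi> \<omega>) \<in> borel_measurable lborel" for n
      unfolding powr_def by measurable
    show "integrable lborel (\<lambda>x. exp (pi * \<bar>Im z\<bar>) * (\<bar>x\<bar> powr (- Re z) * norm (\<phi> x)))"
      by (intro integrable_mult_right rapid_integrable[OF r\<phi>]) (use z in auto)
    have ne: "AE \<omega> in lborel. \<omega> \<noteq> (0::real)" by (rule AE_lborel_singleton)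
    show "AE \<omega> in lborel. (\<lambda>n. (of_real (\<epsilon> n) + \<i> * of_real \<omega>) powr (- z) * \<phi> \<omega>)
        \<longlonglongrightarrow> (\<i> * of_real \<omega>) powr (- z) * \<phi> \<omega>"
      using ne
    proof eventually_elim
      case (elim \<omega>)
      have "(\<lambda>n. of_real (\<epsilon> n) + \<i> * of_real \<omega>) \<longlonglongrightarrow> of_real 0 + \<i> * of_real \<omega>"
        by (intro tendsto_intros \<epsilon>0)
      then show ?case
        using elim by (intro tendsto_mult tendsto_const tendsto_powr_complex) (auto simp: complex_nonpos_Reals_iff)
    qed
    show "AE \<omega> in lborel. norm ((of_real (\<epsilon> n) + \<i> * of_real \<omega>) powr (- z) * \<phi> \<omega>)
        \<le> exp (pi * \<bar>Im z\<bar>) * (\<bar>\<omega>\<bar> powr (- Re z) * norm (\<phi> \<omega>))" for n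
      using ne
    proof eventually_elim
      case (elim \<omega>)
      let ?w = "of_real (\<epsilon> n) + \<i> * of_real \<omega> :: complex"
      have "\<bar>\<omega>\<bar> \<le> norm ?w" using abs_Im_le_cmod[of ?w] by simp
      then have "norm ?w powr (- Re z) \<le> \<bar>\<omega>\<bar> powr (- Re z)"
        using elim z by (intro powr_mono2') auto
      then have "norm (?w powr (- z)) \<le> \<bar>\<omega>\<bar> powr (- Re z) * exp (pi * \<bar>Im z\<bar>)"
        using norm_powr_le[of ?w "-z"] by (auto intro: order.trans mult_right_mono)
      from mult_right_mono[OF this, of "norm (\<phi> \<omega>)"] show ?case
        by (simp add: norm_mult mult_ac)
    qed
  qed
  have "(\<lambda>n. LINT x|lborel. ?k n x * fourier \<phi> x)
      \<longlonglongrightarrow> Gamma z * (LINT \<omega>|lborel. (\<i> * of_real \<omega>) powr (- z) * \<phi> \<omega>)"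
    unfolding eq by (intro tendsto_mult tendsto_const R)
  from LIMSEQ_unique[OF L this] show ?thesis .
qed

definition half_line_density :: "real \<Rightarrow> real \<Rightarrow> real" where
  "half_line_density a x = trunc_power x (a - 1) / Gamma a"

lemma half_line_density_measurable [measurable]: "half_line_density a \<in> borel_measurable borel"
  unfolding half_line_density_def[abs_def] trunc_power_def by measurable

text \<open>As a function of \<open>a\<close> the right-hand side makes sense for complex exponents; \<open>rGamma\<close> avoids the poles
  of the Gamma function.\<close>

lemma half_line_density_complex:
  "complex_of_real (half_line_density a x) = rGamma (of_real a) * of_real (max x 0) powr (of_real a - 1)"
  using powr_of_real[of x "a - 1"]
  by (auto simp: half_line_density_def trunc_power_def rGamma_inverse_Gamma max_def Gamma_complex_of_real divide_inverse)

text \<open>The integral that defines the power converges for \<open>Re w > -1\<close>, the claimed one for \<open>Re w < 0\<close>, and they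
  agree in the common strip by \<open>mellin_fourier\<close>.  Glued together they are an entire function, hence
  the continuation; its uniqueness is the identity theorem on a domain that is connected, being the
  complement of a countable set.\<close>

lemma i_omega_power_eq:
  assumes a: "0 < a" "a \<notin> \<nat>" and \<phi>: "\<phi> \<in> schwartz"
  shows "i_omega_power (of_real (-a)) \<phi> = (LINT x|lborel. of_real (half_line_density a x) * fourier \<phi> x)"
proof -
  note r\<phi> = rapid_schwartz[OF \<phi>] and rF = rapid_fourier[OF \<phi>]
  define I1 where "I1 = (\<lambda>w. LINT \<omega>|lborel. (\<i> * of_real \<omega>) powr w * \<phi> \<omega>)"
  define I2 where "I2 = (\<lambda>w. LINT x|lborel. of_real (max x 0) powr w * fourier \<phi> x)"
  \<comment> \<open>the two half-planes overlap in the strip, so \<open>F\<close> is holomorphic in a neighbourhood of every point\<close>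
  define F where "F = (\<lambda>w. if -1 < Re w then I1 w else rGamma (-w) * I2 (-w - 1))"
  let ?dom = "{w::complex. w + 1 \<notin> \<int>\<^sub>\<le>\<^sub>0}"
  have hol1: "I1 holomorphic_on {w. -1 < Re w}"
    unfolding I1_def by (rule holomorphic_powr_integral[OF r\<phi>]) (auto simp: norm_mult)
  have hol2: "I2 holomorphic_on {w. -1 < Re w}"
    unfolding I2_def by (rule holomorphic_powr_integral[OF rF]) (auto simp: max_def)
  have strip: "I1 w = rGamma (-w) * I2 (-w - 1)" if "-1 < Re w" "Re w < 0" for w
  proof -
    have "I2 (-w - 1) = Gamma (-w) * I1 w"
      unfolding I1_def I2_def using mellin_fourier[OF \<phi>, of "-w"] that by simp
    moreover have "-w \<notin> \<int>\<^sub>\<le>\<^sub>0"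
      using that by (auto elim!: nonpos_Ints_cases simp: complex_eq_iff)
    then have "rGamma (-w) * Gamma (-w) = 1"
      by (simp add: rGamma_inverse_Gamma Gamma_eq_zero_iff)
    ultimately show ?thesis by (metis mult.assoc mult_1)
  qed
  have left: "F w = rGamma (-w) * I2 (-w - 1)" if "Re w < 0" for w
    using strip that by (auto simp: F_def)
  have "(\<lambda>w. rGamma (-w) * I2 (-w - 1)) holomorphic_on {w. Re w < 0}"
    by (intro holomorphic_intros holomorphic_on_compose_gen[OF _ hol2, unfolded comp_def]) auto
  then have "F holomorphic_on {w. Re w < 0}"
    by (rule holomorphic_transform) (simp add: left)
  moreover have "F holomorphic_on {w. -1 < Re w}"
    by (rule holomorphic_transform[OF hol1]) (simp add: F_def)
  ultimately have "F holomorphic_on ({w. Re w < 0} \<union> {w. -1 < Re w})"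
    by (intro holomorphic_on_Un open_halfspace_Re_gt open_halfspace_Re_lt)
  then have holF: "F holomorphic_on ?dom"
    by (rule holomorphic_on_subset) auto
  have Fright: "F w = (LINT \<omega>|lborel. (\<i> * of_real \<omega>) powr w * \<phi> \<omega>)" if "-1 < Re w" for w
    using that by (simp add: F_def I1_def)
  have dom: "of_real (-a) \<in> ?dom"
  proof -
    have False if h: "complex_of_real (-a) + 1 \<in> \<int>\<^sub>\<le>\<^sub>0"
    proof -
      obtain n where "complex_of_real (-a) + 1 = - of_nat n"
        using h by (auto elim: nonpos_Ints_cases')
      then have "complex_of_real a = of_real (real (Suc n))"
        by (simp add: algebra_simps eq_neg_iff_add_eq_0)
      then have "a = real (Suc n)" by (simp only: of_real_eq_iff)
      then show False using a(2) by (metis of_nat_in_Nats)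
    qed
    then show ?thesis by blast
  qed
  have open_dom: "open ?dom"
  proof -
    have "closed ((\<lambda>w::complex. w + 1) -` \<int>\<^sub>\<le>\<^sub>0)"
      by (rule closed_vimage) (auto intro!: continuous_intros)
    then show ?thesis by (simp add: closed_def vimage_def Compl_eq)
  qed
  have connected_dom: "connected ?dom"
  proof -
    have "countable (\<int>\<^sub>\<le>\<^sub>0 :: complex set)"
      by (rule countable_subset[of _ "range of_int"]) (auto simp: nonpos_Ints_def)
    then have "countable ((\<lambda>w. w - 1) ` (\<int>\<^sub>\<le>\<^sub>0 :: complex set))" by simp
    then have "path_connected (- ((\<lambda>w. w - 1) ` (\<int>\<^sub>\<le>\<^sub>0 :: complex set)))"
      by (intro path_connected_complement_countable) auto
    moreover have "- ((\<lambda>w. w - 1) ` \<int>\<^sub>\<le>\<^sub>0) = ?dom"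
      by (auto simp: image_iff algebra_simps)
    ultimately show ?thesis using path_connected_imp_connected by metis
  qed
  have "i_omega_power (of_real (-a)) \<phi> = F (of_real (-a))"
    unfolding i_omega_power_def
  proof (rule the_equality)
    show "\<exists>G. G holomorphic_on ?dom \<and>
       (\<forall>w. -1 < Re w \<longrightarrow> G w = (LINT \<omega>|lborel. (\<i> * of_real \<omega>) powr w * \<phi> \<omega>)) \<and>
       F (of_real (-a)) = G (of_real (-a))"
      using holF Fright by blast
    fix v assume "\<exists>G. G holomorphic_on ?dom \<and>
       (\<forall>w. -1 < Re w \<longrightarrow> G w = (LINT \<omega>|lborel. (\<i> * of_real \<omega>) powr w * \<phi> \<omega>)) \<and>
       v = G (of_real (-a))"
    then obtain G where G: "G holomorphic_on ?dom"
      "\<And>w. -1 < Re w \<Longrightarrow> G w = (LINT \<omega>|lborel. (\<i> * of_real \<omega>) powr w * \<phi> \<omega>)"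
      "v = G (of_real (-a))" by blast
    have "G (of_real (-a)) = F (of_real (-a))"
    proof (rule analytic_continuation_open[where s = "{w. -1 < Re w}" and s' = ?dom
        and f = G and g = F and z = "of_real (-a)"])
      show "{w. -1 < Re w} \<noteq> {}" by (auto intro!: exI[of _ 0])
      show "{w. -1 < Re w} \<subseteq> ?dom"
        by (auto elim!: nonpos_Ints_cases simp: complex_eq_iff)
    qed (use G(1,2) Fright holF dom open_dom connected_dom in \<open>simp_all add: open_halfspace_Re_gt\<close>)
    then show "v = F (of_real (-a))" using G(3) by simp
  qed
  also have "\<dots> = rGamma (of_real a) * I2 (of_real a - 1)"
    using left[of "of_real (-a)"] a by simp
  also have "\<dots> = (LINT x|lborel. of_real (half_line_density a x) * fourier \<phi> x)"
    unfolding I2_def half_line_density_complex by (simp add: mult.assoc)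
  finally show ?thesis .
qed

lemma heaviside_conv_power_Suc:
  "heaviside_conv_power (Suc k) x = (if 0 \<le> x then x ^ k / fact k else 0)"
proof (induction k arbitrary: x)
  case 0
  show ?case by (simp add: heaviside_conv_power_def heaviside_def)
next
  case (Suc k)
  have "heaviside_conv_power (Suc (Suc k)) x = Defs.convolution heaviside (heaviside_conv_power (Suc k)) x"
    by (simp add: heaviside_conv_power_def)
  also have "\<dots> = (LINT y|lborel. indicator {0..x} y *\<^sub>R (y ^ k / fact k))"
    unfolding Defs.convolution_def by (rule Bochner_Integration.integral_cong) (auto simp: Suc heaviside_def indicator_def)
  also have "\<dots> = (if 0 \<le> x then x ^ Suc k / fact (Suc k) else 0)"
  proof (cases "0 \<le> x")
    case True
    have "(LINT y|lborel. indicator {0..x} y *\<^sub>R (y ^ k / fact k)) = x ^ Suc k / fact (Suc k) - 0 ^ Suc k / fact (Suc k)"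
    proof (rule integral_FTC_atLeastAtMost[OF True])
      fix y :: real
      have "((\<lambda>y. y ^ Suc k / fact (Suc k)) has_real_derivative y ^ k / fact k) (at y)"
        by (rule derivative_eq_intros refl | simp)+
      then show "((\<lambda>y. y ^ Suc k / fact (Suc k)) has_vector_derivative y ^ k / fact k) (at y within {0..x})"
        by (simp add: has_real_derivative_iff_has_vector_derivative has_vector_derivative_at_within)
    qed (auto intro!: continuous_intros)
    then show ?thesis using True by simp
  qed simp
  finally show ?case .
qed

text \<open>The Heaviside function and its convolution powers are defined with the convention of a closed
  half-line, which differs from the density at the origin at most.\<close>

lemma cone_factor_eq:
  assumes a: "0 < a" and \<phi>: "\<phi> \<in> schwartz"
  shows "cone_factor a \<phi> = (LINT x|lborel. of_real (half_line_density a x) * fourier \<phi> x)"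
proof (cases "a \<in> \<nat>")
  case True
  then obtain n where "a = real n" by (auto elim: Nats_cases)
  then obtain k where k: "a = real (Suc k)" using a by (cases n) auto
  have [measurable]: "fourier \<phi> \<in> borel_measurable borel"
    using rapid_fourier[OF \<phi>] by (auto simp: rapid_def)
  have "nat \<lfloor>a\<rfloor> = Suc k" by (simp add: k)
  then have eq: "heaviside_conv_power (nat \<lfloor>a\<rfloor>) = (\<lambda>x. if 0 \<le> x then x ^ k / fact k else 0)"
    using heaviside_conv_power_Suc by auto
  have Suc1: "real (Suc k) - 1 = real k" by simp
  have G: "Gamma (real (Suc k)) = fact k"
    using Gamma_fact[of k, where 'a = real] by (simp add: add.commute)
  have "cone_factor a \<phi> = (LINT x|lborel. of_real (if 0 \<le> x then x ^ k / fact k else 0) * fourier \<phi> x)"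
    using True by (simp add: cone_factor_def dist_fourier_def dist_of_fun_def eq)
  also have "\<dots> = (LINT x|lborel. of_real (half_line_density a x) * fourier \<phi> x)"
  proof (rule integral_cong_AE)
    have "AE x in lborel. x \<noteq> (0::real)" by (rule AE_lborel_singleton)
    then show "AE x in lborel. of_real (if 0 \<le> x then x ^ k / fact k else 0) * fourier \<phi> x
        = of_real (half_line_density a x) * fourier \<phi> x"
      by eventually_elim (auto simp: half_line_density_def trunc_power_def k G Suc1 powr_realpow simp del: of_nat_Suc)
  qed auto
  finally show ?thesis .
next
  case False
  then show ?thesis using i_omega_power_eq[OF a False \<phi>] by (simp add: cone_factor_def)
qed

section \<open>Linear change of variables in the Lebesgue integral\<close>

lemma linear_borel_measurable:
  fixes f :: "'a::euclidean_space \<Rightarrow> 'b::real_normed_vector"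
  shows "linear f \<Longrightarrow> f \<in> borel_measurable borel"
  by (intro borel_measurable_continuous_onI linear_continuous_on linear_conv_bounded_linear[THEN iffD1])

text \<open>The transformation formula as a property that is stable under composition.  It is asked for the
  nonnegative integral because there no integrability conditions get in the way.\<close>

definition scales_lborel :: "(real^'n \<Rightarrow> real^'n) \<Rightarrow> bool" where
  "scales_lborel f \<longleftrightarrow> linear f \<and> (det (matrix f) \<noteq> 0 \<longrightarrow> (\<forall>h\<in>borel_measurable borel.
     (\<integral>\<^sup>+x. h x \<partial>lborel) = ennreal \<bar>det (matrix f)\<bar> * (\<integral>\<^sup>+x. h (f x) \<partial>lborel)))"

lemma scales_lborel_comp:
  assumes "scales_lborel f" "scales_lborel g"
  shows "scales_lborel (f \<circ> g)"
  unfolding scales_lborel_def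
proof (intro conjI impI ballI)
  have lin: "linear f" "linear g" using assms by (auto simp: scales_lborel_def)
  then show "linear (f \<circ> g)" by (intro linear_compose)
  have det: "det (matrix (f \<circ> g)) = det (matrix f) * det (matrix g)"
    by (simp add: matrix_compose[OF lin(2,1)] det_mul)
  assume nz: "det (matrix (f \<circ> g)) \<noteq> 0"
  fix h :: "real^'a \<Rightarrow> ennreal" assume [measurable]: "h \<in> borel_measurable borel"
  note [measurable] = linear_borel_measurable[OF lin(1)]
  have "(\<lambda>x. h (f x)) \<in> borel_measurable borel" by measurable
  then have "(\<integral>\<^sup>+x. h x \<partial>lborel) = ennreal \<bar>det (matrix f)\<bar> * (ennreal \<bar>det (matrix g)\<bar> * (\<integral>\<^sup>+x. h (f (g x)) \<partial>lborel))"
    using assms nz det unfolding scales_lborel_def by auto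
  then show "(\<integral>\<^sup>+x. h x \<partial>lborel) = ennreal \<bar>det (matrix (f \<circ> g))\<bar> * (\<integral>\<^sup>+x. h ((f \<circ> g) x) \<partial>lborel)"
    by (simp add: det abs_mult ennreal_mult mult.assoc)
qed

text \<open>A diagonal map acts on each coordinate separately.\<close>

lemma scales_lborel_stretch:
  fixes c :: "'n::finite \<Rightarrow> real"
  shows "scales_lborel (\<lambda>x. \<chi> i. c i * x $ i)" (is "scales_lborel ?f")
  unfolding scales_lborel_def
proof (intro conjI impI ballI)
  show "linear ?f" by (rule linearI) (auto simp: vec_eq_iff algebra_simps)
  have det: "det (matrix ?f) = (\<Prod>i\<in>UNIV. c i)"
    by (subst det_diagonal) (auto simp: matrix_def axis_def)
  assume "det (matrix ?f) \<noteq> 0"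
  then have c: "c i \<noteq> 0" for i by (simp add: det)
  define e where "e = (\<lambda>k::'n. axis k (1::real))"
  have inj: "inj e" by (auto simp: e_def inj_def axis_eq_axis)
  have basis: "Basis = range e" by (auto simp: e_def Basis_vec_def)
  have inv: "inv e (e k) = k" for k by (simp add: inj)
  define c' where "c' = (\<lambda>b. c (inv e b))"
  have T: "(0::real^'n) + (\<Sum>j\<in>Basis. (c' j * (x \<bullet> j)) *\<^sub>R j) = ?f x" for x
  proof -
    have "(\<Sum>j\<in>Basis. (c' j * (x \<bullet> j)) *\<^sub>R j) = (\<Sum>k\<in>UNIV. (c k * x $ k) *\<^sub>R e k)"
      unfolding basis by (subst sum.reindex[OF inj]) (simp add: c'_def inv, simp add: e_def inner_axis)
    also have "\<dots> = ?f x"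
      by (simp add: vec_eq_iff e_def axis_def if_distrib cong: if_cong)
    finally show ?thesis by simp
  qed
  have prod: "(\<Prod>j\<in>Basis. \<bar>c' j\<bar>) = \<bar>\<Prod>i\<in>UNIV. c i\<bar>"
    unfolding basis by (subst prod.reindex[OF inj]) (simp add: c'_def inv abs_prod)
  have eq: "(lborel :: (real^'n) measure) = density (distr lborel borel ?f) (\<lambda>_. ennreal \<bar>\<Prod>i\<in>UNIV. c i\<bar>)"
    using lborel_affine_euclidean[of c' "0::real^'n"] c unfolding T prod by (simp add: c'_def)
  note [measurable] = linear_borel_measurable[OF \<open>linear ?f\<close>]
  fix h :: "real^'n \<Rightarrow> ennreal" assume [measurable]: "h \<in> borel_measurable borel"
  show "(\<integral>\<^sup>+x. h x \<partial>lborel) = ennreal \<bar>det (matrix ?f)\<bar> * (\<integral>\<^sup>+x. h (?f x) \<partial>lborel)"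
    unfolding det by (subst eq) (simp add: nn_integral_density nn_integral_distr nn_integral_cmult)
qed

text \<open>Integrating over the coordinate \<open>b\<close> first, with the others fixed, the shear is a translation of that
  coordinate.\<close>

lemma nn_integral_lborel_shear:
  fixes h :: "'a::euclidean_space \<Rightarrow> ennreal"
  assumes bd: "b \<in> Basis" "d \<in> Basis" "b \<noteq> d" and [measurable]: "h \<in> borel_measurable borel"
  shows "(\<integral>\<^sup>+x. h (x + (x \<bullet> d) *\<^sub>R b) \<partial>lborel) = (\<integral>\<^sup>+x. h x \<partial>lborel)"
proof -
  interpret product_sigma_finite "\<lambda>_::'a. lborel :: real measure" by standard
  define I where "I = (Basis::'a set) - {b}"
  have I: "finite I" "b \<notin> I" "insert b I = Basis" "d \<in> I" using bd by (auto simp: I_def)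
  define T where "T = (\<lambda>g::'a \<Rightarrow> real. \<Sum>i\<in>Basis. g i *\<^sub>R i)"
  have T[measurable]: "T \<in> measurable (\<Pi>\<^sub>M i\<in>(Basis::'a set). (lborel::real measure)) borel"
    unfolding T_def by simp
  have split: "(\<integral>\<^sup>+x. H x \<partial>lborel) = (\<integral>\<^sup>+x. (\<integral>\<^sup>+y. H (T (x(b := y))) \<partial>lborel) \<partial>(\<Pi>\<^sub>M i\<in>I. lborel))"
    if [measurable]: "H \<in> borel_measurable borel" for H :: "'a \<Rightarrow> ennreal"
  proof -
    have "(\<integral>\<^sup>+x. H x \<partial>lborel) = (\<integral>\<^sup>+x. H (T x) \<partial>(\<Pi>\<^sub>M i\<in>Basis. lborel))"
      by (subst lborel_eq) (simp add: nn_integral_distr T_def[symmetric] flip: T_def)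
    also have "\<dots> = (\<integral>\<^sup>+x. (\<integral>\<^sup>+y. H (T (x(b := y))) \<partial>lborel) \<partial>(\<Pi>\<^sub>M i\<in>I. lborel))"
      using product_nn_integral_insert[OF I(1,2), of "\<lambda>x. H (T x)"] by (simp add: I(3))
    finally show ?thesis .
  qed
  have Tu: "T (x(b := y)) + (T (x(b := y)) \<bullet> d) *\<^sub>R b = T (x(b := x d + 1 * y))" for x y
  proof -
    have "T (x(b := y)) \<bullet> d = x d" using bd by (simp add: T_def inner_sum_left_Basis)
    moreover have "T (x(b := z)) = z *\<^sub>R b + (\<Sum>i\<in>I. x i *\<^sub>R i)" for z
    proof -
      have "T (x(b := z)) = (x(b := z)) b *\<^sub>R b + (\<Sum>i\<in>I. (x(b := z)) i *\<^sub>R i)"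
        unfolding T_def I(3)[symmetric] by (rule sum.insert[OF I(1,2)])
      also have "(\<Sum>i\<in>I. (x(b := z)) i *\<^sub>R i) = (\<Sum>i\<in>I. x i *\<^sub>R i)"
        using I by (intro sum.cong) auto
      finally show ?thesis by (simp only: fun_upd_same)
    qed
    ultimately show ?thesis by (simp add: algebra_simps)
  qed
  have inner: "(\<integral>\<^sup>+y. h (T (x(b := x d + 1 * y))) \<partial>lborel) = (\<integral>\<^sup>+y. h (T (x(b := y))) \<partial>lborel)"
    if x: "x \<in> space (\<Pi>\<^sub>M i\<in>I. lborel)" for x
  proof -
    have "(\<lambda>y. x(b := y)) \<in> measurable lborel (\<Pi>\<^sub>M i\<in>insert b I. lborel)"
      using x by (intro measurable_fun_upd[where J = I]) auto
    then have [measurable]: "(\<lambda>y. T (x(b := y))) \<in> borel_measurable borel"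
      using measurable_compose[OF _ T] unfolding I(3) by simp
    show ?thesis
      using nn_integral_real_affine[of "\<lambda>y. h (T (x(b := y)))" 1 "x d"] by simp
  qed
  have "(\<integral>\<^sup>+x. h (x + (x \<bullet> d) *\<^sub>R b) \<partial>lborel)
      = (\<integral>\<^sup>+x. (\<integral>\<^sup>+y. h (T (x(b := x d + 1 * y))) \<partial>lborel) \<partial>(\<Pi>\<^sub>M i\<in>I. lborel))"
    by (subst split) (measurable, simp only: Tu)
  also have "\<dots> = (\<integral>\<^sup>+x. (\<integral>\<^sup>+y. h (T (x(b := y))) \<partial>lborel) \<partial>(\<Pi>\<^sub>M i\<in>I. lborel))"
    by (rule nn_integral_cong) (rule inner)
  also have "\<dots> = (\<integral>\<^sup>+x. h x \<partial>lborel)" by (rule split[symmetric]) measurable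
  finally show ?thesis .
qed

lemma scales_lborel_shear:
  fixes m n :: "'n::finite"
  assumes mn: "m \<noteq> n"
  shows "scales_lborel (\<lambda>x. \<chi> i. if i = m then x $ m + x $ n else x $ i)" (is "scales_lborel ?f")
  unfolding scales_lborel_def
proof (intro conjI impI ballI)
  show "linear ?f" by (rule linearI) (auto simp: vec_eq_iff algebra_simps)
  have "matrix ?f = (\<chi> k. if k = m then row m (mat 1) + 1 *s row n (mat 1) else row k (mat 1))"
    by (auto simp: matrix_def vec_eq_iff row_def mat_def axis_def)
  then have det: "det (matrix ?f) = 1"
    using det_row_operation[OF mn, of "mat 1 :: real^'n^'n" 1] by simp
  have f: "?f x = x + (x \<bullet> axis n 1) *\<^sub>R axis m 1" for x
    by (simp add: inner_axis) (auto simp: vec_eq_iff axis_def)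
  fix h :: "real^'n \<Rightarrow> ennreal" assume "h \<in> borel_measurable borel"
  then show "(\<integral>\<^sup>+x. h x \<partial>lborel) = ennreal \<bar>det (matrix ?f)\<bar> * (\<integral>\<^sup>+x. h (?f x) \<partial>lborel)"
    unfolding det unfolding f using mn
    by (subst nn_integral_lborel_shear) (auto simp: Basis_vec_def axis_eq_axis)
qed

text \<open>Every linear map is a composition of stretches, swaps of two coordinates, shears and maps with a zero
  row; the latter have determinant zero.  A swap is itself a composition of three shears and three
  sign changes.\<close>

lemma scales_lborel_linear:
  fixes f :: "real^'n \<Rightarrow> real^'n"
  assumes "linear f"
  shows "scales_lborel f"
  using assms
proof (rule induct_linear_elementary)
  show "scales_lborel (f \<circ> g)" if "scales_lborel f" "scales_lborel g" for f g :: "real^'n \<Rightarrow> real^'n"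
    by (rule scales_lborel_comp[OF that])
  show "scales_lborel f" if "linear f" and 0: "\<And>x. f x $ i = 0" for f :: "real^'n \<Rightarrow> real^'n" and i
  proof -
    have "row i (matrix f) = 0" using 0 by (simp add: row_def matrix_def vec_eq_iff)
    then have "det (matrix f) = 0" by (rule det_zero_row)
    with that show ?thesis by (simp add: scales_lborel_def)
  qed
  show "scales_lborel (\<lambda>x::real^'n. \<chi> i. c i * x $ i)" for c
    by (rule scales_lborel_stretch)
  show shear: "scales_lborel (\<lambda>x::real^'n. \<chi> i. if i = m then x $ m + x $ n else x $ i)" if "m \<noteq> n" for m n
    by (rule scales_lborel_shear[OF that])
  show "scales_lborel (\<lambda>x::real^'n. \<chi> i. x $ Transposition.transpose m n i)" if mn: "m \<noteq> n" for m n
  proof -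
    define S where "S = (\<lambda>m n (x::real^'n). \<chi> i. if i = m then x $ m + x $ n else x $ i)"
    define D where "D = (\<lambda>(x::real^'n). \<chi> i. (if i = n then -1 else 1) * x $ i)"
    \<comment> \<open>\<open>(a, b) \<mapsto> (a + b, b) \<mapsto> (a + b, - a) \<mapsto> (b, - a) \<mapsto> (b, a)\<close>; the middle shear is conjugated by a sign change\<close>
    have "scales_lborel (D \<circ> S m n \<circ> D \<circ> S n m \<circ> D \<circ> S m n)"
      unfolding S_def D_def using mn
      by (intro scales_lborel_comp scales_lborel_stretch shear) auto
    also have "D \<circ> S m n \<circ> D \<circ> S n m \<circ> D \<circ> S m n = (\<lambda>x. \<chi> i. x $ Transposition.transpose m n i)"
      using mn by (auto simp: fun_eq_iff vec_eq_iff S_def D_def Transposition.transpose_def)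
    finally show ?thesis .
  qed
qed

lemma lborel_linear_bij:
  fixes A :: "real^'n \<Rightarrow> real^'n"
  assumes A: "linear A" "det (matrix A) \<noteq> 0"
  shows "lborel = density (distr lborel borel A) (\<lambda>_. ennreal \<bar>det (matrix A)\<bar>)"
proof (rule measure_eqI)
  note [measurable] = linear_borel_measurable[OF A(1)]
  fix X :: "(real^'n) set" assume "X \<in> sets lborel"
  then have [measurable]: "X \<in> sets borel" by simp
  have "(indicator X :: real^'n \<Rightarrow> ennreal) \<in> borel_measurable borel" by measurable
  then have "(\<integral>\<^sup>+x. indicator X x \<partial>lborel) = ennreal \<bar>det (matrix A)\<bar> * (\<integral>\<^sup>+x. indicator X (A x) \<partial>lborel)"
    using scales_lborel_linear[OF A(1)] A(2) unfolding scales_lborel_def by blast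
  also have "(\<integral>\<^sup>+x. indicator X (A x) \<partial>lborel) = emeasure (distr lborel borel A) X"
    using nn_integral_distr[of A lborel borel "indicator X"] by simp
  finally show "emeasure lborel X = emeasure (density (distr lborel borel A) (\<lambda>_. ennreal \<bar>det (matrix A)\<bar>)) X"
    by (simp add: emeasure_density_const)
qed simp

lemma lborel_integral_linear:
  fixes A :: "real^'n \<Rightarrow> real^'n" and f :: "real^'n \<Rightarrow> 'b::{banach,second_countable_topology}"
  assumes A: "linear A" "det (matrix A) \<noteq> 0" and [measurable]: "f \<in> borel_measurable borel"
  shows "(LINT x|lborel. f x) = \<bar>det (matrix A)\<bar> *\<^sub>R (LINT x|lborel. f (A x))"
    and "integrable lborel f \<Longrightarrow> integrable lborel (\<lambda>x. f (A x))"
proof -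
  note eq = lborel_linear_bij[OF A]
  have [measurable]: "A \<in> borel_measurable borel"
    by (rule linear_borel_measurable[OF A(1)])
  show "(LINT x|lborel. f x) = \<bar>det (matrix A)\<bar> *\<^sub>R (LINT x|lborel. f (A x))"
    by (subst eq) (simp add: integral_density integral_distr)
  assume f: "integrable lborel f"
  from f have "integrable lborel (\<lambda>x. \<bar>det (matrix A)\<bar> *\<^sub>R f (A x))"
    by (subst (asm) eq) (simp add: integrable_density integrable_distr_eq)
  from integrable_scaleR_right[OF this, of "inverse \<bar>det (matrix A)\<bar>"]
  show "integrable lborel (\<lambda>x. f (A x))" using A(2) by simp
qed

section \<open>Densities of moderate growth and the tensor product on the orthant\<close>

text \<open>The hypothesis says that \<open>c\<close> has moderate growth in the mean: it may be unbounded near a hyperplane, as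
  the density of a cone spline with an exponent less than one is.\<close>

lemma moderate_mult_schwartz_bound:
  fixes c :: "'a::euclidean_space \<Rightarrow> real"
  assumes c: "integrable lborel (\<lambda>x. c x / (1 + norm x) ^ N)" and [measurable]: "c \<in> borel_measurable borel"
    and [measurable]: "h \<in> borel_measurable borel" and h: "\<And>x. (1 + norm x) ^ N * norm (h x) \<le> K"
  shows "integrable lborel (\<lambda>x. of_real (c x) * (h x :: complex))"
    and "norm (LINT x|lborel. of_real (c x) * h x) \<le> (LINT x|lborel. \<bar>c x\<bar> / (1 + norm x) ^ N) * K"
proof -
  have p: "0 < (1 + norm x) ^ N" for x :: 'a by (simp add: add_pos_nonneg)
  have le: "norm (of_real (c x) * h x) \<le> norm (c x / (1 + norm x) ^ N) * K" for x
  proof -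
    have "norm (h x) \<le> K / (1 + norm x) ^ N"
      using h[of x] p[of x] by (subst pos_le_divide_eq) (auto simp: mult.commute)
    from mult_left_mono[OF this, of "\<bar>c x\<bar>"] show ?thesis
      by (simp add: norm_mult abs_divide)
  qed
  have ci: "integrable lborel (\<lambda>x. norm (c x / (1 + norm x) ^ N) * K)"
    by (intro integrable_mult_left integrable_norm c)
  have "norm (of_real (c x) * h x) \<le> norm (norm (c x / (1 + norm x) ^ N) * K)" for x
    using order.trans[OF le abs_ge_self] by (simp only: real_norm_def)
  then show i: "integrable lborel (\<lambda>x. of_real (c x) * h x)"
    by (intro Bochner_Integration.integrable_bound[OF ci] AE_I2) measurable
  have "norm (LINT x|lborel. of_real (c x) * h x) \<le> (LINT x|lborel. norm (of_real (c x) * h x))" by simp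
  also have "\<dots> \<le> (LINT x|lborel. norm (c x / (1 + norm x) ^ N) * K)"
    by (rule integral_mono[OF integrable_norm[OF i] ci le])
  also have "\<dots> = (LINT x|lborel. \<bar>c x\<bar> / (1 + norm x) ^ N) * K"
    by (subst integral_mult_left_zero) (simp add: abs_divide)
  finally show "norm (LINT x|lborel. of_real (c x) * h x) \<le> (LINT x|lborel. \<bar>c x\<bar> / (1 + norm x) ^ N) * K" .
qed

lemma moderate_tempered:
  fixes c :: "'a::euclidean_space \<Rightarrow> real"
  assumes c: "integrable lborel (\<lambda>x. c x / (1 + norm x) ^ N)" and m[measurable]: "c \<in> borel_measurable borel"
  shows "tempered (dist_of_fun c)" and "represented_by (dist_of_fun c) c"
proof -
  let ?I = "LINT x|lborel. \<bar>c x\<bar> / (1 + norm x) ^ N"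
  have b: "integrable lborel (\<lambda>x. of_real (c x) * f x)"
    "norm (dist_of_fun c f) \<le> ?I * schwartz_norm N f" if f: "f \<in> schwartz" for f
    unfolding dist_of_fun_def
    by (rule moderate_mult_schwartz_bound[OF c m _]; use f schwartz_norm_upper[OF f, of "[]" N] in auto)+
  show "tempered (dist_of_fun c)"
    unfolding tempered_def
  proof (intro conjI ballI allI exI)
    show "dist_of_fun c (\<lambda>x. f x + g x) = dist_of_fun c f + dist_of_fun c g"
      if "f \<in> schwartz" "g \<in> schwartz" for f g
      using b(1)[OF that(1)] b(1)[OF that(2)] by (simp add: dist_of_fun_def distrib_left)
    show "dist_of_fun c (\<lambda>x. a * f x) = a * dist_of_fun c f" for a f
      by (simp add: dist_of_fun_def mult.left_commute)
  qed (rule b(2))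
  have "set_integrable lborel K c" if K: "compact K" for K
  proof -
    obtain R where R: "\<And>x. x \<in> K \<Longrightarrow> norm x \<le> R" using K compact_imp_bounded bounded_iff by metis
    have [measurable]: "K \<in> sets borel" using K by (simp add: borel_compact)
    show ?thesis
      unfolding set_integrable_def
    proof (rule Bochner_Integration.integrable_bound[OF integrable_mult_right[OF c, of "(1 + R) ^ N"]])
      have "norm (indicator K x *\<^sub>R c x) \<le> norm ((1 + R) ^ N * (c x / (1 + norm x) ^ N))" for x
      proof (cases "x \<in> K")
        case True
        have p: "0 < (1 + norm x) ^ N" by (simp add: add_pos_nonneg)
        have "(1 + norm x) ^ N \<le> (1 + R) ^ N" using R[OF True] by (intro power_mono) auto
        then have "1 \<le> (1 + R) ^ N / (1 + norm x) ^ N" using p by simp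
        from mult_right_mono[OF this, of "\<bar>c x\<bar>"] have "\<bar>c x\<bar> \<le> (1 + R) ^ N / (1 + norm x) ^ N * \<bar>c x\<bar>" by simp
        also have "\<dots> \<le> norm ((1 + R) ^ N / (1 + norm x) ^ N) * \<bar>c x\<bar>"
          by (intro mult_right_mono) (auto simp: abs_divide intro!: divide_right_mono abs_ge_self)
        also have "\<dots> = norm ((1 + R) ^ N * (c x / (1 + norm x) ^ N))"
          by (simp add: abs_mult abs_divide)
        finally show ?thesis using True by simp
      qed simp
      then show "AE x in lborel. norm (indicator K x *\<^sub>R c x) \<le> norm ((1 + R) ^ N * (c x / (1 + norm x) ^ N))"
        by (rule AE_I2)
    qed measurable
  qed
  with b show "represented_by (dist_of_fun c) c" by (auto simp: represented_by_def)
qed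

lemma half_line_density_nonneg: "0 < a \<Longrightarrow> 0 \<le> half_line_density a x"
  by (simp add: half_line_density_def trunc_power_def)

definition orthant_density :: "('n::finite \<Rightarrow> real) \<Rightarrow> real^'n \<Rightarrow> real" where
  "orthant_density \<alpha> y = (\<Prod>k\<in>UNIV. half_line_density (\<alpha> k) (y $ k))"

lemma orthant_density_measurable [measurable]: "orthant_density \<alpha> \<in> borel_measurable borel"
  unfolding orthant_density_def[abs_def] by measurable

text \<open>One exponent \<open>m\<close>, larger than every \<open>\<alpha> k + 1\<close>, makes all one-variable integrals converge; and
  \<open>(1 + norm y) ^ (m * CARD('n))\<close> dominates the product of the one-variable weights.\<close>

lemma orthant_density_moderate:
  fixes \<alpha> :: "'n::finite \<Rightarrow> real"
  assumes \<alpha>: "\<And>k. 0 < \<alpha> k"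
  obtains N where "integrable lborel (\<lambda>y. orthant_density \<alpha> y / (1 + norm y) ^ N)"
proof -
  define m where "m = nat \<lceil>\<Sum>k\<in>UNIV. \<alpha> k\<rceil> + 2"
  have m: "\<alpha> k - 1 + 2 \<le> real m" for k
  proof -
    have "\<alpha> k \<le> (\<Sum>k\<in>UNIV. \<alpha> k)" by (rule member_le_sum) (auto intro: less_imp_le \<alpha>)
    then show ?thesis unfolding m_def by linarith
  qed
  have i: "integrable lborel (\<lambda>t. half_line_density (\<alpha> k) t / (1 + \<bar>t\<bar>) ^ m)" for k
  proof (rule Bochner_Integration.integrable_bound)
    show "integrable lborel (\<lambda>t::real. (1 / Gamma (\<alpha> k)) * (\<bar>t\<bar> powr (\<alpha> k - 1) / (1 + \<bar>t\<bar>) ^ m))"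
      by (intro integrable_mult_right integrable_powr_decay m) (use \<alpha>[of k] in \<open>auto simp: m_def\<close>)
    show "AE t in lborel. norm (half_line_density (\<alpha> k) t / (1 + \<bar>t\<bar>) ^ m)
        \<le> norm ((1 / Gamma (\<alpha> k)) * (\<bar>t\<bar> powr (\<alpha> k - 1) / (1 + \<bar>t\<bar>) ^ m))"
      by (intro AE_I2) (auto simp: half_line_density_def trunc_power_def abs_mult)
  qed measurable
  have "integrable lborel (\<lambda>y. orthant_density \<alpha> y / (1 + norm y) ^ (m * CARD('n)))"
  proof (rule Bochner_Integration.integrable_bound[OF lborel_prod_components(1)[OF i]])
    show "AE y in lborel. norm (orthant_density \<alpha> y / (1 + norm y) ^ (m * CARD('n)))
      \<le> norm (\<Prod>k\<in>UNIV. half_line_density (\<alpha> k) (y $ k) / (1 + \<bar>y $ k\<bar>) ^ m)"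
    proof (rule AE_I2)
      fix y :: "real^'n"
      have nn: "0 \<le> orthant_density \<alpha> y"
        unfolding orthant_density_def by (intro prod_nonneg half_line_density_nonneg \<alpha> ballI)
      have "(\<Prod>k\<in>UNIV. (1 + \<bar>y $ k\<bar>) ^ m) \<le> (\<Prod>k\<in>(UNIV::'n set). (1 + norm y) ^ m)"
        by (intro prod_mono conjI power_mono) (auto intro: component_le_norm_cart)
      also have "\<dots> = (1 + norm y) ^ (m * CARD('n))" by (simp add: power_mult)
      finally have le: "(\<Prod>k\<in>UNIV. (1 + \<bar>y $ k\<bar>) ^ m) \<le> (1 + norm y) ^ (m * CARD('n))" .
      have p: "0 < (\<Prod>k\<in>UNIV. (1 + \<bar>y $ k\<bar>) ^ m)" by (intro prod_pos) (simp add: add_pos_nonneg)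
      have "orthant_density \<alpha> y / (1 + norm y) ^ (m * CARD('n)) \<le> orthant_density \<alpha> y / (\<Prod>k\<in>UNIV. (1 + \<bar>y $ k\<bar>) ^ m)"
        using le p nn by (intro divide_left_mono mult_pos_pos) (auto intro: less_le_trans)
      also have "\<dots> = (\<Prod>k\<in>UNIV. half_line_density (\<alpha> k) (y $ k) / (1 + \<bar>y $ k\<bar>) ^ m)"
        by (simp add: orthant_density_def prod_dividef)
      finally show "norm (orthant_density \<alpha> y / (1 + norm y) ^ (m * CARD('n)))
         \<le> norm (\<Prod>k\<in>UNIV. half_line_density (\<alpha> k) (y $ k) / (1 + \<bar>y $ k\<bar>) ^ m)"
        using nn by (simp add: abs_divide)
    qed
  qed measurable
  then show ?thesis by (rule that)
qed

text \<open>Continuity comes from the decay of \<open>fourier \<psi>\<close> in terms of a Schwartz norm of \<open>\<psi>\<close>; on products the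
  integral factors into the one-variable pairings.\<close>

theorem orthant_tensor_product:
  fixes \<alpha> :: "'n::finite \<Rightarrow> real"
  assumes \<alpha>: "\<And>k. 0 < \<alpha> k"
  shows "is_tensor_product (\<lambda>k. cone_factor (\<alpha> k)) (dist_fourier (dist_of_fun (orthant_density \<alpha>)))"
  unfolding is_tensor_product_def
proof (intro conjI allI impI)
  let ?G = "orthant_density \<alpha>"
  obtain N where N: "integrable lborel (\<lambda>y. ?G y / (1 + norm y) ^ N)"
    by (rule orthant_density_moderate[OF \<alpha>])
  obtain M C where C: "0 \<le> C" "\<And>(f::real^'n \<Rightarrow> complex) y. f \<in> schwartz \<Longrightarrow>
     (1 + norm y) ^ N * norm (fourier f y) \<le> C * schwartz_norm M f"
    using fourier_decay[of N, where 'a = "real^'n"] by metis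
  let ?I = "LINT x|lborel. \<bar>?G x\<bar> / (1 + norm x) ^ N"
  have b: "integrable lborel (\<lambda>x. of_real (?G x) * fourier f x)"
    "norm (dist_of_fun ?G (fourier f)) \<le> ?I * (C * schwartz_norm M f)" if f: "f \<in> schwartz" for f
    unfolding dist_of_fun_def
    by (rule moderate_mult_schwartz_bound[OF N _ _ C(2)[OF f]]; use f in \<open>auto intro!: fourier_measurable\<close>)+
  show "tempered (dist_fourier (dist_of_fun ?G))"
    unfolding tempered_def dist_fourier_def
  proof (intro conjI ballI allI exI)
    show "dist_of_fun ?G (fourier (\<lambda>x. f x + g x)) = dist_of_fun ?G (fourier f) + dist_of_fun ?G (fourier g)"
      if "f \<in> schwartz" "g \<in> schwartz" for f g
      using b(1)[OF that(1)] b(1)[OF that(2)] by (simp add: dist_of_fun_def fourier_add[OF that] distrib_left)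
    show "dist_of_fun ?G (fourier (\<lambda>x. a * f x)) = a * dist_of_fun ?G (fourier f)" for a f
      by (simp add: dist_of_fun_def fourier_def mult.assoc mult.left_commute)
    show "norm (dist_of_fun ?G (fourier f)) \<le> (?I * C) * schwartz_norm M f" if "f \<in> schwartz" for f
      using b(2)[OF that] by (simp add: mult.assoc)
  qed
  fix \<phi> :: "'n \<Rightarrow> real \<Rightarrow> complex" assume \<phi>: "\<forall>k. \<phi> k \<in> schwartz"
  have i: "integrable lborel (\<lambda>t. of_real (half_line_density (\<alpha> k) t) * fourier (\<phi> k) t)" for k
  proof (rule Bochner_Integration.integrable_bound)
    show "integrable lborel (\<lambda>t. norm (1 / Gamma (\<alpha> k)) * (\<bar>t\<bar> powr (\<alpha> k - 1) * norm (fourier (\<phi> k) t)))"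
      by (intro integrable_mult_right rapid_integrable rapid_fourier) (use \<alpha>[of k] \<phi> in auto)
    have [measurable]: "fourier (\<phi> k) \<in> borel_measurable borel"
      using \<phi> schwartz_measurable by (intro fourier_measurable) blast
    show "(\<lambda>t. of_real (half_line_density (\<alpha> k) t) * fourier (\<phi> k) t) \<in> borel_measurable lborel"
      by measurable
    show "AE t in lborel. norm (of_real (half_line_density (\<alpha> k) t) * fourier (\<phi> k) t)
       \<le> norm (norm (1 / Gamma (\<alpha> k)) * (\<bar>t\<bar> powr (\<alpha> k - 1) * norm (fourier (\<phi> k) t)))"
      by (intro AE_I2) (auto simp: half_line_density_def trunc_power_def norm_mult abs_mult norm_divide)
  qed
  have "dist_fourier (dist_of_fun ?G) (\<lambda>y. \<Prod>k\<in>UNIV. \<phi> k (y $ k))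
      = (LINT y|lborel. (\<Prod>k\<in>UNIV. of_real (half_line_density (\<alpha> k) (y $ k)) * fourier (\<phi> k) (y $ k)))"
    using \<phi> by (simp add: dist_fourier_def dist_of_fun_def orthant_density_def fourier_product prod.distrib)
  also have "\<dots> = (\<Prod>k\<in>UNIV. LINT t|lborel. of_real (half_line_density (\<alpha> k) t) * fourier (\<phi> k) t)"
    by (rule lborel_prod_components(2)[OF i])
  also have "\<dots> = (\<Prod>k\<in>UNIV. cone_factor (\<alpha> k) (\<phi> k))"
    using \<phi> by (simp add: cone_factor_eq[OF \<alpha>])
  finally show "dist_fourier (dist_of_fun ?G) (\<lambda>y. \<Prod>k\<in>UNIV. \<phi> k (y $ k)) = (\<Prod>k\<in>UNIV. cone_factor (\<alpha> k) (\<phi> k))" .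
qed

section \<open>Gaussians and their Fourier transforms\<close>

text \<open>Polynomial functions, generated so that induction yields that their derivatives are polynomial and
  that they grow polynomially.\<close>

inductive polyfun :: "('a::euclidean_space \<Rightarrow> complex) \<Rightarrow> bool" where
  const: "polyfun (\<lambda>x. c)"
| linear: "polyfun (\<lambda>x. of_real (x \<bullet> v))"
| add: "polyfun p \<Longrightarrow> polyfun q \<Longrightarrow> polyfun (\<lambda>x. p x + q x)"
| mult: "polyfun p \<Longrightarrow> polyfun q \<Longrightarrow> polyfun (\<lambda>x. p x * q x)"

lemma polyfun_sum:
  assumes "finite I" "\<And>i. i \<in> I \<Longrightarrow> polyfun (p i)"
  shows "polyfun (\<lambda>x. \<Sum>i\<in>I. p i x)"
  using assms by (induction I) (auto intro: polyfun.intros)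

lemma polyfun_derivative:
  assumes "polyfun p"
  shows "\<exists>p'. (\<forall>x. (p has_derivative p' x) (at x)) \<and> (\<forall>b. polyfun (\<lambda>x. p' x b))"
  using assms
proof induction
  case (const c)
  show ?case by (rule exI[of _ "\<lambda>x h. 0"]) (auto intro: polyfun.const)
next
  case (linear v)
  show ?case
    by (rule exI[of _ "\<lambda>x h. of_real (h \<bullet> v)"]) (auto intro: polyfun.const intro!: derivative_eq_intros)
next
  case (add p q)
  then obtain p' q' where *: "\<And>x. (p has_derivative p' x) (at x)" "\<And>b. polyfun (\<lambda>x. p' x b)"
    "\<And>x. (q has_derivative q' x) (at x)" "\<And>b. polyfun (\<lambda>x. q' x b)" by blast
  then show ?case
    by (intro exI[of _ "\<lambda>x h. p' x h + q' x h"] conjI allI has_derivative_add polyfun.add) auto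
next
  case (mult p q)
  then obtain p' q' where *: "\<And>x. (p has_derivative p' x) (at x)" "\<And>b. polyfun (\<lambda>x. p' x b)"
    "\<And>x. (q has_derivative q' x) (at x)" "\<And>b. polyfun (\<lambda>x. q' x b)" by blast
  then show ?case using mult.hyps
    by (intro exI[of _ "\<lambda>x h. p x * q' x h + p' x h * q x"] conjI allI has_derivative_mult
          polyfun.add polyfun.mult) auto
qed

lemma polyfun_growth:
  assumes "polyfun p"
  shows "\<exists>K m. 0 \<le> K \<and> (\<forall>x. norm (p x) \<le> K * (1 + norm x) ^ m)"
  using assms
proof induction
  case (const c)
  show ?case by (rule exI[of _ "norm c"], rule exI[of _ 0]) auto
next
  case (linear v)
  have "norm (complex_of_real (x \<bullet> v)) \<le> norm v * (1 + norm x) ^ 1" for x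
    using Cauchy_Schwarz_ineq2[of x v] by (simp add: algebra_simps add_increasing)
  then show ?case by (intro exI[of _ "norm v"] exI[of _ 1]) auto
next
  case (add p q)
  then obtain K m L n where *: "0 \<le> K" "\<And>x. norm (p x) \<le> K * (1 + norm x) ^ m"
    "0 \<le> L" "\<And>x. norm (q x) \<le> L * (1 + norm x) ^ n" by blast
  have "norm (p x + q x) \<le> (K + L) * (1 + norm x) ^ (m + n)" for x
  proof -
    have "norm (p x + q x) \<le> K * (1 + norm x) ^ m + L * (1 + norm x) ^ n"
      by (intro norm_triangle_le add_mono *)
    also have "\<dots> \<le> K * (1 + norm x) ^ (m + n) + L * (1 + norm x) ^ (m + n)"
      using * by (intro add_mono mult_left_mono power_increasing) auto
    finally show ?thesis by (simp add: algebra_simps)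
  qed
  then show ?case using * by (intro exI[of _ "K + L"] exI[of _ "m + n"]) auto
next
  case (mult p q)
  then obtain K m L n where *: "0 \<le> K" "\<And>x. norm (p x) \<le> K * (1 + norm x) ^ m"
    "0 \<le> L" "\<And>x. norm (q x) \<le> L * (1 + norm x) ^ n" by blast
  have "norm (p x * q x) \<le> (K * L) * (1 + norm x) ^ (m + n)" for x
  proof -
    have "norm (p x * q x) \<le> (K * (1 + norm x) ^ m) * (L * (1 + norm x) ^ n)"
      unfolding norm_mult using * by (intro mult_mono) auto
    then show ?thesis by (simp add: power_add mult_ac)
  qed
  then show ?case using * by (intro exI[of _ "K * L"] exI[of _ "m + n"]) auto
qed

text \<open>Since \<open>1 + t \<le> exp t\<close>, the exponent to be bounded is \<open>n * t - c * t\<^sup>2\<close>; complete the square.\<close>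

lemma power_times_gaussian_bound:
  fixes t c :: real
  assumes "0 \<le> t" "0 < c"
  shows "(1 + t) ^ n * exp (- c * t\<^sup>2) \<le> exp (real n ^ 2 / (4 * c))"
proof -
  have "(1 + t) ^ n \<le> exp t ^ n" using assms by (intro power_mono exp_ge_add_one_self) auto
  also have "\<dots> = exp (real n * t)" by (simp add: exp_of_nat_mult)
  finally have "(1 + t) ^ n * exp (- c * t\<^sup>2) \<le> exp (real n * t) * exp (- c * t\<^sup>2)"
    by (intro mult_right_mono) auto
  also have "\<dots> = exp (real n * t - c * t\<^sup>2)" by (simp add: exp_diff exp_minus divide_inverse)
  also have "real n * t - c * t\<^sup>2 \<le> real n ^ 2 / (4 * c)"
  proof -
    have "0 \<le> (2 * c * t - real n)\<^sup>2" by simp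
    then have "(real n * t - c * t\<^sup>2) * (4 * c) \<le> real n ^ 2"
      by (simp add: power2_eq_square algebra_simps)
    then show ?thesis using assms by (subst pos_le_divide_eq) auto
  qed
  finally show ?thesis by simp
qed

text \<open>Every iterated derivative of \<open>exp (q x)\<close> is a polynomial function times \<open>exp (q x)\<close>.\<close>

lemma exp_polyfun_schwartz:
  fixes q :: "'a::euclidean_space \<Rightarrow> complex"
  assumes q: "polyfun q" and c: "0 < c" and Re: "\<And>x. Re (q x) \<le> - c * (norm x)\<^sup>2"
  shows "(\<lambda>x. exp (q x)) \<in> schwartz"
proof -
  obtain q' where q': "\<And>x. (q has_derivative q' x) (at x)" "\<And>b. polyfun (\<lambda>x. q' x b)"
    using polyfun_derivative[OF q] by blast
  have der: "((\<lambda>x. p x * exp (q x)) has_derivative (\<lambda>h. p x * (exp (q x) * q' x h) + p' x h * exp (q x))) (at x)"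
    if "\<And>x. (p has_derivative p' x) (at x)" for p p' x
    by (rule has_derivative_mult[OF that])
       (rule has_derivative_compose[OF q'(1) DERIV_exp[unfolded has_field_derivative_def]])
  have form: "\<exists>p. polyfun p \<and> iter_deriv bs (\<lambda>x. exp (q x)) = (\<lambda>x. p x * exp (q x))" for bs
  proof (induction bs)
    case Nil
    show ?case by (rule exI[of _ "\<lambda>x. 1"]) (auto intro: polyfun.const)
  next
    case (Cons b bs)
    then obtain p where p: "polyfun p" "iter_deriv bs (\<lambda>x. exp (q x)) = (\<lambda>x. p x * exp (q x))" by blast
    obtain p' where p': "\<And>x. (p has_derivative p' x) (at x)" "\<And>b. polyfun (\<lambda>x. p' x b)"
      using polyfun_derivative[OF p(1)] by blast
    have "iter_deriv (b # bs) (\<lambda>x. exp (q x)) = (\<lambda>x. (p x * q' x b + p' x b) * exp (q x))"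
      unfolding iter_deriv.simps p(2) frechet_derivative_at[OF der[OF p'(1)], symmetric]
      by (simp add: algebra_simps)
    moreover have "polyfun (\<lambda>x. p x * q' x b + p' x b)"
      by (intro polyfun.add polyfun.mult p p' q')
    ultimately show ?case by blast
  qed
  show ?thesis
  proof (rule schwartzI)
    fix bs :: "'a list"
    obtain p where p: "polyfun p" and eq: "iter_deriv bs (\<lambda>x. exp (q x)) = (\<lambda>x. p x * exp (q x))"
      using form by blast
    obtain p' where p': "\<And>x. (p has_derivative p' x) (at x)" using polyfun_derivative[OF p] by blast
    show "iter_deriv bs (\<lambda>x. exp (q x)) differentiable at x" for x
      unfolding eq differentiable_def using der[OF p'] by blast
    fix m
    obtain K n where K: "0 \<le> K" "\<And>x. norm (p x) \<le> K * (1 + norm x) ^ n"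
      using polyfun_growth[OF p] by blast
    have "(1 + norm x) ^ m * norm (p x * exp (q x)) \<le> K * exp (real (m + n) ^ 2 / (4 * c))" for x
    proof -
      have "norm (p x * exp (q x)) \<le> (K * (1 + norm x) ^ n) * exp (- c * (norm x)\<^sup>2)"
        unfolding norm_mult norm_exp_eq_Re using K Re[of x] by (intro mult_mono) auto
      then have "(1 + norm x) ^ m * norm (p x * exp (q x)) \<le> (1 + norm x) ^ m * ((K * (1 + norm x) ^ n) * exp (- c * (norm x)\<^sup>2))"
        by (intro mult_left_mono) auto
      also have "\<dots> = K * ((1 + norm x) ^ (m + n) * exp (- c * (norm x)\<^sup>2))"
        by (simp add: power_add mult_ac)
      also have "\<dots> \<le> K * exp (real (m + n) ^ 2 / (4 * c))"
        using K c by (intro mult_left_mono power_times_gaussian_bound) auto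
      finally show ?thesis .
    qed
    then show "\<exists>K. \<forall>x. (1 + norm x) ^ m * norm (iter_deriv bs (\<lambda>x. exp (q x)) x) \<le> K"
      unfolding eq by blast
  qed
qed

text \<open>A modulated Gaussian.  Modulation by \<open>v\<close> becomes translation by \<open>- v\<close> of the Fourier transform.\<close>

definition wave_packet :: "real \<Rightarrow> real \<Rightarrow> real \<Rightarrow> complex" where
  "wave_packet \<delta> v t = exp (- of_real ((\<delta> * t)\<^sup>2 / 2) - \<i> * of_real (v * t))"

lemma wave_packet_schwartz:
  assumes \<delta>: "0 < \<delta>"
  shows "wave_packet \<delta> v \<in> schwartz"
proof -
  have "polyfun (\<lambda>t::real. of_real (- \<delta>\<^sup>2 / 2) * (of_real (t \<bullet> 1) * of_real (t \<bullet> 1)) + (- \<i> * of_real v) * of_real (t \<bullet> 1))"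
    by (intro polyfun.intros)
  moreover have "(\<lambda>t::real. of_real (- \<delta>\<^sup>2 / 2) * (of_real (t \<bullet> 1) * of_real (t \<bullet> 1)) + (- \<i> * of_real v) * of_real (t \<bullet> 1))
      = (\<lambda>t. - of_real ((\<delta> * t)\<^sup>2 / 2) - \<i> * of_real (v * t))"
    by (auto simp: fun_eq_iff power2_eq_square)
  ultimately have "polyfun (\<lambda>t. - of_real ((\<delta> * t)\<^sup>2 / 2) - \<i> * of_real (v * t))" by simp
  then show ?thesis
    unfolding wave_packet_def[abs_def]
    by (rule exp_polyfun_schwartz[where c = "\<delta>\<^sup>2 / 2"]) (use \<delta> in \<open>auto simp: power_mult_distrib\<close>)
qed

text \<open>The characteristic function of the standard normal distribution, rescaled.\<close>

lemma fourier_wave_packet: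
  assumes \<delta>: "0 < \<delta>"
  shows "fourier (wave_packet \<delta> v) t = of_real (sqrt (2 * pi) / \<delta> * exp (- ((t + v) / \<delta>)\<^sup>2 / 2))"
proof -
  define u where "u = - (t + v) / \<delta>"
  have "(CLINT x|std_normal_distribution. iexp (u * x)) = complex_of_real (exp (- (u^2) / 2))"
    using char_std_normal_distribution unfolding char_def by metis
  moreover have "(CLINT x|std_normal_distribution. iexp (u * x)) = (LINT x|lborel. of_real (std_normal_density x) * iexp (u * x))"
    by (subst integral_density) (auto simp: scaleR_conv_of_real)
  moreover have "\<dots> = \<delta> *\<^sub>R (LINT x|lborel. of_real (std_normal_density (0 + \<delta> * x)) * iexp (u * (0 + \<delta> * x)))"
    using lborel_integral_real_affine[of \<delta> "\<lambda>x. of_real (std_normal_density x) * iexp (u * x)" 0] \<delta> by simp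
  moreover have "of_real (std_normal_density (0 + \<delta> * x)) * iexp (u * (0 + \<delta> * x))
      = of_real (1 / sqrt (2 * pi)) * (wave_packet \<delta> v x * exp (- \<i> * of_real (t \<bullet> x)))" for x
  proof -
    have "u * (\<delta> * x) = - (t * x) - v * x" using \<delta> by (simp add: u_def field_simps)
    then have "\<i> * complex_of_real (u * (\<delta> * x)) = - \<i> * of_real (v * x) + - \<i> * of_real (t * x)"
      by (simp only:) (simp add: algebra_simps)
    then have "iexp (u * (\<delta> * x)) = exp (- \<i> * of_real (v * x)) * exp (- \<i> * of_real (t * x))"
      by (simp only: exp_add)
    moreover have "wave_packet \<delta> v x = of_real (exp (- (\<delta> * x)\<^sup>2 / 2)) * exp (- \<i> * of_real (v * x))"
      unfolding wave_packet_def exp_of_real[symmetric] exp_add[symmetric] by simp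
    ultimately show ?thesis
      by (simp add: std_normal_density_def mult_ac)
  qed
  ultimately have "complex_of_real (exp (- (u^2) / 2)) = of_real \<delta> * (of_real (1 / sqrt (2 * pi)) * fourier (wave_packet \<delta> v) t)"
    by (simp add: fourier_def scaleR_conv_of_real)
  moreover have "of_real \<delta> \<noteq> (0::complex)" "complex_of_real (sqrt (2 * pi)) \<noteq> 0" using \<delta> by auto
  ultimately have "fourier (wave_packet \<delta> v) t = of_real (sqrt (2 * pi)) / of_real \<delta> * of_real (exp (- (u^2) / 2))"
    by (simp add: field_simps)
  moreover have "u^2 = ((t + v) / \<delta>)^2" unfolding u_def by (simp only: minus_divide_left[symmetric] power2_minus)
  ultimately show ?thesis by simp
qed

section \<open>Density of the dilates and translates of one Schwartz function\<close>

lemma schwartz_derivative_bound: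
  fixes F :: "'a::euclidean_space \<Rightarrow> complex"
  assumes F: "F \<in> schwartz"
  obtains C where "0 \<le> C" "\<And>x v. (1 + norm x) ^ N * norm (frechet_derivative F (at x) v) \<le> C * norm v"
proof -
  have "\<exists>K. 0 \<le> K \<and> (\<forall>x. (1 + norm x) ^ N * norm (frechet_derivative F (at x) b) \<le> K)" if b: "b \<in> Basis" for b
    using schwartz_bound[OF F, of "[b]" N] b
    by (simp only: iter_deriv.simps Cons_in_lists_iff lists.Nil simp_thms) metis
  then obtain K where K: "\<And>b. b \<in> Basis \<Longrightarrow> 0 \<le> K b"
    "\<And>b x. b \<in> Basis \<Longrightarrow> (1 + norm x) ^ N * norm (frechet_derivative F (at x) b) \<le> K b" by metis
  have "(1 + norm x) ^ N * norm (frechet_derivative F (at x) v) \<le> (\<Sum>b\<in>Basis. K b) * norm v" for x v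
  proof -
    let ?L = "frechet_derivative F (at x)"
    have lin: "linear ?L" using schwartz_has_derivative[OF F] by (rule has_derivative_linear)
    have "?L v = ?L (\<Sum>b\<in>Basis. (v \<bullet> b) *\<^sub>R b)" by (simp add: euclidean_representation)
    also have "\<dots> = (\<Sum>b\<in>Basis. (v \<bullet> b) *\<^sub>R ?L b)"
      using lin by (simp add: linear_sum linear_cmul)
    finally have "norm (?L v) \<le> (\<Sum>b\<in>Basis. \<bar>v \<bullet> b\<bar> * norm (?L b))"
      by (simp add: sum_norm_le)
    also have "\<dots> \<le> (\<Sum>b\<in>Basis. norm v * norm (?L b))"
      by (intro sum_mono mult_right_mono Basis_le_norm) auto
    finally have "(1 + norm x) ^ N * norm (?L v) \<le> (1 + norm x) ^ N * (\<Sum>b\<in>Basis. norm v * norm (?L b))"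
      by (intro mult_left_mono) auto
    also have "\<dots> = (\<Sum>b\<in>Basis. (1 + norm x) ^ N * norm (?L b)) * norm v"
      by (simp add: sum_distrib_left sum_distrib_right mult_ac)
    also have "\<dots> \<le> (\<Sum>b\<in>Basis. K b) * norm v"
      by (intro mult_right_mono sum_mono K) auto
    finally show ?thesis .
  qed
  moreover have "0 \<le> (\<Sum>b\<in>Basis. K b)" by (intro sum_nonneg K)
  ultimately show ?thesis by (rule that[rotated])
qed

text \<open>On the segment between \<open>x - y\<close> and \<open>x - z\<close> a point \<open>\<xi>\<close> satisfies
  \<open>1 + norm x \<le> (1 + norm y + norm z) * (1 + norm \<xi>)\<close>.  So the weight in \<open>x\<close> is absorbed by the decay of
  the derivative, at the price of a weight in \<open>y\<close> and \<open>z\<close>.\<close>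

lemma schwartz_lipschitz:
  fixes F :: "'a::euclidean_space \<Rightarrow> complex"
  assumes F: "F \<in> schwartz"
  obtains C where "0 \<le> C" "\<And>x y z. (1 + norm x) ^ N * norm (F (x - y) - F (x - z))
      \<le> C * ((1 + norm y + norm z) ^ N * norm (y - z))"
proof -
  obtain C where C: "0 \<le> C" "\<And>x v. (1 + norm x) ^ N * norm (frechet_derivative F (at x) v) \<le> C * norm v"
    using schwartz_derivative_bound[OF F, of N] by metis
  have "(1 + norm x) ^ N * norm (F (x - y) - F (x - z)) \<le> C * ((1 + norm y + norm z) ^ N * norm (y - z))" for x y z
  proof -
    define B where "B = C * (1 + norm y + norm z) ^ N * norm (y - z) / (1 + norm x) ^ N"
    have p: "0 < (1 + norm x) ^ N" by (simp add: add_pos_nonneg)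
    have "norm ((F ((x - y) + 1 *\<^sub>R (y - z)) - F (x - y)) /\<^sub>R 1) \<le> B"
    proof (rule difference_quotient_bound[OF schwartz_has_derivative[OF F]])
      fix t :: real assume t: "0 < t" "t < 1"
      define \<xi> where "\<xi> = x - y + t *\<^sub>R (y - z)"
      have "x = \<xi> + ((1 - t) *\<^sub>R y + t *\<^sub>R z)" by (simp add: \<xi>_def algebra_simps)
      then have "norm x \<le> norm \<xi> + (norm ((1 - t) *\<^sub>R y) + norm (t *\<^sub>R z))"
        by (metis norm_triangle_ineq norm_triangle_le add_left_mono)
      also have "norm ((1 - t) *\<^sub>R y) \<le> norm y" using t by (simp add: mult_left_le_one_le)
      also have "norm (t *\<^sub>R z) \<le> norm z" using t by (simp add: mult_left_le_one_le)
      finally have "1 + norm x \<le> 1 + (norm \<xi> + (norm y + norm z))" by simp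
      also have "\<dots> \<le> (1 + norm y + norm z) * (1 + norm \<xi>)" by (simp add: algebra_simps)
      finally have "(1 + norm x) ^ N \<le> ((1 + norm y + norm z) * (1 + norm \<xi>)) ^ N"
        by (intro power_mono) auto
      then have "(1 + norm x) ^ N * norm (frechet_derivative F (at \<xi>) (y - z))
          \<le> ((1 + norm y + norm z) * (1 + norm \<xi>)) ^ N * norm (frechet_derivative F (at \<xi>) (y - z))"
        by (intro mult_right_mono) auto
      also have "\<dots> = (1 + norm y + norm z) ^ N * ((1 + norm \<xi>) ^ N * norm (frechet_derivative F (at \<xi>) (y - z)))"
        by (simp add: power_mult_distrib)
      also have "\<dots> \<le> (1 + norm y + norm z) ^ N * (C * norm (y - z))"
        by (intro mult_left_mono C) auto
      finally show "norm (frechet_derivative F (at (x - y + t *\<^sub>R (y - z))) (y - z)) \<le> B"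
        using p unfolding B_def \<xi>_def[symmetric] by (subst pos_le_divide_eq) (auto simp: mult_ac)
    qed simp
    then have "norm (F (x - z) - F (x - y)) \<le> B" by simp
    then have "norm (F (x - y) - F (x - z)) * (1 + norm x) ^ N \<le> C * (1 + norm y + norm z) ^ N * norm (y - z)"
      using p unfolding B_def by (subst (asm) pos_le_divide_eq) (auto simp: norm_minus_commute)
    then show ?thesis by (simp add: mult_ac)
  qed
  with C(1) show ?thesis by (rule that)
qed

lemma schwartz_weighted_integrable:
  fixes f :: "'a::euclidean_space \<Rightarrow> complex"
  assumes f: "f \<in> schwartz"
  shows "integrable lborel (\<lambda>x. (1 + norm x) ^ m * norm (f x))"
proof -
  obtain K where K: "0 \<le> K" "\<And>x. (1 + norm x) ^ (2 * DIM('a) + m) * norm (iter_deriv [] f x) \<le> K"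
    using schwartz_bound[OF f lists.Nil, of "2 * DIM('a) + m"] by metis
  have [measurable]: "f \<in> borel_measurable borel" using f by auto
  show ?thesis
    by (rule integrable_weight_bound(1)[of _ K]) (use K in \<open>auto simp: power_add abs_mult mult_ac\<close>)
qed

lemma schwartz_bounded:
  fixes f :: "'a::euclidean_space \<Rightarrow> complex"
  assumes f: "f \<in> schwartz"
  obtains K where "\<And>x. norm (f x) \<le> K"
  using schwartz_bound[OF f lists.Nil, of 0] by auto

lemma schwartz_convolution_integrable:
  fixes p F :: "'a::euclidean_space \<Rightarrow> complex"
  assumes p: "p \<in> schwartz" and F: "F \<in> schwartz" and [measurable]: "s \<in> borel_measurable borel"
  shows "integrable lborel (\<lambda>y. p y * F (s y))"
proof -
  obtain K where K: "\<And>x. norm (F x) \<le> K" using schwartz_bounded[OF F] by metis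
  have [measurable]: "p \<in> borel_measurable borel" "F \<in> borel_measurable borel" using p F by auto
  have K0: "0 \<le> K" using order.trans[OF norm_ge_zero K] .
  show ?thesis
    by (rule Bochner_Integration.integrable_bound[OF integrable_mult_left[OF integrable_norm[OF schwartz_integrable[OF p]], of K]])
       (auto simp: norm_mult K0 intro!: mult_left_mono K AE_I2)
qed

text \<open>Dominated convergence: the difference quotients of \<open>F\<close> are bounded by the supremum of its derivative.\<close>

lemma convolution_difference_quotient:
  fixes p F :: "'a::euclidean_space \<Rightarrow> complex"
  assumes p: "p \<in> schwartz" and F: "F \<in> schwartz" and b: "b \<in> Basis"
    and h: "\<And>n. 0 < h n" "h \<longlonglongrightarrow> 0"
  shows "(\<lambda>n. ((LINT y|lborel. p y * F (x + h n *\<^sub>R b - y)) - (LINT y|lborel. p y * F (x - y))) / of_real (h n))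
      \<longlonglongrightarrow> (LINT y|lborel. p y * frechet_derivative F (at (x - y)) b)"
proof -
  have [measurable]: "p \<in> borel_measurable borel" "F \<in> borel_measurable borel"
    "(\<lambda>x. frechet_derivative F (at x) b) \<in> borel_measurable borel"
    using p F schwartz_directional_derivative[OF F b] by auto
  obtain K where K: "\<And>x. norm (frechet_derivative F (at x) b) \<le> K"
    using schwartz_bounded[OF schwartz_directional_derivative[OF F b]] by metis
  let ?q = "\<lambda>n y. (F (x - y + h n *\<^sub>R b) - F (x - y)) /\<^sub>R h n"
  have eq: "((LINT y|lborel. p y * F (x + h n *\<^sub>R b - y)) - (LINT y|lborel. p y * F (x - y))) / of_real (h n)
      = (LINT y|lborel. p y * ?q n y)" for n
  proof -
    have i: "integrable lborel (\<lambda>y. p y * F (x + h n *\<^sub>R b - y))" "integrable lborel (\<lambda>y. p y * F (x - y))"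
      by (rule schwartz_convolution_integrable[OF p F]; measurable)+
    have "p y * ?q n y = (p y * F (x + h n *\<^sub>R b - y) - p y * F (x - y)) / of_real (h n)" for y
      by (simp add: scaleR_conv_of_real divide_inverse algebra_simps)
    then show ?thesis using i by simp
  qed
  show ?thesis
    unfolding eq
  proof (rule integral_dominated_convergence[where w = "\<lambda>y. norm (p y) * K"])
    show "integrable lborel (\<lambda>y. norm (p y) * K)"
      by (intro integrable_mult_left integrable_norm schwartz_integrable p)
    show "AE y in lborel. (\<lambda>n. p y * ?q n y) \<longlonglongrightarrow> p y * frechet_derivative F (at (x - y)) b"
      by (intro AE_I2 tendsto_mult tendsto_const
            filterlim_compose[OF difference_quotient_limit[OF schwartz_has_derivative[OF F]]])
         (use h in \<open>auto simp: filterlim_at less_imp_neq[symmetric]\<close>)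
    show "AE y in lborel. norm (p y * ?q n y) \<le> norm (p y) * K" for n
      unfolding norm_mult
      by (intro AE_I2 mult_left_mono difference_quotient_bound[OF schwartz_has_derivative[OF F] h(1)] K) auto
  qed measurable
qed

text \<open>Both sides arise by differentiating one function in the same direction: the left-hand side by
  differentiating \<open>k\<close>, the right-hand side by differentiating \<open>p\<close>.  Moving one derivative at a time
  from \<open>k\<close> to \<open>p\<close> would instead reverse the order of the derivatives and require their symmetry.\<close>

lemma convolution_iter_deriv:
  fixes p k :: "'a::euclidean_space \<Rightarrow> complex"
  assumes p: "p \<in> schwartz" and k: "k \<in> schwartz" and bs: "bs \<in> lists Basis"
  shows "(LINT y|lborel. p y * iter_deriv bs k (x - y)) = (LINT u|lborel. k u * iter_deriv bs p (x - u))"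
  using bs
proof (induction bs arbitrary: x)
  case Nil
  have [measurable]: "p \<in> borel_measurable borel" "k \<in> borel_measurable borel" using p k by auto
  show ?case
    using lborel_integral_affine(2)[of "-1" "\<lambda>y. p y * k (x - y)" x] by (simp add: mult.commute)
next
  case (Cons b bs)
  then have b: "b \<in> Basis" and bs: "bs \<in> lists Basis" by auto
  define h where "h = (\<lambda>n. 1 / (real (Suc n)))"
  have h: "\<And>n. 0 < h n" "h \<longlonglongrightarrow> 0" unfolding h_def by (auto, real_asymp)
  note IH = Cons.IH
  show ?case
    using LIMSEQ_unique[OF convolution_difference_quotient[OF p iter_deriv_schwartz[OF k bs] b h, of x]
      convolution_difference_quotient[OF k iter_deriv_schwartz[OF p bs] b h, of x, folded IH]]
    by simp
qed

lemma uniform_constant: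
  fixes P :: "'i \<Rightarrow> real \<Rightarrow> bool"
  assumes I: "finite I" and ex: "\<And>i. i \<in> I \<Longrightarrow> \<exists>C\<ge>0. P i C"
    and mono: "\<And>i C D. P i C \<Longrightarrow> C \<le> D \<Longrightarrow> P i D"
  obtains C where "0 \<le> C" "\<And>i. i \<in> I \<Longrightarrow> P i C"
proof -
  obtain C where C: "\<And>i. i \<in> I \<Longrightarrow> 0 \<le> C i \<and> P i (C i)" using ex by metis
  have "C i \<le> (\<Sum>i\<in>I. C i)" if "i \<in> I" for i
    by (rule member_le_sum[OF that]) (use C I in auto)
  then have "P i (\<Sum>i\<in>I. C i)" if "i \<in> I" for i using C mono that by blast
  then show ?thesis using C by (intro that[of "\<Sum>i\<in>I. C i"] sum_nonneg) auto
qed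

text \<open>The convolution of \<open>\<phi>\<close> and \<open>k\<close> is approximated in a Schwartz norm by finite combinations of translates of
  \<open>k\<close>.  Instead of a partition into cubes, let \<open>s\<close> be a measurable function with finitely many values
  close to the identity, and replace \<open>k (x - y)\<close> by \<open>k (x - s y)\<close> under the integral.\<close>

lemma convolution_riemann_sum:
  fixes \<phi> k :: "'a::euclidean_space \<Rightarrow> complex"
  assumes \<phi>: "\<phi> \<in> schwartz" and k: "k \<in> schwartz" and \<eta>: "0 < \<eta>"
  obtains V c where "finite V"
    "\<And>bs x. bs \<in> lists Basis \<Longrightarrow> length bs \<le> N \<Longrightarrow> (1 + norm x) ^ N *
      norm ((LINT y|lborel. \<phi> y * iter_deriv bs k (x - y)) - (\<Sum>v\<in>V. c v * iter_deriv bs k (x - v))) \<le> \<eta>"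
proof -
  have [measurable]: "\<phi> \<in> borel_measurable borel" using \<phi> by auto
  let ?I = "{bs. bs \<in> lists (Basis::'a set) \<and> length bs \<le> N}"
  let ?P = "\<lambda>bs C. \<forall>x y z. (1 + norm x) ^ N * norm (iter_deriv bs k (x - y) - iter_deriv bs k (x - z))
      \<le> C * ((1 + norm y + norm z) ^ N * norm (y - z))"
  obtain C where C0: "0 \<le> C" and C: "\<And>bs. bs \<in> ?I \<Longrightarrow> ?P bs C"
  proof (rule uniform_constant[of ?I ?P, OF _ _ _ that])
    show "finite ?I" by (rule finite_multi_indices)
    show "\<exists>C\<ge>0. ?P bs C" if "bs \<in> ?I" for bs
    proof -
      have "iter_deriv bs k \<in> schwartz" using that by (intro iter_deriv_schwartz k) auto
      from schwartz_lipschitz[OF this, of N] obtain C where "0 \<le> C" "?P bs C" by blast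
      then show ?thesis by blast
    qed
    show "?P bs D" if "?P bs C" "C \<le> D" for bs C D
    proof (intro allI)
      fix x y z :: 'a
      have "C * ((1 + norm y + norm z) ^ N * norm (y - z)) \<le> D * ((1 + norm y + norm z) ^ N * norm (y - z))"
        using that(2) by (intro mult_right_mono) auto
      with that(1)[rule_format, of x y z]
      show "(1 + norm x) ^ N * norm (iter_deriv bs k (x - y) - iter_deriv bs k (x - z))
          \<le> D * ((1 + norm y + norm z) ^ N * norm (y - z))"
        by (rule order.trans)
    qed
  qed
  obtain s :: "nat \<Rightarrow> 'a \<Rightarrow> 'a" where s: "\<And>i. simple_function borel (s i)" "\<And>y. (\<lambda>i. s i y) \<longlonglongrightarrow> y"
     "\<And>i y. norm (s i y) \<le> 2 * norm y"
    using borel_measurable_implies_sequence_metric[of "\<lambda>y::'a. y" borel 0] by auto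
  have [measurable]: "s i \<in> borel_measurable borel" for i
    using s(1) by (rule borel_measurable_simple_function)
  define G where "G = (\<lambda>i y. norm (\<phi> y) * ((1 + norm y + norm (s i y)) ^ N * norm (y - s i y)))"
  define w where "w = (\<lambda>y. 3 ^ (N + 1) * ((1 + norm y) ^ (N + 1) * norm (\<phi> y)))"
  have w: "integrable lborel w"
    unfolding w_def by (intro integrable_mult_right schwartz_weighted_integrable \<phi>)
  have Gw: "norm (G i y) \<le> w y" for i y
  proof -
    have "(1 + norm y + norm (s i y)) ^ N \<le> (3 * (1 + norm y)) ^ N"
      using s(3)[of i y] by (intro power_mono) auto
    moreover have "norm (y - s i y) \<le> 3 * (1 + norm y)"
      using s(3)[of i y] norm_triangle_ineq4[of y "s i y"] by (simp add: distrib_left)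
    ultimately have "(1 + norm y + norm (s i y)) ^ N * norm (y - s i y) \<le> (3 * (1 + norm y)) ^ N * (3 * (1 + norm y))"
      by (intro mult_mono) auto
    also have "\<dots> = 3 ^ (N + 1) * (1 + norm y) ^ (N + 1)"
      by (simp only: power_mult_distrib power_add power_one_right mult_ac)
    finally have "norm (\<phi> y) * ((1 + norm y + norm (s i y)) ^ N * norm (y - s i y))
       \<le> norm (\<phi> y) * (3 ^ (N + 1) * (1 + norm y) ^ (N + 1))"
      by (intro mult_left_mono) auto
    then show ?thesis by (simp add: G_def w_def mult_ac abs_mult)
  qed
  have Gi: "integrable lborel (G i)" for i
  proof (rule Bochner_Integration.integrable_bound[OF w])
    show "G i \<in> borel_measurable lborel" unfolding G_def by measurable
    show "AE y in lborel. norm (G i y) \<le> norm (w y)"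
      by (rule AE_I2, rule order.trans[OF Gw]) simp
  qed
  have "(\<lambda>i. integral\<^sup>L lborel (G i)) \<longlonglongrightarrow> (LINT y|lborel. norm (\<phi> y) * ((1 + norm y + norm y) ^ N * norm (y - y)))"
  proof (rule integral_dominated_convergence[OF _ _ w])
    show "AE y in lborel. (\<lambda>i. G i y) \<longlonglongrightarrow> norm (\<phi> y) * ((1 + norm y + norm y) ^ N * norm (y - y))"
      unfolding G_def by (intro AE_I2 tendsto_intros s(2))
    show "G i \<in> borel_measurable lborel" for i using Gi by auto
    show "AE y in lborel. norm (G i y) \<le> w y" for i using Gw by auto
  qed measurable
  then have "(\<lambda>i. C * integral\<^sup>L lborel (G i)) \<longlonglongrightarrow> C * 0"
    by (intro tendsto_mult tendsto_const) simp
  then have "\<forall>\<^sub>F i in sequentially. C * integral\<^sup>L lborel (G i) < \<eta>"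
    using \<eta> by (intro order_tendstoD) auto
  then obtain i where i: "C * integral\<^sup>L lborel (G i) < \<eta>"
    by (auto simp: eventually_sequentially)
  define V where "V = range (s i)"
  define c where "c = (\<lambda>v. LINT y|lborel. indicator (s i -` {v}) y *\<^sub>R \<phi> y)"
  have V: "finite V" unfolding V_def using s(1)[of i] by (auto simp: simple_function_def)
  show ?thesis
  proof (rule that[of V c])
    show "finite V" by (rule V)
    fix bs :: "'a list" and x :: 'a assume bs: "bs \<in> lists Basis" "length bs \<le> N"
    let ?F = "iter_deriv bs k"
    have F: "?F \<in> schwartz" by (rule iter_deriv_schwartz[OF k bs(1)])
    have p: "0 < (1 + norm x) ^ N" by (simp add: add_pos_nonneg)
    have int: "integrable lborel (\<lambda>y. \<phi> y * ?F (x - y))" "integrable lborel (\<lambda>y. \<phi> y * ?F (x - s i y))"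
      by (rule schwartz_convolution_integrable[OF \<phi> F]; measurable)+
    have ind: "integrable lborel (\<lambda>y. indicator (s i -` {v}) y *\<^sub>R \<phi> y)" for v
    proof (rule integrable_mult_indicator[OF _ schwartz_integrable[OF \<phi>]])
      have "s i -` {v} \<inter> space borel \<in> sets borel" by measurable
      then show "s i -` {v} \<in> sets lborel" by simp
    qed
    have "(\<Sum>v\<in>V. c v * ?F (x - v)) = (LINT y|lborel. (\<Sum>v\<in>V. (indicator (s i -` {v}) y *\<^sub>R \<phi> y) * ?F (x - v)))"
    proof -
      have "integrable lborel (\<lambda>y. (indicator (s i -` {v}) y *\<^sub>R \<phi> y) * ?F (x - v))" for v
        by (rule integrable_mult_left[OF ind])
      from Bochner_Integration.integral_sum[of V, OF this] show ?thesis
        unfolding c_def by (simp only: integral_mult_left_zero)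
    qed
    also have "\<dots> = (LINT y|lborel. \<phi> y * ?F (x - s i y))"
    proof (rule Bochner_Integration.integral_cong)
      fix y
      have "(\<Sum>v\<in>V. (indicator (s i -` {v}) y *\<^sub>R \<phi> y) * ?F (x - v))
          = (\<Sum>v\<in>V. if s i y = v then \<phi> y * ?F (x - v) else 0)"
        by (intro sum.cong) (auto simp: indicator_def)
      also have "\<dots> = \<phi> y * ?F (x - s i y)"
        using V by (simp add: V_def)
      finally show "(\<Sum>v\<in>V. (indicator (s i -` {v}) y *\<^sub>R \<phi> y) * ?F (x - v)) = \<phi> y * ?F (x - s i y)" .
    qed simp
    finally have "(LINT y|lborel. \<phi> y * ?F (x - y)) - (\<Sum>v\<in>V. c v * ?F (x - v))
        = (LINT y|lborel. \<phi> y * (?F (x - y) - ?F (x - s i y)))"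
      using int by (simp add: right_diff_distrib)
    then have "(1 + norm x) ^ N * norm ((LINT y|lborel. \<phi> y * ?F (x - y)) - (\<Sum>v\<in>V. c v * ?F (x - v)))
        \<le> (1 + norm x) ^ N * (LINT y|lborel. norm (\<phi> y * (?F (x - y) - ?F (x - s i y))))"
      using integral_norm_bound by (auto intro!: mult_left_mono)
    also have "\<dots> = (LINT y|lborel. (1 + norm x) ^ N * norm (\<phi> y * (?F (x - y) - ?F (x - s i y))))"
      by simp
    also have "\<dots> \<le> (LINT y|lborel. C * G i y)"
    proof (rule integral_mono)
      show "integrable lborel (\<lambda>y. (1 + norm x) ^ N * norm (\<phi> y * (?F (x - y) - ?F (x - s i y))))"
        using int by (intro integrable_mult_right integrable_norm) (simp add: right_diff_distrib)
      show "integrable lborel (\<lambda>y. C * G i y)" by (intro integrable_mult_right Gi)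
      fix y
      have "(1 + norm x) ^ N * norm (\<phi> y * (?F (x - y) - ?F (x - s i y)))
          = norm (\<phi> y) * ((1 + norm x) ^ N * norm (?F (x - y) - ?F (x - s i y)))"
        by (simp add: norm_mult)
      also have "\<dots> \<le> norm (\<phi> y) * (C * ((1 + norm y + norm (s i y)) ^ N * norm (y - s i y)))"
        using C[of bs] bs by (intro mult_left_mono) (blast, simp)
      also have "\<dots> = C * G i y" by (simp add: G_def)
      finally show "(1 + norm x) ^ N * norm (\<phi> y * (?F (x - y) - ?F (x - s i y))) \<le> C * G i y" .
    qed
    also have "\<dots> \<le> \<eta>" using i by simp
    finally show "(1 + norm x) ^ N * norm ((LINT y|lborel. \<phi> y * ?F (x - y)) - (\<Sum>v\<in>V. c v * ?F (x - v))) \<le> \<eta>" .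
  qed
qed

text \<open>As \<open>\<delta>\<close> tends to zero the functions \<open>u \<mapsto> g (u / \<delta>) / \<delta> ^ n\<close> are an approximate identity, up to the factor
  \<open>\<integral> g\<close>; here they are written after the substitution of \<open>\<delta> *\<^sub>R u\<close> for \<open>u\<close>.\<close>

lemma mollifier_error:
  fixes g F :: "'a::euclidean_space \<Rightarrow> complex"
  assumes g: "g \<in> schwartz" and F: "F \<in> schwartz"
  obtains C where "0 \<le> C" "\<And>\<delta> x. 0 < \<delta> \<Longrightarrow> \<delta> \<le> 1 \<Longrightarrow> (1 + norm x) ^ N *
    norm (F x * integral\<^sup>L lborel g - (LINT u|lborel. g u * F (x - \<delta> *\<^sub>R u))) \<le> C * \<delta>"
proof -
  obtain C where C: "0 \<le> C" "\<And>x y z. (1 + norm x) ^ N * norm (F (x - y) - F (x - z))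
      \<le> C * ((1 + norm y + norm z) ^ N * norm (y - z))"
    using schwartz_lipschitz[OF F, of N] by metis
  define I where "I = (LINT u|lborel. (1 + norm u) ^ (N + 1) * norm (g u))"
  have I0: "0 \<le> I" unfolding I_def by (intro integral_nonneg_AE AE_I2) auto
  have "(1 + norm x) ^ N * norm (F x * integral\<^sup>L lborel g - (LINT u|lborel. g u * F (x - \<delta> *\<^sub>R u))) \<le> (C * I) * \<delta>"
    if \<delta>: "0 < \<delta>" "\<delta> \<le> 1" for \<delta> x
  proof -
    have int: "integrable lborel (\<lambda>u. g u * F x)" "integrable lborel (\<lambda>u. g u * F (x - \<delta> *\<^sub>R u))"
      by (rule schwartz_convolution_integrable[OF g F]; measurable)+
    have "F x * integral\<^sup>L lborel g - (LINT u|lborel. g u * F (x - \<delta> *\<^sub>R u)) = (LINT u|lborel. g u * (F x - F (x - \<delta> *\<^sub>R u)))"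
      using int by (simp add: right_diff_distrib mult.commute)
    then have "(1 + norm x) ^ N * norm (F x * integral\<^sup>L lborel g - (LINT u|lborel. g u * F (x - \<delta> *\<^sub>R u)))
       \<le> (1 + norm x) ^ N * (LINT u|lborel. norm (g u * (F x - F (x - \<delta> *\<^sub>R u))))"
      using integral_norm_bound by (auto intro!: mult_left_mono)
    also have "\<dots> = (LINT u|lborel. (1 + norm x) ^ N * norm (g u * (F x - F (x - \<delta> *\<^sub>R u))))" by simp
    also have "\<dots> \<le> (LINT u|lborel. (C * \<delta>) * ((1 + norm u) ^ (N + 1) * norm (g u)))"
    proof (rule integral_mono)
      show "integrable lborel (\<lambda>u. (1 + norm x) ^ N * norm (g u * (F x - F (x - \<delta> *\<^sub>R u))))"
        using int by (intro integrable_mult_right integrable_norm) (simp add: right_diff_distrib)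
      show "integrable lborel (\<lambda>u. (C * \<delta>) * ((1 + norm u) ^ (N + 1) * norm (g u)))"
        by (intro integrable_mult_right schwartz_weighted_integrable g)
      fix u
      have "(1 + norm x) ^ N * norm (F (x - 0) - F (x - \<delta> *\<^sub>R u))
         \<le> C * ((1 + norm (0::'a) + norm (\<delta> *\<^sub>R u)) ^ N * norm (0 - \<delta> *\<^sub>R u))" by (rule C)
      also have "\<dots> \<le> C * ((1 + norm u) ^ N * (\<delta> * (1 + norm u)))"
        using \<delta> C by (intro mult_left_mono mult_mono power_mono) (auto simp: mult_left_le_one_le)
      finally have "(1 + norm x) ^ N * norm (F x - F (x - \<delta> *\<^sub>R u)) \<le> C * \<delta> * (1 + norm u) ^ (N + 1)"
        by (simp add: mult_ac)
      then have "norm (g u) * ((1 + norm x) ^ N * norm (F x - F (x - \<delta> *\<^sub>R u))) \<le> norm (g u) * (C * \<delta> * (1 + norm u) ^ (N + 1))"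
        by (intro mult_left_mono) auto
      then show "(1 + norm x) ^ N * norm (g u * (F x - F (x - \<delta> *\<^sub>R u))) \<le> (C * \<delta>) * ((1 + norm u) ^ (N + 1) * norm (g u))"
        by (simp add: norm_mult mult_ac)
    qed
    also have "\<dots> = (C * I) * \<delta>" unfolding I_def by simp
    finally show ?thesis .
  qed
  with that[of "C * I"] C I0 show ?thesis by simp
qed

lemma tempered_lincomb_vanishing:
  assumes W: "tempered W" and V: "finite V" and f: "f \<in> schwartz"
    and g: "\<And>v. v \<in> V \<Longrightarrow> g v \<in> schwartz" "\<And>v. v \<in> V \<Longrightarrow> W (g v) = 0"
  shows "W (\<lambda>x. f x + (\<Sum>v\<in>V. c v * g v x)) = W f"
  using V g
proof (induction V)
  case (insert v V)
  let ?h = "\<lambda>x. f x + (\<Sum>v\<in>V. c v * g v x)"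
  have h: "?h \<in> schwartz" using schwartz_lincomb[of V f g c] insert f by auto
  have gv: "g v \<in> schwartz" "W (g v) = 0" using insert by auto
  have cg: "(\<lambda>x. c v * g v x) \<in> schwartz"
    using schwartz_add_scale[OF schwartz_zero gv(1), of "c v"] by simp
  have "W (\<lambda>x. f x + (\<Sum>v\<in>insert v V. c v * g v x)) = W (\<lambda>x. ?h x + c v * g v x)"
    using insert.hyps by (simp add: algebra_simps)
  also have "\<dots> = W ?h + W (\<lambda>x. c v * g v x)"
    using W h cg by (simp add: tempered_def)
  also have "W (\<lambda>x. c v * g v x) = 0" using W gv by (simp add: tempered_def)
  finally show ?case using insert by simp
qed simp

text \<open>For each \<open>\<delta>\<close> the function \<open>\<phi>\<close> differs by \<open>O(\<delta>)\<close>, in the norm that controls \<open>W\<close>, from a finite combination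
  of translates of \<open>g (x / \<delta>)\<close>, on which \<open>W\<close> is zero.\<close>

theorem tempered_vanishing_on_dilates:
  fixes W :: "('a::euclidean_space \<Rightarrow> complex) \<Rightarrow> complex"
  assumes W: "tempered W" and g: "g \<in> schwartz" and Z: "integral\<^sup>L lborel g \<noteq> 0"
    and vanish: "\<And>s v. 0 < s \<Longrightarrow> W (\<lambda>x. g (s *\<^sub>R (x - v))) = 0"
    and \<phi>: "\<phi> \<in> schwartz"
  shows "W \<phi> = 0"
proof -
  obtain N K where K: "\<And>f. f \<in> schwartz \<Longrightarrow> norm (W f) \<le> K * schwartz_norm N f"
    using W unfolding tempered_def by blast
  let ?I = "{bs. bs \<in> lists (Basis::'a set) \<and> length bs \<le> N}"
  let ?Z = "integral\<^sup>L lborel g"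
  let ?P = "\<lambda>bs C. \<forall>\<delta> x. 0 < \<delta> \<longrightarrow> \<delta> \<le> 1 \<longrightarrow> (1 + norm x) ^ N *
      norm (iter_deriv bs \<phi> x * ?Z - (LINT u|lborel. g u * iter_deriv bs \<phi> (x - \<delta> *\<^sub>R u))) \<le> C * \<delta>"
  obtain C where C0: "0 \<le> C" and C: "\<And>bs. bs \<in> ?I \<Longrightarrow> ?P bs C"
  proof (rule uniform_constant[of ?I ?P, OF _ _ _ that])
    show "finite ?I" by (rule finite_multi_indices)
    show "\<exists>C\<ge>0. ?P bs C" if "bs \<in> ?I" for bs
    proof -
      have "iter_deriv bs \<phi> \<in> schwartz" using that by (intro iter_deriv_schwartz \<phi>) auto
      from mollifier_error[OF g this, of N] obtain C where "0 \<le> C" "?P bs C" by blast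
      then show ?thesis by blast
    qed
    show "?P bs D" if "?P bs C" "C \<le> D" for bs C D
    proof (intro allI impI)
      fix \<delta> :: real and x :: 'a assume \<delta>: "0 < \<delta>" "\<delta> \<le> 1"
      have "C * \<delta> \<le> D * \<delta>" using that(2) \<delta> by (intro mult_right_mono) auto
      with that(1)[rule_format, OF \<delta>, of x]
      show "(1 + norm x) ^ N *
        norm (iter_deriv bs \<phi> x * ?Z - (LINT u|lborel. g u * iter_deriv bs \<phi> (x - \<delta> *\<^sub>R u))) \<le> D * \<delta>"
        by (rule order.trans)
    qed
  qed
  define L where "L = \<bar>K\<bar> * (real (card ?I) * ((C + 1) / norm ?Z))"
  have main: "norm (W \<phi>) \<le> L * \<delta>" if \<delta>: "0 < \<delta>" "\<delta> \<le> 1" for \<delta>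
  proof -
    define k where "k = (\<lambda>v x. g ((1 / \<delta>) *\<^sub>R (x - v)))"
    have k: "k v \<in> schwartz" for v
      unfolding k_def using \<delta> by (intro schwartz_dilation g) auto
    have Wk: "W (k v) = 0" for v
      unfolding k_def using \<delta> by (intro vanish) auto
    have kv: "iter_deriv bs (k v) x = iter_deriv bs (k 0) (x - v)" if "bs \<in> lists Basis" for bs v x
      unfolding k_def iter_deriv_dilation[OF g that] by simp
    \<comment> \<open>the Jacobian of the substitution \<open>u = \<delta> *\<^sub>R u'\<close>, by which the convolution with \<open>k 0\<close> has to be divided\<close>
    define d where "d = \<delta> ^ DIM('a)"
    have d: "0 < d" using \<delta> by (simp add: d_def)
    obtain V c where V: "finite V" and err: "\<And>bs x. bs \<in> lists Basis \<Longrightarrow> length bs \<le> N \<Longrightarrow> (1 + norm x) ^ N *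
      norm ((LINT y|lborel. \<phi> y * iter_deriv bs (k 0) (x - y)) - (\<Sum>v\<in>V. c v * iter_deriv bs (k 0) (x - v))) \<le> d * \<delta>"
      using convolution_riemann_sum[OF \<phi> k[of 0] mult_pos_pos[OF d \<delta>(1)], of N] by blast
    define c' where "c' = (\<lambda>v. - c v / (?Z * of_real d))"
    define f where "f = (\<lambda>x. \<phi> x + (\<Sum>v\<in>V. c' v * k v x))"
    note lc = schwartz_lincomb[OF V \<phi>, of k c', OF k, folded f_def]
    have Wf: "W f = W \<phi>"
      using tempered_lincomb_vanishing[OF W V \<phi>, of k c'] k Wk by (simp add: f_def)
    have "(1 + norm x) ^ N * norm (iter_deriv bs f x) \<le> ((C + 1) / norm ?Z) * \<delta>"
      if bs: "bs \<in> lists Basis" "length bs \<le> N" for bs x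
    proof -
      define A where "A = iter_deriv bs \<phi> x * ?Z - (LINT u|lborel. g u * iter_deriv bs \<phi> (x - \<delta> *\<^sub>R u))"
      define B where "B = (LINT y|lborel. \<phi> y * iter_deriv bs (k 0) (x - y)) - (\<Sum>v\<in>V. c v * iter_deriv bs (k 0) (x - v))"
      have [measurable]: "g \<in> borel_measurable borel" "iter_deriv bs \<phi> \<in> borel_measurable borel"
        using g iter_deriv_schwartz[OF \<phi> bs(1)] by auto
      have "(LINT y|lborel. \<phi> y * iter_deriv bs (k 0) (x - y)) = (LINT u|lborel. k 0 u * iter_deriv bs \<phi> (x - u))"
        by (rule convolution_iter_deriv[OF \<phi> k bs(1)])
      also have "\<dots> = of_real d * (LINT u|lborel. g u * iter_deriv bs \<phi> (x - \<delta> *\<^sub>R u))"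
        using \<delta> unfolding k_def d_def
        by (subst lborel_integral_affine(2)[of \<delta> _ 0]) (auto simp: scaleR_conv_of_real)
      finally have conv: "(LINT y|lborel. \<phi> y * iter_deriv bs (k 0) (x - y))
          = of_real d * (LINT u|lborel. g u * iter_deriv bs \<phi> (x - \<delta> *\<^sub>R u))" .
      have "iter_deriv bs f x = iter_deriv bs \<phi> x - (\<Sum>v\<in>V. c v * iter_deriv bs (k 0) (x - v)) / (?Z * of_real d)"
      proof -
        have "iter_deriv bs f x = iter_deriv bs \<phi> x + (\<Sum>v\<in>V. c' v * iter_deriv bs (k v) x)"
          using bspec[OF conjunct2[OF lc] bs(1)] by (simp only:)
        also have "(\<Sum>v\<in>V. c' v * iter_deriv bs (k v) x) = (\<Sum>v\<in>V. c' v * iter_deriv bs (k 0) (x - v))"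
          by (rule sum.cong[OF refl], subst kv[OF bs(1)], rule refl)
        finally show ?thesis by (simp add: c'_def sum_divide_distrib sum_negf)
      qed
      also have "\<dots> = (of_real d * A + B) / (?Z * of_real d)"
      proof -
        have "a - r / (z * e) = (e * (a * z - j) + (e * j - r)) / (z * e)"
          if "z \<noteq> 0" "e \<noteq> 0" for a r z e j :: complex
        proof -
          have "e * (a * z - j) + (e * j - r) = a * (z * e) - r" by (simp add: algebra_simps)
          then have "(e * (a * z - j) + (e * j - r)) / (z * e) = (a * (z * e) - r) / (z * e)" by (simp only:)
          also have "\<dots> = a - r / (z * e)" using that by (simp add: diff_divide_distrib)
          finally show ?thesis by simp
        qed
        moreover have "of_real d \<noteq> (0::complex)" using d by simp
        ultimately show ?thesis unfolding A_def B_def conv using Z by blast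
      qed
      finally have "(1 + norm x) ^ N * norm (iter_deriv bs f x)
          = (1 + norm x) ^ N * norm (of_real d * A + B) / (norm ?Z * d)"
        using d by (simp add: norm_divide norm_mult)
      also have "\<dots> \<le> (1 + norm x) ^ N * (d * norm A + norm B) / (norm ?Z * d)"
        using d Z by (intro divide_right_mono mult_left_mono norm_triangle_le) (auto simp: norm_mult)
      also have "\<dots> = (d * ((1 + norm x) ^ N * norm A) + (1 + norm x) ^ N * norm B) / (norm ?Z * d)"
        by (simp add: algebra_simps)
      also have "\<dots> \<le> (d * (C * \<delta>) + d * \<delta>) / (norm ?Z * d)"
      proof (intro divide_right_mono add_mono mult_left_mono)
        show "(1 + norm x) ^ N * norm A \<le> C * \<delta>"
          unfolding A_def using C[of bs] bs \<delta> by blast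
        show "(1 + norm x) ^ N * norm B \<le> d * \<delta>" unfolding B_def by (rule err[OF bs])
      qed (use d in auto)
      also have "\<dots> = ((C + 1) / norm ?Z) * \<delta>"
        using d Z by (simp add: field_simps)
      finally show ?thesis .
    qed
    then have sn: "schwartz_norm N f \<le> real (card ?I) * (((C + 1) / norm ?Z) * \<delta>)"
      by (rule schwartz_norm_least)
    have "norm (W \<phi>) = norm (W f)" by (simp add: Wf)
    also have "\<dots> \<le> K * schwartz_norm N f" using lc by (intro K) auto
    also have "\<dots> \<le> \<bar>K\<bar> * schwartz_norm N f"
      using lc by (intro mult_right_mono schwartz_norm_nonneg) auto
    also have "\<dots> \<le> \<bar>K\<bar> * (real (card ?I) * (((C + 1) / norm ?Z) * \<delta>))"
      by (intro mult_left_mono sn) auto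
    also have "\<dots> = L * \<delta>" by (simp add: L_def)
    finally show ?thesis .
  qed
  have "norm (W \<phi>) \<le> 0"
  proof (rule LIMSEQ_le_const)
    have "(\<lambda>n. L * (1 / real (Suc n))) \<longlonglongrightarrow> L * 0"
      by (intro tendsto_mult tendsto_const) real_asymp
    then show "(\<lambda>n. L * (1 / real (Suc n))) \<longlonglongrightarrow> 0" by simp
    show "\<exists>N. \<forall>n\<ge>N. norm (W \<phi>) \<le> L * (1 / real (Suc n))"
      by (intro exI[of _ 0] allI impI main) auto
  qed
  then show ?thesis by simp
qed

section \<open>Fractional cone splines\<close>

definition coords :: "('n \<Rightarrow> real^'n) \<Rightarrow> real^'n \<Rightarrow> real^'n::finite" where
  "coords Y x = (\<chi> k. x \<bullet> Y k)"

lemma linear_coords: "linear (coords Y)"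
  by (rule linearI) (auto simp: coords_def vec_eq_iff inner_add_left)

lemma det_coords: "det (matrix (coords Y)) = det (\<chi> i k. Y k $ i)"
proof -
  have "matrix (coords Y) = transpose (\<chi> i k. Y k $ i)"
    by (simp add: vec_eq_iff matrix_def transpose_def coords_def inner_axis')
  then show ?thesis by (simp add: det_transpose)
qed

locale dual_bases =
  fixes X Xd :: "'n::finite \<Rightarrow> real^'n"
  assumes dual: "X j \<bullet> Xd k = (if j = k then 1 else 0)"
begin

definition combine :: "real^'n \<Rightarrow> real^'n" where
  "combine y = (\<Sum>k\<in>UNIV. y $ k *\<^sub>R X k)"

lemma coords_combine: "coords Xd (combine y) = y"
  by (simp add: coords_def combine_def vec_eq_iff inner_sum_left dual if_distrib cong: if_cong)

lemma linear_combine: "linear combine"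
  by (rule linearI) (auto simp: combine_def algebra_simps sum.distrib scaleR_sum_right)

lemma combine_coords: "combine (coords Xd x) = x"
proof -
  have "inj combine" by (metis coords_combine injI)
  then have "surj combine" using linear_combine linear_injective_imp_surjective by blast
  then show ?thesis by (metis coords_combine surjD)
qed

text \<open>Thus \<open>combine\<close>, the inverse of \<open>coords Xd\<close>, is the transpose of \<open>coords X\<close>.\<close>

lemma inner_combine: "combine y \<bullet> \<omega> = y \<bullet> coords X \<omega>"
proof -
  have "combine y \<bullet> \<omega> = (\<Sum>k\<in>UNIV. y $ k * (X k \<bullet> \<omega>))"
    by (simp add: combine_def inner_sum_left)
  also have "\<dots> = y \<bullet> coords X \<omega>"
    by (simp add: inner_vec_def[of y] coords_def inner_commute)
  finally show ?thesis .
qed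

lemma det_coords_mult: "det (matrix (coords X)) * det (matrix (coords Xd)) = 1"
proof -
  have "(\<chi> i k. X k $ i) = matrix combine"
    by (simp add: vec_eq_iff matrix_def combine_def axis_def if_distrib if_distribR cong: if_cong)
  moreover have "matrix (coords Xd) ** matrix combine = mat 1"
    using matrix_compose[OF linear_combine linear_coords[of Xd]]
    by (metis coords_combine comp_apply eq_id_iff matrix_id_mat_1)
  ultimately show ?thesis by (metis det_I det_coords det_mul mult.commute)
qed

lemma det_nonzero: "det (matrix (coords X)) \<noteq> 0" "det (matrix (coords Xd)) \<noteq> 0"
  using det_coords_mult by auto

lemma inj_coords: "inj (coords X)"
  using det_nz_iff_inj[OF linear_coords[of X]] det_nonzero by auto

lemma inv_coords: "inv (coords X) (coords X \<omega>) = \<omega>"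
  by (rule inv_f_f[OF inj_coords])

lemma coords_inv: "coords X (inv (coords X) u) = u"
  by (rule surj_f_inv_f, rule linear_injective_imp_surjective) (auto intro: linear_coords inj_coords)

abbreviation detX :: real where "detX \<equiv> \<bar>det (matrix (coords X))\<bar>"

text \<open>Substitute \<open>u = coords X \<omega>\<close> and write the phase \<open>x \<bullet> \<omega>\<close> as \<open>coords Xd x \<bullet> coords X \<omega>\<close>.\<close>

lemma fourier_coords:
  assumes [measurable]: "\<phi> \<in> borel_measurable borel"
  shows "fourier \<phi> x = fourier (\<lambda>u. \<phi> (inv (coords X) u)) (coords Xd x) / of_real detX"
proof -
  have lin: "linear (inv (coords X))"
    by (rule inj_linear_imp_inv_linear[OF linear_coords inj_coords])
  note [measurable] = linear_borel_measurable[OF lin]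
  have "fourier (\<lambda>u. \<phi> (inv (coords X) u)) (coords Xd x)
      = detX *\<^sub>R (LINT \<omega>|lborel. \<phi> (inv (coords X) (coords X \<omega>)) * exp (- \<i> * of_real (coords Xd x \<bullet> coords X \<omega>)))"
    unfolding fourier_def by (rule lborel_integral_linear[OF linear_coords det_nonzero(1)]) measurable
  also have "\<dots> = detX *\<^sub>R fourier \<phi> x"
    by (simp add: inv_coords fourier_def inner_combine[symmetric] combine_coords)
  finally show ?thesis using det_nonzero by (simp add: scaleR_conv_of_real)
qed

definition cone_density :: "('n \<Rightarrow> real) \<Rightarrow> real^'n \<Rightarrow> real" where
  "cone_density \<alpha> x = orthant_density \<alpha> (coords Xd x) / detX"

lemma cone_density_measurable [measurable]: "cone_density \<alpha> \<in> borel_measurable borel"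
proof -
  note [measurable] = linear_borel_measurable[OF linear_coords[of Xd]]
  show ?thesis unfolding cone_density_def[abs_def] by measurable
qed

text \<open>The substitution \<open>y = coords Xd x\<close> contributes \<open>1 / detX\<close>, and rewriting the integrand by
  \<open>fourier_coords\<close> and the definition of the density contributes \<open>detX * detX\<close>.  What remains is the
  Jacobian in the definition of the pullback.\<close>

lemma cone_density_fourier:
  assumes [measurable]: "\<phi> \<in> borel_measurable borel"
  shows "dist_of_fun (cone_density \<alpha>) (fourier \<phi>)
    = dist_pullback (coords X) (dist_fourier (dist_of_fun (orthant_density \<alpha>))) \<phi>"
proof -
  let ?\<psi> = "\<lambda>u. \<phi> (inv (coords X) u)"
  have lin: "linear (inv (coords X))"
    by (rule inj_linear_imp_inv_linear[OF linear_coords inj_coords])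
  note [measurable] = linear_borel_measurable[OF lin]
  have [measurable]: "fourier ?\<psi> \<in> borel_measurable borel" by (rule fourier_measurable) measurable
  have 1: "detX * \<bar>det (matrix (coords Xd))\<bar> = 1"
    using det_coords_mult by (metis abs_mult abs_one)
  have "dist_of_fun (orthant_density \<alpha>) (fourier ?\<psi>)
     = \<bar>det (matrix (coords Xd))\<bar> *\<^sub>R (LINT x|lborel. of_real (orthant_density \<alpha> (coords Xd x)) * fourier ?\<psi> (coords Xd x))"
    unfolding dist_of_fun_def by (rule lborel_integral_linear[OF linear_coords det_nonzero(2)]) measurable
  also have "\<dots> = \<bar>det (matrix (coords Xd))\<bar> *\<^sub>R (LINT x|lborel. of_real (detX * detX) * (of_real (cone_density \<alpha> x) * fourier \<phi> x))"
  proof (intro arg_cong[where f = "(*\<^sub>R) _"] Bochner_Integration.integral_cong refl)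
    fix x
    have scale: "of_real g * F = of_real (d * d) * (of_real (g / d) * (F / of_real d))"
      if "d \<noteq> 0" for g d :: real and F :: complex
      using that by simp
    show "of_real (orthant_density \<alpha> (coords Xd x)) * fourier ?\<psi> (coords Xd x)
        = of_real (detX * detX) * (of_real (cone_density \<alpha> x) * fourier \<phi> x)"
      unfolding fourier_coords[OF assms] cone_density_def
      by (rule scale) (use det_nonzero in simp)
  qed
  also have "\<dots> = of_real (\<bar>det (matrix (coords Xd))\<bar> * (detX * detX)) * dist_of_fun (cone_density \<alpha>) (fourier \<phi>)"
    by (simp add: dist_of_fun_def scaleR_conv_of_real del: of_real_mult) (simp add: mult_ac)
  also have "\<bar>det (matrix (coords Xd))\<bar> * (detX * detX) = detX"
  proof -
    have "\<bar>det (matrix (coords Xd))\<bar> * (detX * detX) = (detX * \<bar>det (matrix (coords Xd))\<bar>) * detX"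
      by (simp only: mult_ac)
    then show ?thesis by (simp only: 1 mult_1)
  qed
  finally show ?thesis
    using det_nonzero by (simp add: dist_pullback_def dist_fourier_def)
qed

lemma cone_density_moderate:
  assumes \<alpha>: "\<And>k. 0 < \<alpha> k"
  obtains N where "integrable lborel (\<lambda>x. cone_density \<alpha> x / (1 + norm x) ^ N)"
proof -
  obtain N where N: "integrable lborel (\<lambda>y. orthant_density \<alpha> y / (1 + norm y) ^ N)"
    by (rule orthant_density_moderate[OF \<alpha>])
  have "integrable lborel (\<lambda>x. orthant_density \<alpha> (coords Xd x) / (1 + norm (coords Xd x)) ^ N)"
    by (rule lborel_integral_linear(2)[OF linear_coords det_nonzero(2) _ N]) measurable
  note i = integrable_mult_right[OF this]
  obtain B where B: "0 < B" "\<And>x. norm (coords Xd x) \<le> B * norm x"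
    using linear_bounded_pos[OF linear_coords] by blast
  have "integrable lborel (\<lambda>x. cone_density \<alpha> x / (1 + norm x) ^ N)"
  proof (rule Bochner_Integration.integrable_bound[OF i[of "(1 + B) ^ N / detX"]])
    have "norm (cone_density \<alpha> x / (1 + norm x) ^ N)
       \<le> norm ((1 + B) ^ N / detX * (orthant_density \<alpha> (coords Xd x) / (1 + norm (coords Xd x)) ^ N))" for x
    proof -
      let ?g = "orthant_density \<alpha> (coords Xd x)"
      have "1 + norm (coords Xd x) \<le> 1 + B * norm x" using B(2)[of x] by simp
      also have "\<dots> \<le> (1 + B) * (1 + norm x)" using B(1) by (simp add: algebra_simps)
      finally have "(1 + norm (coords Xd x)) ^ N \<le> ((1 + B) * (1 + norm x)) ^ N" by (intro power_mono) auto
      then have le: "(1 + norm (coords Xd x)) ^ N \<le> (1 + B) ^ N * (1 + norm x) ^ N" by (simp add: power_mult_distrib)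
      have p: "0 < (1 + norm (coords Xd x)) ^ N" "0 < (1 + norm x) ^ N" by (simp_all add: add_pos_nonneg)
      have "1 / (1 + norm x) ^ N \<le> (1 + B) ^ N / (1 + norm (coords Xd x)) ^ N"
        using le p by (simp add: divide_simps mult.commute)
      from mult_left_mono[OF this, of "\<bar>?g\<bar> / detX"] show ?thesis
        using B(1) by (simp add: cone_density_def abs_mult abs_divide mult_ac)
    qed
    then show "AE x in lborel. norm (cone_density \<alpha> x / (1 + norm x) ^ N)
       \<le> norm ((1 + B) ^ N / detX * (orthant_density \<alpha> (coords Xd x) / (1 + norm (coords Xd x)) ^ N))"
      by (rule AE_I2)
  qed measurable
  then show ?thesis by (rule that)
qed

theorem cone_spline_exists:
  assumes \<alpha>: "\<And>k. 0 < \<alpha> k"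
  shows "is_cone_spline \<alpha> X (dist_of_fun (cone_density \<alpha>))"
  unfolding is_cone_spline_def
proof (intro conjI exI ballI)
  obtain N where N: "integrable lborel (\<lambda>x. cone_density \<alpha> x / (1 + norm x) ^ N)"
    by (rule cone_density_moderate[OF \<alpha>])
  show "tempered (dist_of_fun (cone_density \<alpha>))"
    by (rule moderate_tempered(1)[OF N]) measurable
  show "is_tensor_product (\<lambda>k. cone_factor (\<alpha> k)) (dist_fourier (dist_of_fun (orthant_density \<alpha>)))"
    by (rule orthant_tensor_product[OF \<alpha>])
  fix \<phi> :: "real^'n \<Rightarrow> complex" assume "\<phi> \<in> schwartz"
  then show "dist_fourier (dist_of_fun (cone_density \<alpha>)) \<phi>
      = dist_pullback (\<lambda>\<omega>. \<chi> k. \<omega> \<bullet> X k) (dist_fourier (dist_of_fun (orthant_density \<alpha>))) \<phi>"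
    using cone_density_fourier[of \<phi> \<alpha>] by (auto simp: dist_fourier_def coords_def[abs_def])
qed

definition gauss :: "real^'n \<Rightarrow> complex" where
  "gauss x = exp (- of_real ((norm (coords Xd x))\<^sup>2 / 2))"

lemma norm_coords_square: "(norm (coords Y x))\<^sup>2 = (\<Sum>k\<in>UNIV. (x \<bullet> Y k)\<^sup>2)"
  by (simp only: power2_norm_eq_inner) (simp add: inner_vec_def coords_def power2_eq_square)

lemma coords_bounded_below:
  assumes "det (matrix (coords Y)) \<noteq> 0"
  obtains c where "0 < c" "\<And>x. c * norm x \<le> norm (coords Y x)"
proof -
  have "inj (coords Y)" using det_nz_iff_inj[OF linear_coords[of Y]] assms by auto
  from linear_inj_bounded_below_pos[OF linear_coords this] show ?thesis using that by blast
qed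

lemma gauss_schwartz: "gauss \<in> schwartz"
proof -
  obtain c where c: "0 < c" "\<And>x. c * norm x \<le> norm (coords Xd x)"
    using coords_bounded_below[OF det_nonzero(2)] by blast
  have "polyfun (\<lambda>x. of_real (-1/2) * (\<Sum>k\<in>UNIV. of_real (x \<bullet> Xd k) * of_real (x \<bullet> Xd k)))"
    by (intro polyfun.const polyfun.mult polyfun_sum polyfun.linear) auto
  moreover have "(\<lambda>x. of_real (-1/2) * (\<Sum>k\<in>UNIV. of_real (x \<bullet> Xd k) * of_real (x \<bullet> Xd k)))
      = (\<lambda>x. - complex_of_real ((norm (coords Xd x))\<^sup>2 / 2))"
    by (rule ext, subst norm_coords_square) (simp add: power2_eq_square)
  ultimately have "polyfun (\<lambda>x. - complex_of_real ((norm (coords Xd x))\<^sup>2 / 2))" by simp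
  then show ?thesis
    unfolding gauss_def[abs_def]
  proof (rule exp_polyfun_schwartz[where c = "c\<^sup>2 / 2"])
    show "0 < c\<^sup>2 / 2" using c by simp
    fix x
    have "(c * norm x)\<^sup>2 \<le> (norm (coords Xd x))\<^sup>2" using c by (intro power_mono) auto
    then show "Re (- complex_of_real ((norm (coords Xd x))\<^sup>2 / 2)) \<le> - (c\<^sup>2 / 2) * (norm x)\<^sup>2"
      by (simp add: power_mult_distrib)
  qed
qed

lemma gauss_integral_nonzero: "integral\<^sup>L lborel gauss \<noteq> 0"
proof
  let ?g = "\<lambda>x. exp (- ((norm (coords Xd x))\<^sup>2 / 2))"
  have g: "gauss = (\<lambda>x. of_real (?g x))"
    by (simp add: gauss_def[abs_def] exp_of_real[symmetric])
  assume "integral\<^sup>L lborel gauss = 0"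
  then have 0: "integral\<^sup>L lborel ?g = 0" by (simp add: g)
  have "integrable lborel ?g"
    using schwartz_integrable[OF gauss_schwartz] unfolding g by (simp only: complex_of_real_integrable_eq)
  with 0 have "AE x in lborel. ?g x = 0"
    by (subst (asm) integral_nonneg_eq_0_iff_AE) auto
  then have "AE x::real^'n in lborel. False" by simp
  then have "emeasure lborel (UNIV :: (real^'n) set) = 0" by (simp add: AE_iff_measurable[OF _ refl])
  then show False by simp
qed

text \<open>In the coordinates \<open>coords X \<omega>\<close> a product of wave packets of width \<open>s\<close>; its Fourier transform is a
  product of one-variable Gaussians in \<open>coords Xd x\<close>, centred at \<open>coords Xd w\<close> by the choice of the
  modulation.\<close>

lemma gauss_dilate_as_fourier:
  assumes s: "0 < s"
  obtains v where
    "(\<lambda>\<omega>. \<Prod>k\<in>UNIV. wave_packet (1 / s) (v k) (coords X \<omega> $ k)) \<in> schwartz"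
    "\<And>x. gauss (s *\<^sub>R (x - w)) = of_real (detX / (sqrt (2 * pi) * s) ^ CARD('n)) *
       fourier (\<lambda>\<omega>. \<Prod>k\<in>UNIV. wave_packet (1 / s) (v k) (coords X \<omega> $ k)) x"
proof -
  define v where "v = (\<lambda>k. - coords Xd w $ k)"
  let ?\<phi> = "\<lambda>\<omega>. \<Prod>k\<in>UNIV. wave_packet (1 / s) (v k) (coords X \<omega> $ k)"
  have \<delta>: "0 < 1 / s" using s by simp
  have \<phi>: "?\<phi> \<in> schwartz"
  proof -
    obtain c where c: "0 < c" "\<And>x. c * norm x \<le> norm (coords X x)"
      using coords_bounded_below[OF det_nonzero(1)] by blast
    let ?q = "\<lambda>\<omega>. \<Sum>k\<in>UNIV. of_real (- (1 / s)\<^sup>2 / 2) * (of_real (\<omega> \<bullet> X k) * of_real (\<omega> \<bullet> X k))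
        + (- \<i> * of_real (v k)) * of_real (\<omega> \<bullet> X k)"
    have "polyfun ?q" by (intro polyfun_sum polyfun.intros) auto
    then have "(\<lambda>\<omega>. exp (?q \<omega>)) \<in> schwartz"
    proof (rule exp_polyfun_schwartz[where c = "(1 / s)\<^sup>2 / 2 * c\<^sup>2"])
      show "0 < (1 / s)\<^sup>2 / 2 * c\<^sup>2" using c s by simp
      fix \<omega>
      have "(c * norm \<omega>)\<^sup>2 \<le> (norm (coords X \<omega>))\<^sup>2" using c by (intro power_mono) auto
      from mult_left_mono[OF this, of "(1 / s)\<^sup>2 / 2"]
      have "(1 / s)\<^sup>2 / 2 * c\<^sup>2 * (norm \<omega>)\<^sup>2 \<le> (1 / s)\<^sup>2 / 2 * (\<Sum>k\<in>UNIV. (\<omega> \<bullet> X k)\<^sup>2)"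
        by (simp add: norm_coords_square power_mult_distrib)
      moreover have "Re (?q \<omega>) = - ((1 / s)\<^sup>2 / 2 * (\<Sum>k\<in>UNIV. (\<omega> \<bullet> X k)\<^sup>2))"
        by (simp add: sum_distrib_left power2_eq_square sum_negf)
      ultimately show "Re (?q \<omega>) \<le> - ((1 / s)\<^sup>2 / 2 * c\<^sup>2) * (norm \<omega>)\<^sup>2" by simp
    qed
    moreover have "exp (?q \<omega>) = ?\<phi> \<omega>" for \<omega>
    proof -
      have "?\<phi> \<omega> = exp (\<Sum>k\<in>UNIV. - of_real ((1 / s * (\<omega> \<bullet> X k))\<^sup>2 / 2) - \<i> * of_real (v k * (\<omega> \<bullet> X k)))"
        by (simp add: wave_packet_def coords_def exp_sum)
      also have "(\<Sum>k\<in>UNIV. - of_real ((1 / s * (\<omega> \<bullet> X k))\<^sup>2 / 2) - \<i> * of_real (v k * (\<omega> \<bullet> X k))) = ?q \<omega>"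
        by (intro sum.cong refl) (simp add: power2_eq_square)
      finally show ?thesis by simp
    qed
    ultimately show ?thesis by simp
  qed
  have "fourier ?\<phi> x = of_real ((sqrt (2 * pi) * s) ^ CARD('n) / detX) * gauss (s *\<^sub>R (x - w))" for x
  proof -
    have "fourier ?\<phi> x = fourier (\<lambda>u. \<Prod>k\<in>UNIV. wave_packet (1 / s) (v k) (u $ k)) (coords Xd x) / of_real detX"
      by (subst fourier_coords) (use \<phi> in \<open>auto simp: coords_inv\<close>)
    also have "fourier (\<lambda>u. \<Prod>k\<in>UNIV. wave_packet (1 / s) (v k) (u $ k)) (coords Xd x)
        = (\<Prod>k\<in>UNIV. fourier (wave_packet (1 / s) (v k)) (coords Xd x $ k))"
      by (rule fourier_product) (rule wave_packet_schwartz[OF \<delta>])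
    also have "\<dots> = (\<Prod>k\<in>UNIV. of_real (sqrt (2 * pi) * s) * of_real (exp (- (s * ((x - w) \<bullet> Xd k))\<^sup>2 / 2)))"
      using s by (intro prod.cong refl, subst fourier_wave_packet[OF \<delta>])
        (simp add: v_def coords_def inner_diff_left mult.commute)
    also have "\<dots> = of_real (sqrt (2 * pi) * s) ^ CARD('n) * of_real (\<Prod>k\<in>UNIV. exp (- (s * ((x - w) \<bullet> Xd k))\<^sup>2 / 2))"
      by (simp add: prod.distrib)
    also have "(\<Prod>k\<in>UNIV. exp (- (s * ((x - w) \<bullet> Xd k))\<^sup>2 / 2)) = exp (- ((norm (coords Xd (s *\<^sub>R (x - w))))\<^sup>2 / 2))"
      by (simp add: exp_sum[symmetric] norm_coords_square sum_divide_distrib sum_negf)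
    finally show ?thesis
      by (simp add: gauss_def exp_of_real[symmetric])
  qed
  then have "gauss (s *\<^sub>R (x - w)) = of_real (detX / (sqrt (2 * pi) * s) ^ CARD('n)) * fourier ?\<phi> x" for x
    using det_nonzero s by (simp add: power_mult_distrib)
  from that[OF \<phi> this] show ?thesis .
qed

text \<open>Two cone splines agree on the Fourier transform of every product of one-variable Schwartz functions in
  the coordinates \<open>coords X \<omega>\<close>, in particular on all dilates and translates of \<open>gauss\<close>.\<close>

theorem cone_spline_unique:
  assumes \<alpha>: "\<And>k. 0 < \<alpha> k" and C: "is_cone_spline \<alpha> X C" and \<phi>: "\<phi> \<in> schwartz"
  shows "C \<phi> = dist_of_fun (cone_density \<alpha>) \<phi>"
proof -
  let ?C0 = "dist_of_fun (cone_density \<alpha>)"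
  note C0 = cone_spline_exists[OF \<alpha>]
  have tC: "tempered C" "tempered ?C0" using C C0 by (auto simp: is_cone_spline_def)
  have eval_tensor: "D (fourier \<psi>) = (\<Prod>k\<in>UNIV. cone_factor (\<alpha> k) (p k)) / of_real detX"
    if D: "is_cone_spline \<alpha> X D" and p: "\<And>k. p k \<in> schwartz"
      and \<psi>: "\<psi> = (\<lambda>\<omega>. \<Prod>k\<in>UNIV. p k (coords X \<omega> $ k))" "\<psi> \<in> schwartz" for D p \<psi>
  proof -
    obtain T where T: "is_tensor_product (\<lambda>k. cone_factor (\<alpha> k)) T"
      "\<And>\<phi>. \<phi> \<in> schwartz \<Longrightarrow> dist_fourier D \<phi> = dist_pullback (coords X) T \<phi>"
      using D unfolding is_cone_spline_def coords_def[abs_def] by blast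
    have "D (fourier \<psi>) = T (\<lambda>u. \<Prod>k\<in>UNIV. p k (u $ k)) / of_real detX"
      using T(2)[OF \<psi>(2)] by (simp add: dist_fourier_def dist_pullback_def \<psi>(1) coords_inv)
    also have "T (\<lambda>u. \<Prod>k\<in>UNIV. p k (u $ k)) = (\<Prod>k\<in>UNIV. cone_factor (\<alpha> k) (p k))"
      using T(1) p by (simp add: is_tensor_product_def)
    finally show ?thesis .
  qed
  have "C \<phi> - ?C0 \<phi> = 0"
  proof (rule tempered_vanishing_on_dilates[OF tempered_diff[OF tC] gauss_schwartz gauss_integral_nonzero _ \<phi>])
    fix s :: real and w :: "real^'n" assume s: "0 < s"
    obtain v where v: "(\<lambda>\<omega>. \<Prod>k\<in>UNIV. wave_packet (1 / s) (v k) (coords X \<omega> $ k)) \<in> schwartz"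
      and g: "\<And>x. gauss (s *\<^sub>R (x - w)) = of_real (detX / (sqrt (2 * pi) * s) ^ CARD('n)) *
        fourier (\<lambda>\<omega>. \<Prod>k\<in>UNIV. wave_packet (1 / s) (v k) (coords X \<omega> $ k)) x"
      using gauss_dilate_as_fourier[OF s, of w] by blast
    let ?\<psi> = "\<lambda>\<omega>. \<Prod>k\<in>UNIV. wave_packet (1 / s) (v k) (coords X \<omega> $ k)"
    let ?a = "complex_of_real (detX / (sqrt (2 * pi) * s) ^ CARD('n))"
    have a: "?a \<noteq> 0" using s det_nonzero by simp
    have "(\<lambda>x. gauss (s *\<^sub>R (x - w))) \<in> schwartz" by (rule schwartz_dilation[OF gauss_schwartz s])
    from schwartz_add_scale[OF schwartz_zero this, of "inverse ?a"]
    have F: "fourier ?\<psi> \<in> schwartz"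
      using a by (simp add: g)
    have p: "wave_packet (1 / s) (v k) \<in> schwartz" for k
      using s by (intro wave_packet_schwartz) simp
    have "C (fourier ?\<psi>) = ?C0 (fourier ?\<psi>)"
      using eval_tensor[OF C p refl v] eval_tensor[OF C0 p refl v] by simp
    moreover have hom: "D (\<lambda>x. a * fourier ?\<psi> x) = a * D (fourier ?\<psi>)" if "tempered D" for D a
      using that F by (simp add: tempered_def)
    ultimately show "C (\<lambda>x. gauss (s *\<^sub>R (x - w))) - ?C0 (\<lambda>x. gauss (s *\<^sub>R (x - w))) = 0"
      unfolding g hom[OF tC(1)] hom[OF tC(2)] by simp
  qed
  then show ?thesis by simp
qed

end

theorem proposition5p1:
  fixes X Xd :: "'n::finite \<Rightarrow> real^'n" and \<alpha> :: "'n \<Rightarrow> real" and M :: "real^'n^'n"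
  assumes "inj X" and "independent (range X)"
    and M: "M = (\<chi> i k. X k $ i)"
    and dual: "\<And>j k. X j \<bullet> Xd k = (if j = k then 1 else 0)"
    and "\<And>k. \<alpha> k > 0"
  shows "(\<exists>C. is_cone_spline \<alpha> X C) \<and>
    (\<forall>C. is_cone_spline \<alpha> X C \<longrightarrow>
      represented_by C (\<lambda>x. 1 / \<bar>det M\<bar> *
        (\<Prod>k\<in>UNIV. trunc_power (x \<bullet> Xd k) (\<alpha> k - 1) / Gamma (\<alpha> k))))"
proof -
  interpret dual_bases X Xd by standard (rule dual)
  note \<alpha> = \<open>\<And>k. \<alpha> k > 0\<close>
  have density: "(\<lambda>x. 1 / \<bar>det M\<bar> * (\<Prod>k\<in>UNIV. trunc_power (x \<bullet> Xd k) (\<alpha> k - 1) / Gamma (\<alpha> k))) = cone_density \<alpha>"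
    by (simp add: cone_density_def fun_eq_iff det_coords M orthant_density_def half_line_density_def coords_def)
  obtain N where N: "integrable lborel (\<lambda>x. cone_density \<alpha> x / (1 + norm x) ^ N)"
    by (rule cone_density_moderate[OF \<alpha>])
  have "represented_by (dist_of_fun (cone_density \<alpha>)) (cone_density \<alpha>)"
    by (rule moderate_tempered(2)[OF N]) measurable
  then have "represented_by C (cone_density \<alpha>)" if "is_cone_spline \<alpha> X C" for C
    using cone_spline_unique[OF \<alpha> that] by (simp add: represented_by_def)
  then show ?thesis
    unfolding density using cone_spline_exists[of \<alpha>, OF \<alpha>] by blast
qed

end
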